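(* There exist an open neighbourhood $V$ of the origin $0$ in $\mathbb{R}^8$ and a $C^{\infty}$ vector field $X$ defined on $V$ such that: (i) $0$ is a nondegenerate multicentre for $X$; (ii) $X$ is not orbitally equivalent to the linear vector field $x\mapsto DX(0)x$ in any neighbourhood of $0$, i.e. $X$ is not linearizable at $0$. Moreover, $X$ has a real analytic first integral whose level sets (apart from the level $\{0\}$) are Euclidean $7$-spheres in $\mathbb{R}^8$, and the period function of $X$ is unbounded on each such invariant $7$-dimensional sphere of sufficiently small radius.
   Context: Nondegenerate multicentre: let $X$ be a $C^1$ vector field defined in a neighbourhood $V$ of the origin $0\in\mathbb{R}^{2n}$, $n>1$. Then $0$ is a nondegenerate multicentre for $X$ if (a) $X(0)=0$; (b) the differential $DX(0)$ is the infinitesimal generator of a $1$-parameter group of nondegenerate rotations (i.e. $e^{tDX(0)}$, $t\in\mathbb{R}$, is a one-parameter group of rotations of $\mathbb{R}^{2n}$ with $DX(0)$ invertible); (c) there exists a neighbourhood $U\subset V$ of $0$ such that $U-\{0\}$ is foliated by closed curves which are trajectories of $X$ (every trajectory of $X$ in $U-\{0\}$ is a nonconstant periodic orbit). Period function: the function $T$ on $U-\{0\}$ assigning to each point $p$ the minimal period (first-return time) $T(p)>0$ of the periodic orbit of $X$ through $p$. Orbital equivalence: two vector fields $X$ on an open set $U$ and $Y$ on an open set $W$, with stationary points $q\in U$ and $p\in W$, are orbitally equivalent if there exist a diffeomorphism $\phi:U\to W$ (taking $q$ to $p$) and a smooth positive function $f:U\to\mathbb{R}$ such that $\phi_*(fX)=Y$.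 A vector field $X$ with stationary point $0$ is linearizable at $0$ if, after restriction to suitable neighbourhoods of $0$, it is orbitally equivalent to its linearization $x\mapsto DX(0)x$. *)

theory Defs
  imports "HOL-Analysis.Analysis"
begin

section \<open>Regularity on open sets\<close>

text \<open>
  \<open>Ck_on\<close> and \<open>smooth_on\<close> are meant for open sets \<open>S\<close> (the derivatives are taken \<open>at x\<close>, not
  \<open>at x within S\<close>). Only the values of \<open>f\<close> on \<open>S\<close> matter then.
  The maps \<open>x \<mapsto> Df(x) v\<close>, \<open>v\<close> arbitrary, are the components of \<open>Df\<close>.
\<close>

primrec Ck_on :: "nat \<Rightarrow> 'a::euclidean_space set \<Rightarrow> ('a \<Rightarrow> 'b::euclidean_space) \<Rightarrow> bool" where
  "Ck_on 0 S f \<longleftrightarrow> continuous_on S f"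
| "Ck_on (Suc k) S f \<longleftrightarrow>
     (\<forall>x\<in>S. f differentiable (at x)) \<and> (\<forall>v. Ck_on k S (\<lambda>x. frechet_derivative f (at x) v))"

definition smooth_on :: "'a::euclidean_space set \<Rightarrow> ('a \<Rightarrow> 'b::euclidean_space) \<Rightarrow> bool" where
  "smooth_on S f \<longleftrightarrow> (\<forall>k. Ck_on k S f)"

text \<open>Multi-indices are functions \<open>'n \<Rightarrow> nat\<close>; \<open>has_sum\<close> means unconditional convergence.\<close>

definition real_analytic_on :: "(real ^ 'n) set \<Rightarrow> (real ^ 'n \<Rightarrow> real) \<Rightarrow> bool" where
  "real_analytic_on S f \<longleftrightarrow>
     (\<forall>p\<in>S. \<exists>r>0. \<exists>c :: ('n \<Rightarrow> nat) \<Rightarrow> real. \<forall>x\<in>ball p r.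
        ((\<lambda>\<alpha>. c \<alpha> * (\<Prod>i\<in>UNIV. (x $ i - p $ i) ^ \<alpha> i)) has_sum f x) UNIV)"


section \<open>Trajectories\<close>

text \<open>
  A vector field on an open set \<open>V\<close> is a total function of which only the values on \<open>V\<close> are used.
\<close>

definition integral_curve ::
    "'a::euclidean_space set \<Rightarrow> ('a \<Rightarrow> 'a) \<Rightarrow> real set \<Rightarrow> (real \<Rightarrow> 'a) \<Rightarrow> bool" where
  "integral_curve S X I \<gamma> \<longleftrightarrow>
     (\<forall>t\<in>I. \<gamma> t \<in> S \<and> (\<gamma> has_vector_derivative X (\<gamma> t)) (at t))"

definition periodic_trajectory ::
    "'a::euclidean_space set \<Rightarrow> ('a \<Rightarrow> 'a) \<Rightarrow> (real \<Rightarrow> 'a) \<Rightarrow> bool" where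
  "periodic_trajectory S X \<gamma> \<longleftrightarrow>
     integral_curve S X UNIV \<gamma> \<and> (\<exists>T>0. \<forall>t. \<gamma> (t + T) = \<gamma> t) \<and> \<not> \<gamma> constant_on UNIV"

text \<open>
  First-return time. For a \<open>C\<^sup>1\<close> field the trajectory \<open>\<gamma>\<close> through \<open>p\<close> is unique, so that the
  description is proper whenever \<open>p\<close> lies on a nonconstant periodic trajectory; the value is
  unspecified at other points.
\<close>

definition period_function ::
    "'a::euclidean_space set \<Rightarrow> ('a \<Rightarrow> 'a) \<Rightarrow> 'a \<Rightarrow> real" where
  "period_function S X p =
     (THE T. T > 0 \<and> (\<exists>\<gamma>. integral_curve S X UNIV \<gamma> \<and> \<gamma> 0 = p \<and> \<gamma> T = p \<and>
                           (\<forall>s. 0 < s \<and> s < T \<longrightarrow> \<gamma> s \<noteq> p)))"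

definition first_integral ::
    "'a::euclidean_space set \<Rightarrow> ('a \<Rightarrow> 'a) \<Rightarrow> ('a \<Rightarrow> real) \<Rightarrow> bool" where
  "first_integral S X H \<longleftrightarrow>
     \<not> H constant_on S \<and>
     (\<forall>I \<gamma>. open I \<and> is_interval I \<and> integral_curve S X I \<gamma> \<longrightarrow> (\<lambda>t. H (\<gamma> t)) constant_on I)"


section \<open>Nondegenerate multicentres\<close>

text \<open>
  The type class operations on \<open>real ^ 'n ^ 'n\<close> (product and powers) are componentwise, so the
  exponential series is written with the matrix product.
\<close>

definition matrix_exp :: "real ^ 'n ^ 'n \<Rightarrow> real ^ 'n ^ 'n" where
  "matrix_exp A = (\<Sum>k. (1 / fact k) *\<^sub>R (((**) A ^^ k) (mat 1)))"

definition generates_nondegenerate_rotations :: "real ^ 'n ^ 'n \<Rightarrow> bool" where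
  "generates_nondegenerate_rotations A \<longleftrightarrow>
     (\<forall>t::real. rotation_matrix (matrix_exp (t *\<^sub>R A))) \<and> invertible A"

definition nondegenerate_multicentre ::
    "(real ^ 'n) set \<Rightarrow> (real ^ 'n \<Rightarrow> real ^ 'n) \<Rightarrow> bool" where
  "nondegenerate_multicentre V X \<longleftrightarrow>
     (\<exists>n>1. CARD('n) = 2 * n) \<and> open V \<and> 0 \<in> V \<and> Ck_on 1 V X \<and>
     X 0 = 0 \<and>
     generates_nondegenerate_rotations (matrix (frechet_derivative X (at 0))) \<and>
     (\<exists>U. open U \<and> 0 \<in> U \<and> U \<subseteq> V \<and>
        (\<forall>p\<in>U - {0}. \<exists>\<gamma>. periodic_trajectory (U - {0}) X \<gamma> \<and> \<gamma> 0 = p))"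


section \<open>Orbital equivalence and linearizability\<close>

definition diffeomorphism ::
    "'a::euclidean_space set \<Rightarrow> 'b::euclidean_space set \<Rightarrow> ('a \<Rightarrow> 'b) \<Rightarrow> bool" where
  "diffeomorphism U W \<phi> \<longleftrightarrow>
     bij_betw \<phi> U W \<and> smooth_on U \<phi> \<and> smooth_on W (inv_into U \<phi>)"

definition pushforward ::
    "'a::euclidean_space set \<Rightarrow> ('a \<Rightarrow> 'b::euclidean_space) \<Rightarrow> ('a \<Rightarrow> 'a) \<Rightarrow> 'b \<Rightarrow> 'b" where
  "pushforward U \<phi> Z y =
     (let x = inv_into U \<phi> y in frechet_derivative \<phi> (at x) (Z x))"

definition orbitally_equivalent ::
    "'a::euclidean_space set \<Rightarrow> ('a \<Rightarrow> 'a) \<Rightarrow> 'a \<Rightarrow>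
     'b::euclidean_space set \<Rightarrow> ('b \<Rightarrow> 'b) \<Rightarrow> 'b \<Rightarrow> bool" where
  "orbitally_equivalent U X q W Y p \<longleftrightarrow>
     open U \<and> q \<in> U \<and> X q = 0 \<and> open W \<and> p \<in> W \<and> Y p = 0 \<and>
     (\<exists>\<phi> (f :: 'a \<Rightarrow> real).
        diffeomorphism U W \<phi> \<and> \<phi> q = p \<and>
        smooth_on U f \<and> (\<forall>x\<in>U. f x > 0) \<and>
        (\<forall>y\<in>W. pushforward U \<phi> (\<lambda>x. f x *\<^sub>R X x) y = Y y))"

definition linearizable_at_0 :: "'a::euclidean_space set \<Rightarrow> ('a \<Rightarrow> 'a) \<Rightarrow> bool" where
  "linearizable_at_0 V X \<longleftrightarrow>
     (\<exists>U W. U \<subseteq> V \<and> orbitally_equivalent U X 0 W (frechet_derivative X (at 0)) 0)"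

end

theory Submission
  imports Defs
begin

text \<open>
  The field is a flat perturbation of \<open>p \<mapsto> i p\<close> on \<open>\<complex>\<^sup>4 = \<real>\<^sup>8\<close>. The orbits of \<open>i p\<close> on the
  sphere \<open>S\<^sup>7\<close> are the fibres, of period \<open>2\<pi>\<close>, of the Hopf fibration over complex projective
  3-space, and the perturbation is modelled on Thurston's flow on the Heisenberg nilmanifold. It
  lives on the part of \<open>S\<^sup>7\<close> that lies over a tube around a 3-torus with angles \<open>x, y, u\<close>, on whose
  2-tori \<open>u = const\<close> the fibration has degree one.

  On the universal cover of that part the coordinates are \<open>x, y, u\<close>, the position \<open>z\<close> along the
  fibres, and a transverse parameter \<open>q\<close> in a ball of \<open>\<real>\<^sup>3\<close>; degree one means that
  \<open>(x, y + 2\<pi>, z)\<close> and \<open>(x, y, z + x)\<close> are the same point, so that \<open>\<partial>\<^sub>y\<close> and \<open>\<partial>\<^sub>x - (y/2\<pi>) \<partial>\<^sub>z\<close> are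
  well defined. Consider the field
  \<open>\<partial>\<^sub>z + \<eta> (cos u (\<partial>\<^sub>x - (y/2\<pi>) \<partial>\<^sub>z) + sin u \<partial>\<^sub>y) - (\<eta>\<^sup>2/4\<pi>) \<partial>\<^sub>u\<close>, where \<open>\<eta> \<ge> 0\<close> depends only on \<open>q\<close>.
  When \<open>\<eta> > 0\<close>, the point \<open>(x, y)\<close> runs once around a circle of radius \<open>R = 4\<pi>/\<eta>\<close> in the plane
  while \<open>u\<close> turns once, which takes the time \<open>T = 8\<pi>\<^sup>2/\<eta>\<^sup>2\<close>. Meanwhile \<open>z\<close> grows by \<open>T\<close> because of
  \<open>\<partial>\<^sub>z\<close> and loses \<open>\<pi> R\<^sup>2 / 2\<pi> = T\<close> because the lift of the circle encloses an area. The two effects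
  cancel exactly for every \<open>\<eta>\<close>, so the orbit closes after the time \<open>T\<close>, which is arbitrarily
  large, whereas for \<open>\<eta> = 0\<close> the orbit is a Hopf fibre again (\<open>long_orbit\<close>, \<open>short_orbit\<close>).

  Taking for \<open>\<eta>\<close> a flat cutoff in \<open>q\<close> times \<open>exp (- 1 / \<bar>p\<bar>\<^sup>2)\<close> makes the perturbation smooth on
  all of \<open>\<real>\<^sup>8\<close>: off the origin by \<open>smooth_at_cone_field\<close>, at the origin by
  \<open>smooth_flat_homogeneous\<close>. It also leaves the linear part equal to multiplication by \<open>i\<close> and
  gives unbounded periods on each sphere (\<open>period_function_unbounded\<close>). The latter excludes
  linearizability: the linear orbits have period \<open>2\<pi>\<close>, and an orbital equivalence changes time by a
  factor that is bounded near the origin (\<open>not_linearizable_multicentre_field\<close>).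

  To find the tori, write \<open>\<complex>\<^sup>4\<close> as the set of pairs \<open>(g, h)\<close> of quaternions. The circle acts by
  multiplication from the left, so \<open>k = g\<inverse> h\<close> is invariant and its four real components can
  carry \<open>x\<close>, \<open>y\<close>, \<open>u\<close> and one transverse parameter. The direction of \<open>g\<close> is that of a nowhere
  vanishing quaternionic function \<open>Q (x, y)\<close> with \<open>Q (x, y + 2\<pi>) = e\<^sup>i\<^sup>x Q (x, y)\<close>, moved by a small
  amount that depends on \<open>q\<close>.
\<close>

section \<open>Calculus of smooth maps\<close>

lemma Ck_on_cong:
  assumes "open S" "\<And>x. x \<in> S \<Longrightarrow> f x = g x"
  shows "Ck_on k S f \<longleftrightarrow> Ck_on k S g"
  using assms(2)
proof (induction k arbitrary: f g)
  case 0
  then show ?case by (simp cong: continuous_on_cong)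
next
  case (Suc k)
  have d: "f differentiable (at x) \<longleftrightarrow> g differentiable (at x)" if "x \<in> S" for x
    using that Suc.prems assms(1) unfolding differentiable_def
    by (metis has_derivative_transform_within_open)
  have e: "frechet_derivative f (at x) = frechet_derivative g (at x)"
    if "x \<in> S" "f differentiable (at x)" for x
    by (rule frechet_derivative_transform_within_open[OF that(2) assms(1) that(1) Suc.prems])
  have "(\<forall>x\<in>S. f differentiable (at x)) \<Longrightarrow>
      Ck_on k S (\<lambda>x. frechet_derivative f (at x) v) = Ck_on k S (\<lambda>x. frechet_derivative g (at x) v)" for v
    using Suc.IH[of "\<lambda>x. frechet_derivative f (at x) v" "\<lambda>x. frechet_derivative g (at x) v"] e by simp
  then show ?case using d by auto
qed

lemma Ck_on_subset: "Ck_on k S f \<Longrightarrow> T \<subseteq> S \<Longrightarrow> Ck_on k T f"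
  by (induction k arbitrary: f) (auto intro: continuous_on_subset)

lemma Ck_on_continuous: "Ck_on k S f \<Longrightarrow> continuous_on S f"
  by (cases k) (auto intro: continuous_at_imp_continuous_on differentiable_imp_continuous_within)

lemma Ck_on_SucD: "Ck_on (Suc k) S f \<Longrightarrow> Ck_on k S f"
proof (induction k arbitrary: f)
  case 0
  then show ?case using Ck_on_continuous by (metis Ck_on.simps(1))
next
  case (Suc k)
  show ?case unfolding Ck_on.simps(2)[of k]
    using Suc.prems Suc.IH unfolding Ck_on.simps(2)[of "Suc k"] by blast
qed

lemma Ck_on_SucI:
  assumes "open S" "\<And>x. x \<in> S \<Longrightarrow> (f has_derivative f' x) (at x)"
    and "\<And>v. Ck_on k S (\<lambda>x. f' x v)"
  shows "Ck_on (Suc k) S f"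
proof -
  have "frechet_derivative f (at x) = f' x" if "x \<in> S" for x
    using assms(2)[OF that] frechet_derivative_at by metis
  then have "Ck_on k S (\<lambda>x. frechet_derivative f (at x) v) = Ck_on k S (\<lambda>x. f' x v)" for v
    by (intro Ck_on_cong assms(1)) simp
  moreover have "f differentiable (at x)" if "x \<in> S" for x
    using assms(2)[OF that] by (auto simp: differentiable_def)
  ultimately show ?thesis using assms(3) by auto
qed

lemma Ck_on_has_derivative:
  "Ck_on (Suc k) S f \<Longrightarrow> x \<in> S \<Longrightarrow> (f has_derivative frechet_derivative f (at x)) (at x)"
  using frechet_derivative_works by auto

lemma Ck_on_local:
  assumes "\<And>x. x \<in> S \<Longrightarrow> \<exists>T. open T \<and> x \<in> T \<and> Ck_on k T f"
  shows "Ck_on k S f"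
  using assms
proof (induction k arbitrary: f)
  case 0
  have "isCont f x" if "x \<in> S" for x
    using 0[OF that] continuous_on_eq_continuous_at by auto
  then show ?case by (simp add: continuous_at_imp_continuous_on)
next
  case (Suc k)
  have "f differentiable (at x)" if "x \<in> S" for x
    using Suc.prems[OF that] by auto
  moreover have "Ck_on k S (\<lambda>x. frechet_derivative f (at x) v)" for v
  proof (rule Suc.IH)
    fix x assume "x \<in> S"
    from Suc.prems[OF this] show "\<exists>T. open T \<and> x \<in> T \<and> Ck_on k T (\<lambda>x. frechet_derivative f (at x) v)"
      unfolding Ck_on.simps(2) by blast
  qed
  ultimately show ?case by simp
qed

lemma Ck_on_const: "Ck_on k S (\<lambda>x. c)"
proof (induction k arbitrary: c)
  case (Suc k)
  have "(\<lambda>x. frechet_derivative (\<lambda>x::'a. c) (at x) v) = (\<lambda>x. 0)" for v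
    by (auto simp: frechet_derivative_const)
  then show ?case using Suc by simp
qed simp

lemma Ck_on_bounded_linear_of:
  assumes "open S" "bounded_linear L" "Ck_on k S f"
  shows "Ck_on k S (\<lambda>x. L (f x))"
  using assms(3)
proof (induction k arbitrary: f)
  case 0
  then show ?case using bounded_linear.continuous_on[OF assms(2)] by auto
next
  case (Suc k)
  show ?case
  proof (rule Ck_on_SucI[OF assms(1)])
    fix x assume "x \<in> S"
    from bounded_linear.has_derivative[OF assms(2) Ck_on_has_derivative[OF Suc.prems this]]
    show "((\<lambda>x. L (f x)) has_derivative (\<lambda>v. L (frechet_derivative f (at x) v))) (at x)" .
  next
    fix v show "Ck_on k S (\<lambda>x. L (frechet_derivative f (at x) v))"
      using Suc by simp
  qed
qed

lemma Ck_on_id: "open S \<Longrightarrow> Ck_on k S (\<lambda>x. x)"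
proof (cases k)
  case (Suc n)
  assume "open S"
  show ?thesis unfolding Suc
    by (rule Ck_on_SucI[OF \<open>open S\<close>, where f' = "\<lambda>x v. v"]) (auto simp: Ck_on_const)
qed simp

lemma Ck_on_add:
  assumes "open S" "Ck_on k S f" "Ck_on k S g"
  shows "Ck_on k S (\<lambda>x. f x + g x)"
  using assms(2,3)
proof (induction k arbitrary: f g)
  case 0
  then show ?case by (auto intro: continuous_intros)
next
  case (Suc k)
  show ?case
  proof (rule Ck_on_SucI[OF assms(1)])
    fix x assume x: "x \<in> S"
    show "((\<lambda>x. f x + g x) has_derivative (\<lambda>v. frechet_derivative f (at x) v + frechet_derivative g (at x) v)) (at x)"
      by (intro has_derivative_add Ck_on_has_derivative[OF Suc.prems(1) x] Ck_on_has_derivative[OF Suc.prems(2) x])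
  next
    fix v show "Ck_on k S (\<lambda>x. frechet_derivative f (at x) v + frechet_derivative g (at x) v)"
      using Suc by simp
  qed
qed

lemma Ck_on_bilinear:
  assumes "open S" "bounded_bilinear bop" "Ck_on k S f" "Ck_on k S g"
  shows "Ck_on k S (\<lambda>x. bop (f x) (g x))"
  using assms(3,4)
proof (induction k arbitrary: f g)
  case 0
  then show ?case using bounded_bilinear.continuous_on[OF assms(2)] by auto
next
  case (Suc k)
  show ?case
  proof (rule Ck_on_SucI[OF assms(1)])
    fix x assume x: "x \<in> S"
    from bounded_bilinear.FDERIV[OF assms(2) Ck_on_has_derivative[OF Suc.prems(1) x] Ck_on_has_derivative[OF Suc.prems(2) x]]
    show "((\<lambda>x. bop (f x) (g x)) has_derivative
       (\<lambda>v. bop (f x) (frechet_derivative g (at x) v) + bop (frechet_derivative f (at x) v) (g x))) (at x)" .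
  next
    fix v
    show "Ck_on k S (\<lambda>x. bop (f x) (frechet_derivative g (at x) v) + bop (frechet_derivative f (at x) v) (g x))"
      using Suc.prems by (intro Ck_on_add[OF assms(1)] Suc.IH) (auto intro: Ck_on_SucD)
  qed
qed

lemma Ck_on_sum:
  assumes "open S" "\<And>i. i \<in> I \<Longrightarrow> Ck_on k S (f i)"
  shows "Ck_on k S (\<lambda>x. \<Sum>i\<in>I. f i x)"
  using assms(2)
  by (induction I rule: infinite_finite_induct) (auto intro: Ck_on_const Ck_on_add[OF assms(1)])

lemma linear_eq_sum_Basis:
  fixes L :: "'a::euclidean_space \<Rightarrow> 'b::real_vector"
  assumes "linear L"
  shows "L v = (\<Sum>b\<in>Basis. (v \<bullet> b) *\<^sub>R L b)"
proof -
  have "L v = L (\<Sum>b\<in>Basis. (v \<bullet> b) *\<^sub>R b)" by (simp add: euclidean_representation)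
  also have "\<dots> = (\<Sum>b\<in>Basis. (v \<bullet> b) *\<^sub>R L b)"
    by (simp add: linear_sum[OF assms] linear_cmul[OF assms])
  finally show ?thesis .
qed

text \<open>The basis expansion of the derivative reduces the chain rule of order \<open>k + 1\<close> to sums and
  products of functions of class \<open>k\<close>.\<close>

lemma Ck_on_compose:
  assumes "open S" "open T" "Ck_on k T f" "Ck_on k S g" "g ` S \<subseteq> T"
  shows "Ck_on k S (\<lambda>x. f (g x))"
  using assms(3-5)
proof (induction k arbitrary: f g)
  case 0
  then show ?case by (auto intro: continuous_on_compose2)
next
  case (Suc k)
  let ?f = "\<lambda>y b. frechet_derivative f (at y) b" and ?g = "\<lambda>x v. frechet_derivative g (at x) v"
  show ?case
  proof (rule Ck_on_SucI[OF assms(1)])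
    fix x assume x: "x \<in> S"
    then have gx: "g x \<in> T" using Suc.prems by auto
    note df = Ck_on_has_derivative[OF Suc.prems(1) gx] and dg = Ck_on_has_derivative[OF Suc.prems(2) x]
    have eq: "?f (g x) (?g x v) = (\<Sum>b\<in>Basis. (?g x v \<bullet> b) *\<^sub>R ?f (g x) b)" for v
      using df by (intro linear_eq_sum_Basis has_derivative_linear)
    have "((\<lambda>x. f (g x)) has_derivative (\<lambda>v. ?f (g x) (?g x v))) (at x)"
      using diff_chain_at[OF dg df] by (simp add: o_def)
    then show "((\<lambda>x. f (g x)) has_derivative (\<lambda>v. \<Sum>b\<in>Basis. (?g x v \<bullet> b) *\<^sub>R ?f (g x) b)) (at x)"
      by (simp add: eq)
  next
    fix v
    have "Ck_on k S (\<lambda>x. ?f (g x) b)" for b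
      using Suc.prems(1,3) Suc.IH[of "\<lambda>y. ?f y b" g] Ck_on_SucD[OF Suc.prems(2)] by auto
    moreover have "Ck_on k S (\<lambda>x. ?g x v \<bullet> b)" for b
      using Suc.prems(2) by (intro Ck_on_bounded_linear_of[OF assms(1) bounded_linear_inner_left]) simp
    ultimately show "Ck_on k S (\<lambda>x. \<Sum>b\<in>Basis. (?g x v \<bullet> b) *\<^sub>R ?f (g x) b)"
      by (intro Ck_on_sum[OF assms(1)] Ck_on_bilinear[OF assms(1) bounded_bilinear_scaleR])
  qed
qed

text \<open>The germ version of \<^const>\<open>smooth_on\<close>: compositions of maps that are defined piecewise or on
  parts of the space can be treated without tracking domains.\<close>

definition smooth_at :: "'a::euclidean_space \<Rightarrow> ('a \<Rightarrow> 'b::euclidean_space) \<Rightarrow> bool" where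
  "smooth_at p f \<longleftrightarrow> (\<exists>S. open S \<and> p \<in> S \<and> smooth_on S f)"

lemma smooth_on_iff_smooth_at: "open S \<Longrightarrow> smooth_on S f \<longleftrightarrow> (\<forall>p\<in>S. smooth_at p f)"
  unfolding smooth_at_def smooth_on_def
  by (auto intro!: Ck_on_local)

lemma smooth_at_has_derivative:
  "smooth_at p f \<Longrightarrow> (f has_derivative frechet_derivative f (at p)) (at p)"
  unfolding smooth_at_def smooth_on_def using Ck_on_has_derivative by blast

lemma smooth_at_linear_derivative: "smooth_at p f \<Longrightarrow> linear (frechet_derivative f (at p))"
  using smooth_at_has_derivative has_derivative_linear by blast

lemma smooth_at_isCont: "smooth_at p f \<Longrightarrow> isCont f p"
  using smooth_at_has_derivative has_derivative_continuous by blast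

lemma smooth_at_eventually: "smooth_at p f \<Longrightarrow> \<forall>\<^sub>F x in nhds p. smooth_at x f"
  unfolding smooth_at_def eventually_nhds by blast

lemma smooth_at_cong:
  assumes "smooth_at p f" "\<forall>\<^sub>F x in nhds p. f x = g x"
  shows "smooth_at p g"
proof -
  obtain S where S: "open S" "p \<in> S" "smooth_on S f" using assms(1) by (auto simp: smooth_at_def)
  obtain T where T: "open T" "p \<in> T" "\<And>x. x \<in> T \<Longrightarrow> f x = g x"
    using assms(2) by (auto simp: eventually_nhds)
  have "Ck_on k (S \<inter> T) g" for k
    using S T Ck_on_cong[of "S \<inter> T" f g k] Ck_on_subset[of k S f "S \<inter> T"] by (auto simp: smooth_on_def)
  then show ?thesis unfolding smooth_at_def smooth_on_def using S T
    by (intro exI[of _ "S \<inter> T"]) auto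
qed

lemma smooth_at_pairwise:
  assumes "smooth_at p f" "smooth_at p g"
    and "\<And>S k. open S \<Longrightarrow> Ck_on k S f \<Longrightarrow> Ck_on k S g \<Longrightarrow> Ck_on k S h"
  shows "smooth_at p h"
proof -
  obtain S T where S: "open S" "p \<in> S" "smooth_on S f" and T: "open T" "p \<in> T" "smooth_on T g"
    using assms by (auto simp: smooth_at_def)
  have "Ck_on k (S \<inter> T) h" for k
    using S T by (intro assms(3)) (auto intro: Ck_on_subset simp: smooth_on_def)
  then show ?thesis unfolding smooth_at_def smooth_on_def using S T
    by (intro exI[of _ "S \<inter> T"]) auto
qed

lemma smooth_at_compose:
  assumes "smooth_at (g p) f" "smooth_at p g"
  shows "smooth_at p (\<lambda>x. f (g x))"
proof -
  obtain S T where S: "open S" "p \<in> S" "smooth_on S g" and T: "open T" "g p \<in> T" "smooth_on T f"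
    using assms by (auto simp: smooth_at_def)
  have "continuous_on S g" using S Ck_on_continuous by (auto simp: smooth_on_def)
  then have o: "open (S \<inter> g -` T)"
    by (rule continuous_open_preimage[OF _ S(1) T(1)])
  have "Ck_on k (S \<inter> g -` T) (\<lambda>x. f (g x))" for k
    by (rule Ck_on_compose[OF o T(1)], use S T in \<open>auto simp: smooth_on_def intro: Ck_on_subset[of k S g]\<close>)
  then show ?thesis unfolding smooth_at_def smooth_on_def using S T o
    by (intro exI[of _ "S \<inter> g -` T"]) auto
qed

named_theorems smooth_intros

lemma smooth_at_const [smooth_intros]: "smooth_at p (\<lambda>x. c)"
  unfolding smooth_at_def smooth_on_def using Ck_on_const by blast

lemma smooth_at_id [smooth_intros]: "smooth_at p (\<lambda>x. x)"
  unfolding smooth_at_def smooth_on_def using Ck_on_id by blast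

lemma smooth_at_linear_of: "bounded_linear L \<Longrightarrow> smooth_at p f \<Longrightarrow> smooth_at p (\<lambda>x. L (f x))"
  by (rule smooth_at_pairwise[of p f f]) (auto intro: Ck_on_bounded_linear_of)

lemma smooth_at_bilinear_of:
  "bounded_bilinear bop \<Longrightarrow> smooth_at p f \<Longrightarrow> smooth_at p g \<Longrightarrow> smooth_at p (\<lambda>x. bop (f x) (g x))"
  by (rule smooth_at_pairwise[of p f g]) (auto intro: Ck_on_bilinear)

lemma smooth_at_add [smooth_intros]:
  "smooth_at p f \<Longrightarrow> smooth_at p g \<Longrightarrow> smooth_at p (\<lambda>x. f x + g x)"
  by (rule smooth_at_pairwise[of p f g]) (auto intro: Ck_on_add)

lemma smooth_at_sum [smooth_intros]:
  assumes "\<And>i. i \<in> I \<Longrightarrow> smooth_at p (f i)"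
  shows "smooth_at p (\<lambda>x. \<Sum>i\<in>I. f i x)"
  using assms by (induction I rule: infinite_finite_induct) (auto intro: smooth_intros)

lemmas smooth_at_minus [smooth_intros] = smooth_at_linear_of[OF bounded_linear_minus[OF bounded_linear_ident]]
lemmas smooth_at_fst [smooth_intros] = smooth_at_linear_of[OF bounded_linear_fst]
lemmas smooth_at_snd [smooth_intros] = smooth_at_linear_of[OF bounded_linear_snd]
lemmas smooth_at_Im [smooth_intros] = smooth_at_linear_of[OF bounded_linear_Im]
lemmas smooth_at_cnj [smooth_intros] = smooth_at_linear_of[OF bounded_linear_cnj]
lemmas smooth_at_scaleR [smooth_intros] = smooth_at_bilinear_of[OF bounded_bilinear_scaleR]
lemmas smooth_at_inner [smooth_intros] = smooth_at_bilinear_of[OF bounded_bilinear_inner]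

lemma smooth_at_of_real [smooth_intros]:
  "smooth_at p f \<Longrightarrow> smooth_at p (\<lambda>x. complex_of_real (f x))"
  by (rule smooth_at_linear_of[OF bounded_linear_of_real])

lemma smooth_at_mult [smooth_intros]:
  fixes f g :: "'a::euclidean_space \<Rightarrow> 'b::{real_normed_algebra,euclidean_space}"
  shows "smooth_at p f \<Longrightarrow> smooth_at p g \<Longrightarrow> smooth_at p (\<lambda>x. f x * g x)"
  by (rule smooth_at_bilinear_of[OF bounded_bilinear_mult])

lemma smooth_at_diff [smooth_intros]:
  assumes "smooth_at p f" "smooth_at p g" shows "smooth_at p (\<lambda>x. f x - g x)"
  using smooth_at_add[OF assms(1) smooth_at_minus[OF assms(2)]] by simp

lemma smooth_at_Pair [smooth_intros]:
  assumes "smooth_at p f" "smooth_at p g" shows "smooth_at p (\<lambda>x. (f x, g x))"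
proof -
  have "bounded_linear (\<lambda>a::'b. (a, 0::'c))" "bounded_linear (\<lambda>b::'c. (0::'b, b))"
    by (auto intro: bounded_linear_Pair bounded_linear_ident bounded_linear_zero)
  from smooth_at_add[OF smooth_at_linear_of[OF this(1) assms(1)] smooth_at_linear_of[OF this(2) assms(2)]]
  show ?thesis by simp
qed

lemma Ck_on_real_antiderivative:
  fixes f :: "real \<Rightarrow> 'b::euclidean_space"
  assumes "open S" "\<And>t. t \<in> S \<Longrightarrow> (f has_vector_derivative f' t) (at t)" "Ck_on k S f'"
  shows "Ck_on (Suc k) S f"
proof (rule Ck_on_SucI[OF assms(1)])
  show "(f has_derivative (\<lambda>v. v *\<^sub>R f' x)) (at x)" if "x \<in> S" for x
    using assms(2)[OF that] by (simp add: has_vector_derivative_def)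
  show "Ck_on k S (\<lambda>x. v *\<^sub>R f' x)" for v
    by (rule Ck_on_bounded_linear_of[OF assms(1) bounded_linear_scaleR_right assms(3)])
qed

lemma Ck_on_sin_cos: "Ck_on k UNIV (sin :: real \<Rightarrow> real) \<and> Ck_on k UNIV (cos :: real \<Rightarrow> real)"
proof (induction k)
  case 0
  then show ?case by (auto intro!: continuous_intros)
next
  case (Suc k)
  have "(sin has_vector_derivative cos t) (at t)" "(cos has_vector_derivative - sin t) (at t)" for t :: real
    by (auto intro!: derivative_eq_intros simp: has_real_derivative_iff_has_vector_derivative[symmetric])
  then show ?case
    using Suc Ck_on_bounded_linear_of[OF _ bounded_linear_minus[OF bounded_linear_ident], of UNIV k sin]
    by (intro conjI Ck_on_real_antiderivative[of UNIV sin cos] Ck_on_real_antiderivative[of UNIV cos "\<lambda>t. - sin t"])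
       auto
qed

lemma Ck_on_exp: "Ck_on k UNIV (exp :: real \<Rightarrow> real)"
proof (induction k)
  case (Suc k)
  then show ?case
    by (intro Ck_on_real_antiderivative[of UNIV exp exp])
       (auto intro!: derivative_eq_intros simp: has_real_derivative_iff_has_vector_derivative[symmetric])
qed (auto intro!: continuous_intros)

lemma Ck_on_inverse: "Ck_on k (- {0}) (inverse :: real \<Rightarrow> real)"
proof (induction k)
  case (Suc k)
  have o: "open (- {0::real})" by auto
  have "Ck_on k (- {0}) (\<lambda>t::real. - (inverse t * inverse t))"
    by (intro Ck_on_bounded_linear_of[OF o bounded_linear_minus[OF bounded_linear_ident]]
        Ck_on_bilinear[OF o bounded_bilinear_mult] Suc)
  then show ?case
    by (intro Ck_on_real_antiderivative[OF o, of inverse])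
       (auto intro!: derivative_eq_intros simp: power2_eq_square has_real_derivative_iff_has_vector_derivative[symmetric])
qed (auto intro!: continuous_intros)

lemma Ck_on_ln: "Ck_on k {0<..} (ln :: real \<Rightarrow> real)"
proof (cases k)
  case (Suc n)
  have "Ck_on n {0<..} (inverse :: real \<Rightarrow> real)"
    by (rule Ck_on_subset[OF Ck_on_inverse]) auto
  then show ?thesis unfolding Suc
    by (intro Ck_on_real_antiderivative[of _ ln inverse])
       (auto intro!: derivative_eq_intros simp: divide_simps has_real_derivative_iff_has_vector_derivative[symmetric])
qed (auto intro!: continuous_intros)

lemma smooth_at_of_Ck_on:
  assumes "\<And>k. Ck_on k S h" "open S" "smooth_at p f" "f p \<in> S"
  shows "smooth_at p (\<lambda>x. h (f x))"
  by (rule smooth_at_compose[OF _ assms(3)]) (use assms in \<open>auto simp: smooth_at_def smooth_on_def\<close>)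

lemma smooth_at_sin [smooth_intros]: "smooth_at p f \<Longrightarrow> smooth_at p (\<lambda>x. sin (f x :: real))"
  by (rule smooth_at_of_Ck_on[of UNIV sin]) (auto simp: Ck_on_sin_cos)

lemma smooth_at_cos [smooth_intros]: "smooth_at p f \<Longrightarrow> smooth_at p (\<lambda>x. cos (f x :: real))"
  by (rule smooth_at_of_Ck_on[of UNIV cos]) (auto simp: Ck_on_sin_cos)

lemma smooth_at_exp [smooth_intros]: "smooth_at p f \<Longrightarrow> smooth_at p (\<lambda>x. exp (f x :: real))"
  by (rule smooth_at_of_Ck_on[of UNIV exp]) (auto simp: Ck_on_exp)

lemma smooth_at_inverse [smooth_intros]:
  "smooth_at p f \<Longrightarrow> f p \<noteq> 0 \<Longrightarrow> smooth_at p (\<lambda>x. inverse (f x :: real))"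
  by (rule smooth_at_of_Ck_on[OF Ck_on_inverse]) auto

lemma smooth_at_ln [smooth_intros]:
  "smooth_at p f \<Longrightarrow> f p > 0 \<Longrightarrow> smooth_at p (\<lambda>x. ln (f x :: real))"
  by (rule smooth_at_of_Ck_on[OF Ck_on_ln]) auto

lemma smooth_at_divide [smooth_intros]:
  assumes "smooth_at p f" "smooth_at p g" "g p \<noteq> 0" shows "smooth_at p (\<lambda>x. f x / g x :: real)"
  using smooth_at_mult[OF assms(1) smooth_at_inverse[OF assms(2,3)]] by (simp add: field_simps)

lemma smooth_at_power [smooth_intros]: "smooth_at p f \<Longrightarrow> smooth_at p (\<lambda>x. (f x :: real) ^ n)"
  by (induction n) (auto intro!: smooth_intros)

lemma smooth_at_norm [smooth_intros]:
  assumes "smooth_at p f" "f p \<noteq> 0"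
  shows "smooth_at p (\<lambda>x. norm (f x))"
proof -
  have "smooth_at p (\<lambda>x. exp (ln (f x \<bullet> f x) / 2))"
    using assms by (intro smooth_intros) auto
  moreover have "\<forall>\<^sub>F x in nhds p. f x \<noteq> 0"
  proof -
    have "isCont f p" using assms smooth_at_isCont by blast
    then have "(f \<longlongrightarrow> f p) (nhds p)" by (simp add: isCont_def tendsto_at_iff_tendsto_nhds)
    then show ?thesis using assms(2) by (rule tendsto_imp_eventually_ne)
  qed
  then have "\<forall>\<^sub>F x in nhds p. exp (ln (f x \<bullet> f x) / 2) = norm (f x)"
  proof eventually_elim
    case (elim x)
    have "exp (ln (f x \<bullet> f x) / 2) = exp (ln (norm (f x)))"
      using elim by (simp add: dot_square_norm ln_realpow)
    then show ?case using elim by simp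
  qed
  ultimately show ?thesis by (rule smooth_at_cong)
qed

lemma smooth_at_cis [smooth_intros]: "smooth_at p f \<Longrightarrow> smooth_at p (\<lambda>x. cis (f x))"
proof -
  assume f: "smooth_at p f"
  have eq: "(\<lambda>x. cis (f x)) = (\<lambda>x. cos (f x) *\<^sub>R 1 + sin (f x) *\<^sub>R \<i>)"
    by (auto simp: complex_eq_iff)
  show ?thesis unfolding eq by (intro smooth_intros f)
qed

lemma smooth_at_Complex [smooth_intros]:
  "smooth_at p f \<Longrightarrow> smooth_at p g \<Longrightarrow> smooth_at p (\<lambda>x. Complex (f x) (g x))"
proof -
  assume f: "smooth_at p f" "smooth_at p g"
  have eq: "(\<lambda>x. Complex (f x) (g x)) = (\<lambda>x. f x *\<^sub>R 1 + g x *\<^sub>R \<i>)"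
    by (auto simp: complex_eq_iff)
  show ?thesis unfolding eq by (intro smooth_intros f)
qed

text \<open>A field that a parametrisation transports from its domain is smooth for this reason; no formula
  for the derivative of the parametrisation is needed.\<close>

lemma smooth_at_directional_derivative:
  assumes "smooth_at p f" "smooth_at p V"
  shows "smooth_at p (\<lambda>x. frechet_derivative f (at x) (V x))"
proof -
  obtain S where S: "open S" "p \<in> S" "smooth_on S f" using assms by (auto simp: smooth_at_def)
  have "smooth_at p (\<lambda>x. frechet_derivative f (at x) b)" for b
    unfolding smooth_at_def smooth_on_def
  proof (intro exI conjI allI)
    show "Ck_on k S (\<lambda>x. frechet_derivative f (at x) b)" for k
      using S(3) Ck_on.simps(2)[of k S f] unfolding smooth_on_def by blast
  qed (use S in auto)
  then have "smooth_at p (\<lambda>x. \<Sum>b\<in>Basis. (V x \<bullet> b) *\<^sub>R frechet_derivative f (at x) b)"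
    by (intro smooth_intros assms)
  moreover have "\<forall>\<^sub>F x in nhds p. smooth_at x f" by (rule smooth_at_eventually[OF assms(1)])
  then have "\<forall>\<^sub>F x in nhds p. (\<Sum>b\<in>Basis. (V x \<bullet> b) *\<^sub>R frechet_derivative f (at x) b) = frechet_derivative f (at x) (V x)"
    by eventually_elim (rule linear_eq_sum_Basis[OF smooth_at_linear_derivative, symmetric])
  ultimately show ?thesis by (rule smooth_at_cong)
qed

lemma Ck_on_Ln: "Ck_on k (- \<real>\<^sub>\<le>\<^sub>0) Ln"
proof (cases k)
  case (Suc n)
  have o: "open (- \<real>\<^sub>\<le>\<^sub>0 :: complex set)" by auto
  have "smooth_at w (\<lambda>w. ((1 / (norm w)\<^sup>2) *\<^sub>R cnj w) * v)" if "w \<notin> \<real>\<^sub>\<le>\<^sub>0" for w v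
    using that by (intro smooth_intros) auto
  then have "smooth_on (- \<real>\<^sub>\<le>\<^sub>0) (\<lambda>w. ((1 / (norm w)\<^sup>2) *\<^sub>R cnj w) * v)" for v
    unfolding smooth_on_iff_smooth_at[OF o] by auto
  moreover have "(Ln has_derivative (\<lambda>v. ((1 / (norm w)\<^sup>2) *\<^sub>R cnj w) * v)) (at w)" if "w \<in> - \<real>\<^sub>\<le>\<^sub>0" for w
  proof -
    have "(Ln has_derivative (*) (inverse w)) (at w)"
      using has_field_derivative_Ln[of w] that by (simp add: has_field_derivative_def)
    moreover have "inverse w = (1 / (norm w)\<^sup>2) *\<^sub>R cnj w"
      using that by (auto simp: inverse_complex.code complex_eq_iff cmod_power2)
    ultimately show ?thesis by (simp del: mult_scaleR_left)
  qed
  ultimately show ?thesis unfolding Suc smooth_on_def by (intro Ck_on_SucI[OF o]) auto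
qed (auto intro!: continuous_intros)

lemma smooth_at_Ln [smooth_intros]:
  "smooth_at p f \<Longrightarrow> f p \<notin> \<real>\<^sub>\<le>\<^sub>0 \<Longrightarrow> smooth_at p (\<lambda>x. Ln (f x))"
  by (rule smooth_at_of_Ck_on[OF Ck_on_Ln]) auto

section \<open>Flat functions and homogeneous fields\<close>

text \<open>The powers of \<open>t\<close> in the denominator make the family closed under differentiation up to linear
  combinations.\<close>

definition flat :: "nat \<Rightarrow> real \<Rightarrow> real" where
  "flat n t = (if t > 0 then exp (- 1 / t) / t ^ n else 0)"

lemma flat_pos: "t > 0 \<Longrightarrow> flat n t > 0"
  and flat_nonpos: "t \<le> 0 \<Longrightarrow> flat n t = 0"
  and flat_nonneg: "flat n t \<ge> 0"
  by (auto simp: flat_def)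

lemma flat_pos_iff: "flat n t > 0 \<longleftrightarrow> t > 0"
  by (auto simp: flat_def)

lemma power_le_fact_mult_exp:
  assumes "x \<ge> (0::real)" shows "x ^ m \<le> fact m * exp x"
proof -
  have "(\<Sum>n\<in>{m}. x ^ n /\<^sub>R fact n) \<le> (\<Sum>n. x ^ n /\<^sub>R fact n)"
    using assms by (intro sum_le_suminf summable_exp_generic) auto
  then have "x ^ m / fact m \<le> exp x" by (simp add: exp_def divide_inverse mult.commute)
  then show ?thesis by (simp add: field_simps)
qed

lemma flat_le_power: "t \<ge> 0 \<Longrightarrow> flat n t \<le> fact (n + m) * t ^ m"
proof (cases "t = 0")
  case False
  assume "t \<ge> 0"
  with False have t: "t > 0" by simp
  have "(1 / t) ^ (n + m) \<le> fact (n + m) * exp (1 / t)"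
    using t by (intro power_le_fact_mult_exp) simp
  then have "exp (- 1 / t) / t ^ n \<le> fact (n + m) * t ^ m"
    using t by (simp add: exp_minus field_simps power_add)
  then show ?thesis using t by (simp add: flat_def)
qed (simp add: flat_def)

lemma flat_has_derivative:
  "(flat n has_real_derivative (flat (n + 2) t - real n * flat (n + 1) t)) (at t)"
proof -
  consider "t > 0" | "t < 0" | "t = 0" by linarith
  then show ?thesis
  proof cases
    case 1
    have "((\<lambda>t. exp (- 1 / t) / t ^ n) has_real_derivative (flat (n + 2) t - real n * flat (n + 1) t)) (at t)"
      using 1
      apply (auto intro!: derivative_eq_intros simp: flat_def)
      apply (cases n)
       apply (auto simp: field_simps power2_eq_square power_add)
      done
    then show ?thesis
      by (rule has_field_derivative_transform_within_open[of _ _ _ "{0<..}"]) (use 1 in \<open>auto simp: flat_def\<close>)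
  next
    case 2
    have "((\<lambda>t. 0) has_real_derivative (flat (n + 2) t - real n * flat (n + 1) t)) (at t)"
      using 2 by (auto simp: flat_def)
    then show ?thesis
      by (rule has_field_derivative_transform_within_open[of _ _ _ "{..<0}"]) (use 2 in \<open>auto simp: flat_def\<close>)
  next
    case 3
    have b: "norm (flat n h / h) \<le> fact (n + 2) * \<bar>h\<bar>" for h
    proof (cases "h > 0")
      case True
      then show ?thesis using flat_le_power[of h n 2] flat_nonneg[of n h]
        by (simp add: field_simps power2_eq_square)
    next
      case False
      have "0 \<le> fact (n + 2) * \<bar>h\<bar>" by (intro mult_nonneg_nonneg) auto
      moreover have "norm (flat n h / h) = 0" using False by (simp add: flat_nonpos)
      ultimately show ?thesis by linarith
    qed
    have "((\<lambda>h. flat n h / h) \<longlongrightarrow> 0) (at 0)"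
    proof (rule Lim_null_comparison[OF always_eventually])
      show "\<forall>h. norm (flat n h / h) \<le> fact (n + 2) * \<bar>h\<bar>" using b by blast
      show "((\<lambda>h. fact (n + 2) * \<bar>h\<bar>) \<longlongrightarrow> (0::real)) (at 0)"
        by (auto intro!: tendsto_eq_intros)
    qed
    then show ?thesis using 3 by (simp add: DERIV_def flat_nonpos)
  qed
qed

lemma Ck_on_flat: "Ck_on k UNIV (flat n)"
proof (induction k arbitrary: n)
  case 0
  have "isCont (flat n) t" for t using flat_has_derivative DERIV_isCont by blast
  then show ?case by (simp add: continuous_at_imp_continuous_on)
next
  case (Suc k)
  show ?case
  proof (rule Ck_on_real_antiderivative)
    show "(flat n has_vector_derivative (flat (n + 2) t - real n * flat (n + 1) t)) (at t)" for t
      using flat_has_derivative by (simp add: has_real_derivative_iff_has_vector_derivative)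
    have "Ck_on k UNIV (\<lambda>t. flat (n + 2) t + (- real n) * flat (n + 1) t)"
      by (intro Ck_on_add Ck_on_bounded_linear_of[OF _ bounded_linear_mult_right] Suc) auto
    then show "Ck_on k UNIV (\<lambda>t. flat (n + 2) t - real n * flat (n + 1) t)" by simp
  qed simp
qed

lemma smooth_at_flat [smooth_intros]: "smooth_at p f \<Longrightarrow> smooth_at p (\<lambda>x. flat n (f x))"
  by (rule smooth_at_of_Ck_on[OF Ck_on_flat]) auto

text \<open>Derivatives of such fields are in general singular at the origin, which is therefore left out.\<close>

definition homogeneous :: "real \<Rightarrow> ('a::euclidean_space \<Rightarrow> 'b::euclidean_space) \<Rightarrow> bool" where
  "homogeneous d G \<longleftrightarrow> (\<forall>l x. l > 0 \<and> x \<noteq> 0 \<longrightarrow> G (l *\<^sub>R x) = (l powr d) *\<^sub>R G x)"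

lemma homogeneous_derivative:
  assumes "homogeneous d G" "\<And>x. x \<noteq> 0 \<Longrightarrow> smooth_at x G"
  shows "homogeneous (d - 1) (\<lambda>x. frechet_derivative G (at x) v)"
  unfolding homogeneous_def
proof (intro allI impI, elim conjE)
  fix l :: real and x :: 'a assume l: "l > 0" and x: "x \<noteq> 0"
  have lx: "l *\<^sub>R x \<noteq> 0" using l x by simp
  have "((\<lambda>y. G (l *\<^sub>R y)) has_derivative (\<lambda>v. frechet_derivative G (at (l *\<^sub>R x)) (l *\<^sub>R v))) (at x)"
    using diff_chain_at[OF has_derivative_scaleR_right[OF has_derivative_ident] smooth_at_has_derivative[OF assms(2)[OF lx]]]
    by (simp add: o_def)
  moreover have "((\<lambda>y. G (l *\<^sub>R y)) has_derivative (\<lambda>v. (l powr d) *\<^sub>R frechet_derivative G (at x) v)) (at x)"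
  proof (rule has_derivative_transform_within_open)
    show "((\<lambda>y. (l powr d) *\<^sub>R G y) has_derivative (\<lambda>v. (l powr d) *\<^sub>R frechet_derivative G (at x) v)) (at x)"
      by (intro has_derivative_scaleR_right smooth_at_has_derivative assms(2) x)
    show "open (- {0::'a})" "x \<in> - {0}" using x by auto
    show "l powr d *\<^sub>R G y = G (l *\<^sub>R y)" if "y \<in> - {0}" for y
      using that l assms(1) by (auto simp: homogeneous_def)
  qed
  ultimately have "frechet_derivative G (at (l *\<^sub>R x)) (l *\<^sub>R v) = (l powr d) *\<^sub>R frechet_derivative G (at x) v"
    using has_derivative_unique by (metis (no_types, lifting))
  then have "l *\<^sub>R frechet_derivative G (at (l *\<^sub>R x)) v = (l powr d) *\<^sub>R frechet_derivative G (at x) v"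
    using linear_cmul[OF smooth_at_linear_derivative[OF assms(2)[OF lx]]] by metis
  then have "(1 / l) *\<^sub>R l *\<^sub>R frechet_derivative G (at (l *\<^sub>R x)) v = (1 / l) *\<^sub>R (l powr d) *\<^sub>R frechet_derivative G (at x) v"
    by simp
  then show "frechet_derivative G (at (l *\<^sub>R x)) v = (l powr (d - 1)) *\<^sub>R frechet_derivative G (at x) v"
    using l by (simp add: powr_diff)
qed

lemma homogeneous_bound:
  fixes G :: "'a::euclidean_space \<Rightarrow> 'b::euclidean_space"
  assumes "homogeneous d G" "\<And>x. x \<noteq> 0 \<Longrightarrow> smooth_at x G"
  obtains B where "B \<ge> 0" "\<And>x. x \<noteq> 0 \<Longrightarrow> norm (G x) \<le> B * norm x powr d"
proof -
  have "continuous_on (sphere 0 1) G"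
  proof (intro continuous_at_imp_continuous_on ballI)
    fix x :: 'a assume "x \<in> sphere 0 1"
    then have "x \<noteq> 0" by auto
    then show "isCont G x" by (rule smooth_at_isCont[OF assms(2)])
  qed
  then have "compact (G ` sphere 0 1)" by (intro compact_continuous_image) auto
  then obtain B where B: "\<And>x. x \<in> sphere 0 1 \<Longrightarrow> norm (G x) \<le> B"
    using compact_imp_bounded bounded_iff by (metis imageI)
  have "norm (G x) \<le> max B 0 * norm x powr d" if "x \<noteq> 0" for x
  proof -
    have "G x = G (norm x *\<^sub>R (x /\<^sub>R norm x))" using that by simp
    also have "\<dots> = norm x powr d *\<^sub>R G (x /\<^sub>R norm x)"
      using assms(1) that unfolding homogeneous_def by (metis norm_eq_zero scaleR_eq_0_iff inverse_nonzero_iff_nonzero zero_less_norm_iff)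
    finally have "norm (G x) = norm x powr d * norm (G (x /\<^sub>R norm x))" by simp
    moreover have "norm (G (x /\<^sub>R norm x)) \<le> max B 0"
      using B[of "x /\<^sub>R norm x"] that by simp
    ultimately show ?thesis using mult_right_mono[of "norm (G (x /\<^sub>R norm x))" "max B 0" "norm x powr d"]
      by (simp add: mult.commute)
  qed
  then show ?thesis using that[of "max B 0"] by simp
qed

text \<open>A homogeneous field grows at the origin at most like a power of the distance, which the flat
  factor suppresses to second order. The formula then holds at the origin too, where all its terms
  vanish.\<close>

lemma flat_homogeneous_has_derivative:
  fixes G :: "'a::euclidean_space \<Rightarrow> 'b::euclidean_space"
  assumes "homogeneous d G" "\<And>x. x \<noteq> 0 \<Longrightarrow> smooth_at x G"
  shows "((\<lambda>x. flat n (x \<bullet> x) *\<^sub>R G x) has_derivative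
    (\<lambda>v. flat (n + 2) (x \<bullet> x) *\<^sub>R ((2 * (x \<bullet> v)) *\<^sub>R G x) + flat (n + 1) (x \<bullet> x) *\<^sub>R ((- (2 * real n) * (x \<bullet> v)) *\<^sub>R G x)
       + flat n (x \<bullet> x) *\<^sub>R frechet_derivative G (at x) v)) (at x)"
proof (cases "x = 0")
  case False
  let ?d = "flat (n + 2) (x \<bullet> x) - real n * flat (n + 1) (x \<bullet> x)"
  have "((\<lambda>x. x \<bullet> x) has_derivative (\<lambda>v. x \<bullet> v + v \<bullet> x)) (at x)"
    by (intro derivative_intros)
  from diff_chain_at[OF this flat_has_derivative[of n, unfolded has_field_derivative_def]]
  have "((\<lambda>x. flat n (x \<bullet> x)) has_derivative (\<lambda>v. ?d * (x \<bullet> v + v \<bullet> x))) (at x)"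
    by (simp add: o_def)
  from has_derivative_scaleR[OF this smooth_at_has_derivative[OF assms(2)[OF False]]]
  show ?thesis
    by (rule has_derivative_eq_rhs) (auto simp: inner_commute algebra_simps scaleR_diff_left)
next
  case True
  obtain B where B: "B \<ge> 0" "\<And>x. x \<noteq> 0 \<Longrightarrow> norm (G x) \<le> B * norm x powr d"
    using homogeneous_bound[OF assms] by blast
  obtain m :: nat where m: "2 - d \<le> 2 * real m" using real_arch_simple[of "(2 - d) / 2"]
    by (auto simp: mult.commute)
  let ?C = "fact (n + m) * B"
  have bound: "norm (flat n (x \<bullet> x) *\<^sub>R G x) \<le> ?C * (norm x)\<^sup>2" if "norm x < 1" for x
  proof (cases "x = 0")
    case False
    then have nx: "norm x > 0" by simp
    have "flat n (x \<bullet> x) * norm (G x) \<le> (fact (n + m) * (x \<bullet> x) ^ m) * (B * norm x powr d)"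
      by (rule mult_mono[OF flat_le_power B(2)[OF False]]) auto
    also have "\<dots> = ?C * (norm x powr (2 * real m + d))"
    proof -
      have "norm x powr (2 * real m) = norm x ^ (2 * m)"
        using powr_realpow[OF nx, of "2 * m"] by simp
      then have "(x \<bullet> x) ^ m = norm x powr (2 * real m)"
        by (simp add: dot_square_norm power_mult)
      then show ?thesis by (simp add: powr_add mult_ac)
    qed
    also have "\<dots> \<le> ?C * (norm x powr 2)"
    proof (rule mult_left_mono)
      show "norm x powr (2 * real m + d) \<le> norm x powr 2"
        using nx that m by (intro powr_mono') linarith+
    qed (use B(1) in simp)
    finally show ?thesis using nx flat_nonneg[of n] by (simp add: powr_numeral)
  qed (simp add: flat_nonpos)
  have "((\<lambda>x. flat n (x \<bullet> x) *\<^sub>R G x) has_derivative (\<lambda>v. 0)) (at 0)"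
    unfolding has_derivative_at
  proof (intro conjI)
    show "(\<lambda>h. norm (flat n ((0 + h) \<bullet> (0 + h)) *\<^sub>R G (0 + h) - flat n (0 \<bullet> 0) *\<^sub>R G 0 - 0) / norm h) \<midarrow>0\<rightarrow> 0"
    proof (rule Lim_null_comparison)
      show "((\<lambda>h. ?C * norm h) \<longlongrightarrow> 0) (at (0::'a))"
        by (auto intro!: tendsto_eq_intros)
      have "\<forall>\<^sub>F h in at (0::'a). norm h < 1"
        by (auto simp: eventually_at intro!: exI[of _ 1])
      then show "\<forall>\<^sub>F h in at 0. norm (norm (flat n ((0 + h) \<bullet> (0 + h)) *\<^sub>R G (0 + h) - flat n (0 \<bullet> 0) *\<^sub>R G 0 - 0) / norm h) \<le> ?C * norm h"
      proof eventually_elim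
        case (elim h)
        from bound[OF elim] show ?case
          by (cases "h = 0") (auto simp: flat_nonpos divide_simps power2_eq_square mult_ac)
      qed
    qed
  qed simp
  then show ?thesis using True by (simp add: flat_nonpos)
qed

text \<open>By the previous formula a directional derivative is a sum of three fields of the same kind,
  with other degrees and other members of the family \<^const>\<open>flat\<close>; hence the induction on the order
  of differentiability.\<close>

lemma Ck_on_flat_homogeneous:
  fixes G :: "'a::euclidean_space \<Rightarrow> 'b::euclidean_space"
  assumes "homogeneous d G" "\<And>x. x \<noteq> 0 \<Longrightarrow> smooth_at x G"
  shows "Ck_on k UNIV (\<lambda>x. flat n (x \<bullet> x) *\<^sub>R G x)"
  using assms
proof (induction k arbitrary: n d G)
  case 0
  from flat_homogeneous_has_derivative[OF 0] show ?case
    by (auto intro!: continuous_at_imp_continuous_on has_derivative_continuous)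
next
  case (Suc k)
  have l: "homogeneous (d + 1) (\<lambda>x. (c * (x \<bullet> v)) *\<^sub>R G x)" for c v
    using Suc.prems(1) by (auto simp: homogeneous_def powr_add)
  show ?case
  proof (rule Ck_on_SucI[OF open_UNIV])
    fix x
    show "((\<lambda>x. flat n (x \<bullet> x) *\<^sub>R G x) has_derivative
    (\<lambda>v. flat (n + 2) (x \<bullet> x) *\<^sub>R ((2 * (x \<bullet> v)) *\<^sub>R G x) + flat (n + 1) (x \<bullet> x) *\<^sub>R ((- (2 * real n) * (x \<bullet> v)) *\<^sub>R G x)
       + flat n (x \<bullet> x) *\<^sub>R frechet_derivative G (at x) v)) (at x)"
      by (rule flat_homogeneous_has_derivative[OF Suc.prems])
  next
    fix v
    show "Ck_on k UNIV (\<lambda>x. flat (n + 2) (x \<bullet> x) *\<^sub>R ((2 * (x \<bullet> v)) *\<^sub>R G x)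
        + flat (n + 1) (x \<bullet> x) *\<^sub>R ((- (2 * real n) * (x \<bullet> v)) *\<^sub>R G x)
        + flat n (x \<bullet> x) *\<^sub>R frechet_derivative G (at x) v)"
    proof (intro Ck_on_add[OF open_UNIV])
      have s: "smooth_at x (\<lambda>x. (c * (x \<bullet> v)) *\<^sub>R G x)" if "x \<noteq> 0" for x c
        by (intro smooth_at_scaleR smooth_at_mult smooth_at_inner smooth_at_id smooth_at_const Suc.prems(2)[OF that])
      show "Ck_on k UNIV (\<lambda>x. flat (n + 2) (x \<bullet> x) *\<^sub>R ((2 * (x \<bullet> v)) *\<^sub>R G x))"
        by (rule Suc.IH[OF l s])
      show "Ck_on k UNIV (\<lambda>x. flat (n + 1) (x \<bullet> x) *\<^sub>R ((- (2 * real n) * (x \<bullet> v)) *\<^sub>R G x))"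
        by (rule Suc.IH[OF l s])
      show "Ck_on k UNIV (\<lambda>x. flat n (x \<bullet> x) *\<^sub>R frechet_derivative G (at x) v)"
        by (rule Suc.IH[OF homogeneous_derivative[OF Suc.prems] smooth_at_directional_derivative[OF Suc.prems(2) smooth_at_const]])
    qed
  qed
qed

lemma smooth_flat_homogeneous:
  fixes G :: "'a::euclidean_space \<Rightarrow> 'b::euclidean_space"
  assumes "homogeneous d G" "\<And>x. x \<noteq> 0 \<Longrightarrow> smooth_at x G"
  shows "smooth_on UNIV (\<lambda>x. flat n (x \<bullet> x) *\<^sub>R G x)"
  using Ck_on_flat_homogeneous[OF assms] by (auto simp: smooth_on_def)

section \<open>Quaternions as pairs of complex numbers\<close>

type_synonym quat = "complex \<times> complex"

text \<open>The pair \<open>(a, b)\<close> stands for \<open>a + b j\<close>. In these terms \<open>csmul c\<close> is multiplication by \<open>c\<close> from the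
  left, and it commutes with quaternion multiplication from the right.\<close>

definition qmul :: "quat \<Rightarrow> quat \<Rightarrow> quat" where
  "qmul g h = (fst g * fst h - snd g * cnj (snd h), fst g * snd h + snd g * cnj (fst h))"

definition qconj :: "quat \<Rightarrow> quat" where
  "qconj g = (cnj (fst g), - snd g)"

definition csmul :: "complex \<Rightarrow> quat \<Rightarrow> quat" where
  "csmul c g = (c * fst g, c * snd g)"

definition herm :: "quat \<Rightarrow> quat \<Rightarrow> complex" where
  "herm g h = cnj (fst g) * fst h + cnj (snd g) * snd h"

lemma norm_quat_sq: "(norm (g :: quat))\<^sup>2 = (cmod (fst g))\<^sup>2 + (cmod (snd g))\<^sup>2"
  by (cases g) (simp add: norm_Pair)

lemma norm_quat_sq_complex:
  "complex_of_real ((norm (g :: quat))\<^sup>2) = fst g * cnj (fst g) + snd g * cnj (snd g)"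
  by (simp only: norm_quat_sq of_real_add complex_norm_square)

lemma scaleR_quat: "r *\<^sub>R (g :: quat) = (complex_of_real r * fst g, complex_of_real r * snd g)"
  by (cases g) (simp add: scaleR_conv_of_real)

lemma qconj_qmul_cancel: "qmul (qconj g) (qmul g h) = (norm g)\<^sup>2 *\<^sub>R h"
  unfolding scaleR_quat norm_quat_sq_complex by (simp add: qmul_def qconj_def algebra_simps)

lemma qmul_qconj_cancel: "qmul g (qmul (qconj g) h) = (norm g)\<^sup>2 *\<^sub>R h"
  unfolding scaleR_quat norm_quat_sq_complex by (simp add: qmul_def qconj_def algebra_simps)

lemma qmul_csmul: "qmul (csmul c g) h = csmul c (qmul g h)"
  by (simp add: qmul_def csmul_def algebra_simps)

lemma csmul_csmul: "csmul c (csmul d g) = csmul (c * d) g"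
  by (simp add: csmul_def)

lemma csmul_one [simp]: "csmul 1 g = g"
  by (simp add: csmul_def)

lemma csmul_diff: "csmul c (g - h) = csmul c g - csmul c h"
  by (simp add: csmul_def algebra_simps)

lemma csmul_scaleR: "csmul c (r *\<^sub>R g) = r *\<^sub>R csmul c g"
  by (cases g) (simp add: csmul_def)

lemma qmul_scaleR_left: "qmul (r *\<^sub>R g) h = r *\<^sub>R qmul g h"
  by (cases g) (simp add: qmul_def algebra_simps)

lemma qmul_scaleR_right: "qmul g (r *\<^sub>R h) = r *\<^sub>R qmul g h"
  by (cases h) (simp add: qmul_def algebra_simps)

lemma qconj_scaleR: "qconj (r *\<^sub>R g) = r *\<^sub>R qconj g"
  by (cases g) (simp add: qconj_def)

lemma norm_csmul: "norm (csmul c g) = cmod c * norm g"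
proof -
  have "(norm (csmul c g))\<^sup>2 = (cmod c * norm g)\<^sup>2"
    by (simp add: norm_quat_sq csmul_def norm_mult power_mult_distrib algebra_simps)
  then show ?thesis by (simp add: power2_eq_iff_nonneg)
qed

lemma norm_qmul: "norm (qmul g h) = norm g * norm h"
proof -
  have "complex_of_real ((norm (qmul g h))\<^sup>2) = complex_of_real ((norm g * norm h)\<^sup>2)"
    unfolding power_mult_distrib of_real_mult norm_quat_sq_complex
    by (simp add: qmul_def algebra_simps)
  then have "(norm (qmul g h))\<^sup>2 = (norm g * norm h)\<^sup>2" using of_real_eq_iff by blast
  then show ?thesis by (simp add: power2_eq_iff_nonneg)
qed

lemma Re_herm: "Re (herm g h) = inner g h"
  by (cases g; cases h) (simp add: herm_def inner_complex_def)

lemma herm_csmul: "herm g (csmul c h) = c * herm g h"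
  by (simp add: herm_def csmul_def algebra_simps)

lemma smooth_at_qmul [smooth_intros]:
  "smooth_at p f \<Longrightarrow> smooth_at p g \<Longrightarrow> smooth_at p (\<lambda>x. qmul (f x) (g x))"
  unfolding qmul_def by (intro smooth_intros)

lemma smooth_at_qconj [smooth_intros]: "smooth_at p f \<Longrightarrow> smooth_at p (\<lambda>x. qconj (f x))"
  unfolding qconj_def by (intro smooth_intros)

lemma smooth_at_csmul [smooth_intros]:
  "smooth_at p f \<Longrightarrow> smooth_at p g \<Longrightarrow> smooth_at p (\<lambda>x. csmul (f x) (g x))"
  unfolding csmul_def by (intro smooth_intros)

lemma smooth_at_herm [smooth_intros]:
  "smooth_at p f \<Longrightarrow> smooth_at p g \<Longrightarrow> smooth_at p (\<lambda>x. herm (f x) (g x))"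
  unfolding herm_def by (intro smooth_intros)

section \<open>Pairs of quaternions as points of eight-space\<close>

text \<open>Any linear isometry between the two spaces will do, because the construction depends only on the
  quaternions and on the norm.\<close>

lemma ex_emb_prj: "\<exists>fg :: (quat \<times> quat \<Rightarrow> real ^ 8) \<times> (real ^ 8 \<Rightarrow> quat \<times> quat).
    linear (fst fg) \<and> linear (snd fg) \<and> (\<forall>v. norm (fst fg v) = norm v) \<and>
    (\<forall>v. snd fg (fst fg v) = v) \<and> (\<forall>p. fst fg (snd fg p) = p)"
proof -
  have "DIM(quat \<times> quat) = DIM(real ^ 8)" by simp
  from isomorphisms_UNIV_UNIV[OF this] show ?thesis by (metis fst_conv snd_conv)
qed

definition emb_prj :: "(quat \<times> quat \<Rightarrow> real ^ 8) \<times> (real ^ 8 \<Rightarrow> quat \<times> quat)" where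
  "emb_prj = (SOME fg. linear (fst fg) \<and> linear (snd fg) \<and> (\<forall>v. norm (fst fg v) = norm v) \<and>
    (\<forall>v. snd fg (fst fg v) = v) \<and> (\<forall>p. fst fg (snd fg p) = p))"

abbreviation emb :: "quat \<times> quat \<Rightarrow> real ^ 8" where "emb \<equiv> fst emb_prj"
abbreviation prj :: "real ^ 8 \<Rightarrow> quat \<times> quat" where "prj \<equiv> snd emb_prj"

lemma emb_prj: "linear emb" "linear prj" "norm (emb v) = norm v" "prj (emb v) = v" "emb (prj p) = p"
  using someI_ex[OF ex_emb_prj] unfolding emb_prj_def[symmetric] by blast+

lemma norm_prj: "norm (prj p) = norm p"
  using emb_prj(3)[of "prj p"] by (simp add: emb_prj)

lemma bounded_linear_emb: "bounded_linear emb" and bounded_linear_prj: "bounded_linear prj"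
  using emb_prj(1,2) linear_conv_bounded_linear by blast+

lemmas emb_scaleR = linear_cmul[OF emb_prj(1)]
lemmas prj_scaleR = linear_cmul[OF emb_prj(2)]
lemmas smooth_at_emb [smooth_intros] = smooth_at_linear_of[OF bounded_linear_emb]
lemmas smooth_at_prj [smooth_intros] = smooth_at_linear_of[OF bounded_linear_prj]

section \<open>A tube around a circle bundle of degree one over a torus\<close>

text \<open>The components are the angles \<open>x, y, u\<close>, the fibre coordinate \<open>z\<close>, and the real number \<open>P\<close> and the
  complex number \<open>w\<close> with \<open>q = P i + w j\<close>.\<close>

type_synonym coord = "real \<times> real \<times> real \<times> real \<times> real \<times> complex"

abbreviation cX :: "coord \<Rightarrow> real" where "cX c \<equiv> fst c"
abbreviation cY :: "coord \<Rightarrow> real" where "cY c \<equiv> fst (snd c)"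
abbreviation cU :: "coord \<Rightarrow> real" where "cU c \<equiv> fst (snd (snd c))"
abbreviation cZ :: "coord \<Rightarrow> real" where "cZ c \<equiv> fst (snd (snd (snd c)))"
abbreviation cP :: "coord \<Rightarrow> real" where "cP c \<equiv> fst (snd (snd (snd (snd c))))"
abbreviation cW :: "coord \<Rightarrow> complex" where "cW c \<equiv> snd (snd (snd (snd (snd c))))"

text \<open>Two sections, without common zeros, of a line bundle of degree one over the torus, as functions on
  the plane. The exponents jump by one where the flat factor in front vanishes, so that the
  functions are smooth; by \<open>torus_section_shift\<close> a step of \<open>2\<pi>\<close> in \<open>y\<close> multiplies them by
  \<open>cis x\<close>.\<close>

definition torus_section :: "real \<Rightarrow> real \<Rightarrow> quat" where
  "torus_section x y = (flat 0 (1/2 + cos y) *\<^sub>R cis (of_int \<lfloor>(y + pi) / (2 * pi)\<rfloor> * x),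
               flat 0 (1/2 - cos y) *\<^sub>R cis (of_int \<lfloor>y / (2 * pi)\<rfloor> * x))"

definition tube_coord :: "coord \<Rightarrow> quat" where
  "tube_coord c = (\<i> * complex_of_real (cP c), cW c)"

text \<open>With \<open>Q\<close> the value of the section, the vectors \<open>i Q q\<close> with \<open>q\<close> imaginary are those orthogonal
  to \<open>i Q\<close>, the direction of the circle action at \<open>Q\<close>. So \<open>Q - i Q q\<close> runs over a slice transverse
  to the action, whose linear parametrisation by \<open>q\<close> in \<open>\<real>\<^sup>3\<close> is defined over the whole torus.\<close>

definition spinor_base :: "coord \<Rightarrow> quat" where
  "spinor_base c = torus_section (cX c) (cY c) - csmul \<i> (qmul (torus_section (cX c) (cY c)) (tube_coord c))"

definition spinor :: "coord \<Rightarrow> quat" where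
  "spinor c = csmul (cis (cZ c)) (spinor_base c)"

text \<open>If \<open>k\<^sub>1, k\<^sub>2\<close> are the components, then \<open>ln \<bar>k\<^sub>1\<bar> + i ln \<bar>k\<^sub>2\<bar>\<close> has argument \<open>y\<close> and modulus the norm of
  the spinor, and the arguments of \<open>k\<^sub>1\<close> and \<open>k\<^sub>2\<close> are \<open>x\<close> and \<open>u\<close>. This is an open embedding of the
  3-torus times an interval into \<open>\<real>\<^sup>4\<close>; it recovers the norm of the spinor, which gets lost when the
  pair is normalised.\<close>

definition angle_quat :: "coord \<Rightarrow> quat" where
  "angle_quat c = (exp (norm (spinor c) * cos (cY c)) *\<^sub>R cis (cX c), exp (norm (spinor c) * sin (cY c)) *\<^sub>R cis (cU c))"

definition unscaled_map :: "coord \<Rightarrow> quat \<times> quat" where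
  "unscaled_map c = (spinor c, qmul (spinor c) (angle_quat c))"

definition tube_map :: "coord \<Rightarrow> real ^ 8" where
  "tube_map c = emb ((1 / norm (unscaled_map c)) *\<^sub>R unscaled_map c)"

definition tube :: "coord set" where
  "tube = {c. norm (tube_coord c) < 1}"

lemma torus_section_nonzero: "torus_section x y \<noteq> 0"
proof -
  have "1/2 + cos y > 0 \<or> 1/2 - cos y > 0" by linarith
  then have "flat 0 (1/2 + cos y) > 0 \<or> flat 0 (1/2 - cos y) > 0" by (simp add: flat_pos_iff)
  then show ?thesis by (auto simp: torus_section_def prod_eq_iff)
qed

lemma cis_int_mult: "cis (of_int n * (2 * pi)) = 1"
  using cis_multiple_2pi[of "of_int n"] by (simp add: mult_ac)

lemma cis_add_int: "cis (a + 2 * pi * of_int n) = cis a"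
  using cis_int_mult[of n] by (simp add: cis_mult[symmetric] mult_ac)

lemma cis_int_shift: "cis (of_int n * (x + 2 * pi * of_int l)) = cis (of_int n * x)"
proof -
  have "of_int n * (x + 2 * pi * of_int l) = of_int n * x + 2 * pi * of_int (n * l)"
    by (simp add: algebra_simps)
  then show ?thesis using cis_add_int by metis
qed

lemma torus_section_shift: "torus_section (x + 2 * pi * of_int l) (y + 2 * pi * of_int m) = csmul (cis (of_int m * x)) (torus_section x y)"
proof -
  have c: "cos (y + 2 * pi * of_int m) = cos y"
    using sin_cos_eq_iff[of "y + 2 * pi * of_int m" y] by auto
  have "(y + 2 * pi * of_int m + pi) / (2 * pi) = (y + pi) / (2 * pi) + of_int m"
       "(y + 2 * pi * of_int m) / (2 * pi) = y / (2 * pi) + of_int m"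
    by (auto simp: field_simps)
  then have f: "\<lfloor>(y + 2 * pi * of_int m + pi) / (2 * pi)\<rfloor> = \<lfloor>(y + pi) / (2 * pi)\<rfloor> + m"
       "\<lfloor>(y + 2 * pi * of_int m) / (2 * pi)\<rfloor> = \<lfloor>y / (2 * pi)\<rfloor> + m"
    by simp_all
  have "cis (of_int (n + m) * (x + 2 * pi * of_int l)) = cis (of_int m * x) * cis (of_int n * x)" for n
    unfolding cis_int_shift by (simp add: cis_mult algebra_simps)
  then show ?thesis unfolding torus_section_def c f csmul_def by simp
qed

lemma eventually_floor_const:
  assumes "isCont h (p::'a::euclidean_space)" "h p \<notin> \<int>"
  shows "\<forall>\<^sub>F x in nhds p. \<lfloor>h x :: real\<rfloor> = \<lfloor>h p\<rfloor>"
proof -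
  have t: "(h \<longlongrightarrow> h p) (nhds p)" using assms(1) by (simp add: isCont_def tendsto_at_iff_tendsto_nhds)
  have "of_int \<lfloor>h p\<rfloor> < h p" using assms(2) by (metis Ints_of_int floor_correct order_le_less)
  moreover have "h p < of_int \<lfloor>h p\<rfloor> + 1" by linarith
  ultimately have "\<forall>\<^sub>F x in nhds p. of_int \<lfloor>h p\<rfloor> < h x" "\<forall>\<^sub>F x in nhds p. h x < of_int \<lfloor>h p\<rfloor> + 1"
    using t order_tendstoD by blast+
  then show ?thesis by eventually_elim linarith
qed

text \<open>The floor is locally constant except at integers, and near those the factor \<open>flat\<close> vanishes
  identically.\<close>

lemma smooth_at_flat_cis:
  assumes "smooth_at p f" "smooth_at p g" "smooth_at p h" "h p \<in> \<int> \<Longrightarrow> g p < 0"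
  shows "smooth_at p (\<lambda>x. flat 0 (g x) *\<^sub>R cis (of_int \<lfloor>h x :: real\<rfloor> * f x))"
proof (cases "h p \<in> \<int>")
  case False
  have "smooth_at p (\<lambda>x. flat 0 (g x) *\<^sub>R cis (of_int \<lfloor>h p\<rfloor> * f x))"
    by (intro smooth_intros assms)
  moreover have "\<forall>\<^sub>F x in nhds p. \<lfloor>h x\<rfloor> = \<lfloor>h p\<rfloor>"
    by (rule eventually_floor_const[OF smooth_at_isCont[OF assms(3)] False])
  then have "\<forall>\<^sub>F x in nhds p. flat 0 (g x) *\<^sub>R cis (of_int \<lfloor>h p\<rfloor> * f x) = flat 0 (g x) *\<^sub>R cis (of_int \<lfloor>h x\<rfloor> * f x)"
    by eventually_elim simp
  ultimately show ?thesis by (rule smooth_at_cong)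
next
  case True
  have "(g \<longlongrightarrow> g p) (nhds p)"
    using smooth_at_isCont[OF assms(2)] by (simp add: isCont_def tendsto_at_iff_tendsto_nhds)
  from order_tendstoD(2)[OF this assms(4)[OF True]]
  have "\<forall>\<^sub>F x in nhds p. 0 = flat 0 (g x) *\<^sub>R cis (of_int \<lfloor>h x\<rfloor> * f x)"
    by eventually_elim (simp add: flat_nonpos)
  then show ?thesis by (rule smooth_at_cong[OF smooth_at_const])
qed

lemma smooth_at_torus_section [smooth_intros]:
  assumes "smooth_at p f" "smooth_at p g"
  shows "smooth_at p (\<lambda>x. torus_section (f x) (g x))"
  unfolding torus_section_def
proof (intro smooth_at_Pair smooth_at_flat_cis)
  have d: "smooth_at p (\<lambda>x. h x / (2 * pi))" if "smooth_at p h" for h :: "'a \<Rightarrow> real"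
    using that by (intro smooth_intros) auto
  show "smooth_at p (\<lambda>x. (g x + pi) / (2 * pi))" "smooth_at p (\<lambda>x. g x / (2 * pi))"
    by (intro d smooth_intros assms)+
  show "1/2 + cos (g p) < 0" if "(g p + pi) / (2 * pi) \<in> \<int>"
  proof -
    from that obtain n where "(g p + pi) / (2 * pi) = of_int n" by (elim Ints_cases)
    then have "g p + pi = 0 + 2 * pi * of_int n" by (simp add: field_simps)
    then have "cos (g p + pi) = cos 0" using sin_cos_eq_iff[of "g p + pi" 0] by blast
    then show ?thesis by simp
  qed
  show "1/2 - cos (g p) < 0" if "g p / (2 * pi) \<in> \<int>"
  proof -
    from that obtain n where "g p / (2 * pi) = of_int n" by (elim Ints_cases)
    then have "g p = 0 + 2 * pi * of_int n" by (simp add: field_simps)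
    then have "cos (g p) = cos 0" using sin_cos_eq_iff[of "g p" 0] by blast
    then show ?thesis by simp
  qed
qed (intro smooth_intros assms)+

text \<open>Together with the next lemma this shows that the hermitian product of the section with the spinor
  has phase \<open>z\<close>, which makes \<open>z\<close> recoverable from the spinor.\<close>

lemma herm_torus_section_spinor_base:
  "herm (torus_section (cX c) (cY c)) (spinor_base c) = complex_of_real (inner (torus_section (cX c) (cY c)) (spinor_base c))"
proof -
  have "Im (herm g (g - csmul \<i> (qmul g (\<i> * complex_of_real P, w)))) = 0" for g P w
    by (simp add: herm_def csmul_def qmul_def algebra_simps)
  then have "Im (herm (torus_section (cX c) (cY c)) (spinor_base c)) = 0" by (simp add: spinor_base_def tube_coord_def)
  then show ?thesis using Re_herm by (simp add: complex_eq_iff)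
qed

lemma inner_torus_section_spinor_base_pos:
  assumes "c \<in> tube" shows "inner (torus_section (cX c) (cY c)) (spinor_base c) > 0"
proof -
  let ?Q = "torus_section (cX c) (cY c)"
  have "inner ?Q (csmul \<i> (qmul ?Q (tube_coord c))) \<le> norm ?Q * (norm ?Q * norm (tube_coord c))"
    using norm_cauchy_schwarz[of ?Q "csmul \<i> (qmul ?Q (tube_coord c))"] by (simp add: norm_csmul norm_qmul)
  also have "\<dots> < norm ?Q * norm ?Q"
    using assms torus_section_nonzero by (simp add: tube_def)
  finally show ?thesis by (simp add: spinor_base_def inner_diff_right power2_norm_eq_inner[symmetric] power2_eq_square)
qed

lemma norm_spinor: "norm (spinor c) = norm (spinor_base c)"
  by (simp add: spinor_def norm_csmul)

lemma spinor_nonzero: "c \<in> tube \<Longrightarrow> spinor c \<noteq> 0"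
  using inner_torus_section_spinor_base_pos[of c] norm_spinor[of c] by auto

lemma unscaled_map_nonzero: "c \<in> tube \<Longrightarrow> unscaled_map c \<noteq> 0"
  using spinor_nonzero by (auto simp: unscaled_map_def zero_prod_def)

lemma norm_tube_map: "c \<in> tube \<Longrightarrow> norm (tube_map c) = 1"
  using unscaled_map_nonzero by (simp add: tube_map_def emb_prj)

lemma smooth_at_spinor: "smooth_at c spinor"
  unfolding spinor_def spinor_base_def tube_coord_def by (intro smooth_intros)

lemma smooth_at_unscaled_map: "c \<in> tube \<Longrightarrow> smooth_at c unscaled_map"
  unfolding unscaled_map_def angle_quat_def by (intro smooth_intros smooth_at_spinor spinor_nonzero)

lemma smooth_at_tube_map: "c \<in> tube \<Longrightarrow> smooth_at c tube_map"
  unfolding tube_map_def by (intro smooth_intros smooth_at_unscaled_map) (auto simp: unscaled_map_nonzero)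

lemma open_tube: "open tube"
proof -
  have "continuous_on UNIV tube_coord" unfolding tube_coord_def by (intro continuous_intros)
  then have "open (tube_coord -` ball 0 1)" by (simp add: open_vimage)
  moreover have "tube = tube_coord -` ball 0 1" by (auto simp: tube_def)
  ultimately show ?thesis by simp
qed

subsection \<open>Deck transformations\<close>

text \<open>The identifications of the universal cover. The term \<open>- m x\<close> compensates the factor \<open>cis (m x)\<close>
  that the section acquires when \<open>y\<close> grows by \<open>2\<pi> m\<close>.\<close>

definition deck :: "int \<Rightarrow> int \<Rightarrow> int \<Rightarrow> int \<Rightarrow> coord \<Rightarrow> coord" where
  "deck l m n j c = (cX c + 2 * pi * of_int l, cY c + 2 * pi * of_int m, cU c + 2 * pi * of_int n,
     cZ c - of_int m * cX c + 2 * pi * of_int j, cP c, cW c)"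

text \<open>The derivative of a deck transformation.\<close>

definition deck_lin :: "int \<Rightarrow> coord \<Rightarrow> coord" where
  "deck_lin m v = (cX v, cY v, cU v, cZ v - of_int m * cX v, cP v, cW v)"

lemma tube_coord_deck: "tube_coord (deck l m n j c) = tube_coord c"
  by (simp add: tube_coord_def deck_def)

lemma deck_tube: "deck l m n j c \<in> tube \<longleftrightarrow> c \<in> tube"
  by (simp add: tube_def tube_coord_deck)

lemma spinor_deck: "spinor (deck l m n j c) = spinor c"
proof -
  have 1: "spinor_base (deck l m n j c) = csmul (cis (of_int m * cX c)) (spinor_base c)"
  proof -
    have "torus_section (cX (deck l m n j c)) (cY (deck l m n j c)) = csmul (cis (of_int m * cX c)) (torus_section (cX c) (cY c))"
      by (simp add: deck_def torus_section_shift)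
    then show ?thesis
      unfolding spinor_base_def tube_coord_deck by (simp add: qmul_csmul csmul_diff csmul_csmul mult.commute[of \<i>])
  qed
  have 2: "cis (cZ (deck l m n j c)) = cis (cZ c - of_int m * cX c)"
    by (simp add: deck_def cis_add_int)
  show ?thesis unfolding spinor_def 1 2 csmul_csmul by (simp add: cis_mult)
qed

lemma cos_sin_add_int: "cos (a + 2 * pi * of_int n) = cos a" "sin (a + 2 * pi * of_int n) = sin a"
  using sin_cos_eq_iff[of "a + 2 * pi * of_int n" a] by auto

lemma tube_map_deck: "tube_map (deck l m n j c) = tube_map c"
proof -
  have "angle_quat (deck l m n j c) = angle_quat c"
    unfolding angle_quat_def spinor_deck by (simp add: deck_def cis_add_int cos_sin_add_int)
  then show ?thesis by (simp add: tube_map_def unscaled_map_def spinor_deck)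
qed

lemma deck_has_derivative: "(deck l m n j has_derivative deck_lin m) (at c)"
  unfolding deck_def deck_lin_def by (auto intro!: derivative_eq_intros)

lemma frechet_tube_map_deck:
  assumes "c \<in> tube"
  shows "frechet_derivative tube_map (at (deck l m n j c)) (deck_lin m v) = frechet_derivative tube_map (at c) v"
proof -
  have "deck l m n j c \<in> tube" using assms by (simp add: deck_tube)
  from diff_chain_at[OF deck_has_derivative smooth_at_has_derivative[OF smooth_at_tube_map[OF this]]]
  have "(tube_map has_derivative (\<lambda>v. frechet_derivative tube_map (at (deck l m n j c)) (deck_lin m v))) (at c)"
    by (simp add: o_def tube_map_deck)
  then show ?thesis using frechet_derivative_at by metis
qed

lemma tube_map_components:
  assumes "c \<in> tube" "r > 0"
  obtains \<mu> where "\<mu> > 0" "prj (r *\<^sub>R tube_map c) = (\<mu> *\<^sub>R spinor c, \<mu> *\<^sub>R qmul (spinor c) (angle_quat c))"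
proof
  have n: "norm (unscaled_map c) > 0" using unscaled_map_nonzero[OF assms(1)] by simp
  show "r / norm (unscaled_map c) > 0" using n assms by simp
  show "prj (r *\<^sub>R tube_map c) = ((r / norm (unscaled_map c)) *\<^sub>R spinor c, (r / norm (unscaled_map c)) *\<^sub>R qmul (spinor c) (angle_quat c))"
    by (simp add: tube_map_def prj_scaleR emb_prj unscaled_map_def)
qed

lemma cis_eq_cis_iff: "cis a = cis b \<longleftrightarrow> (\<exists>n::int. a = b + 2 * pi * of_int n)"
  using sin_cos_eq_iff[of a b] by (auto simp: complex_eq_iff)

lemma exp_cis_eqD:
  assumes "exp a *\<^sub>R cis x = exp b *\<^sub>R cis y" shows "a = b" "cis x = cis y"
proof -
  have "norm (exp a *\<^sub>R cis x) = norm (exp b *\<^sub>R cis y)" using assms by simp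
  then show "a = b" by simp
  then show "cis x = cis y" using assms by simp
qed

lemma tube_coord_inj:
  assumes "g \<noteq> 0" "g - csmul \<i> (qmul g h) = g - csmul \<i> (qmul g h')" shows "h = h'"
proof -
  have "csmul \<i> (qmul g h) = csmul \<i> (qmul g h')" using assms(2) by simp
  then have "qmul g h = qmul g h'" by (auto simp: csmul_def prod_eq_iff)
  then have "(norm g)\<^sup>2 *\<^sub>R h = (norm g)\<^sup>2 *\<^sub>R h'" by (metis qconj_qmul_cancel)
  then show ?thesis using assms(1) by simp
qed

text \<open>The invariant quaternion gives back the angles modulo \<open>2\<pi>\<close> and the norm of the spinor, hence the
  spinor itself. After a deck transformation both points have the same \<open>x\<close> and \<open>y\<close>, and the product
  with the section yields \<open>z\<close> modulo \<open>2\<pi>\<close>, and then \<open>q\<close>.\<close>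

lemma tube_map_eqD:
  assumes "c \<in> tube" "c' \<in> tube" "tube_map c = tube_map c'"
  obtains l m n j where "c' = deck l m n j c"
proof -
  obtain a where a: "a > 0" "prj (1 *\<^sub>R tube_map c) = (a *\<^sub>R spinor c, a *\<^sub>R qmul (spinor c) (angle_quat c))"
    using tube_map_components[OF assms(1), of 1] by auto
  obtain b where b: "b > 0" "prj (1 *\<^sub>R tube_map c') = (b *\<^sub>R spinor c', b *\<^sub>R qmul (spinor c') (angle_quat c'))"
    using tube_map_components[OF assms(2), of 1] by auto
  have g: "a *\<^sub>R spinor c = b *\<^sub>R spinor c'" and h: "a *\<^sub>R qmul (spinor c) (angle_quat c) = b *\<^sub>R qmul (spinor c') (angle_quat c')"
    using a(2) b(2) assms(3) by auto
  have "qmul (b *\<^sub>R spinor c') (angle_quat c) = qmul (b *\<^sub>R spinor c') (angle_quat c')"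
    using h g by (metis qmul_scaleR_left)
  then have "(norm (b *\<^sub>R spinor c'))\<^sup>2 *\<^sub>R angle_quat c = (norm (b *\<^sub>R spinor c'))\<^sup>2 *\<^sub>R angle_quat c'"
    by (metis qconj_qmul_cancel)
  then have k: "angle_quat c = angle_quat c'" using b(1) spinor_nonzero[OF assms(2)] by simp
  let ?s = "norm (spinor c)" and ?s' = "norm (spinor c')"
  have s0: "?s > 0" "?s' > 0" using spinor_nonzero assms by auto
  have e: "?s * cos (cY c) = ?s' * cos (cY c')" "?s * sin (cY c) = ?s' * sin (cY c')"
     and x: "cis (cX c') = cis (cX c)" and u: "cis (cU c') = cis (cU c)"
  proof -
    have "exp (?s * cos (cY c)) *\<^sub>R cis (cX c) = exp (?s' * cos (cY c')) *\<^sub>R cis (cX c')"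
      "exp (?s * sin (cY c)) *\<^sub>R cis (cU c) = exp (?s' * sin (cY c')) *\<^sub>R cis (cU c')"
      using k unfolding angle_quat_def by blast+
    note * = exp_cis_eqD[OF this(1)] exp_cis_eqD[OF this(2)]
    show "?s * cos (cY c) = ?s' * cos (cY c')" "?s * sin (cY c) = ?s' * sin (cY c')"
      "cis (cX c') = cis (cX c)" "cis (cU c') = cis (cU c)"
      using * by simp_all
  qed
  have p: "?s *\<^sub>R cis (cY c) = ?s' *\<^sub>R cis (cY c')"
    using e by (simp add: complex_eq_iff)
  then have "norm (?s *\<^sub>R cis (cY c)) = norm (?s' *\<^sub>R cis (cY c'))" by simp
  then have s: "?s = ?s'" by simp
  with p s0 have y: "cis (cY c') = cis (cY c)" by simp
  from g have "norm (a *\<^sub>R spinor c) = norm (b *\<^sub>R spinor c')" by simp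
  with s s0 a(1) b(1) have "a = b" by simp
  with g b(1) have sp: "spinor c = spinor c'" by simp
  obtain l where l: "cX c' = cX c + 2 * pi * of_int l" using x by (auto simp: cis_eq_cis_iff)
  obtain m where m: "cY c' = cY c + 2 * pi * of_int m" using y by (auto simp: cis_eq_cis_iff)
  obtain n where n: "cU c' = cU c + 2 * pi * of_int n" using u by (auto simp: cis_eq_cis_iff)
  define d where "d = (cX c, cY c, cU c, cZ c' + of_int m * cX c, cP c', cW c')"
  have cd: "c' = deck l m n 0 d"
    unfolding d_def deck_def using l m n by (simp add: prod_eq_iff)
  have dt: "d \<in> tube" using assms(2) unfolding cd deck_tube .
  have spd: "spinor d = spinor c" using sp unfolding cd spinor_deck by simp
  let ?Q = "torus_section (cX c) (cY c)"
  have Qd: "torus_section (cX d) (cY d) = ?Q" by (simp add: d_def)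
  have "herm ?Q (spinor d) = herm ?Q (spinor c)" using spd by simp
  then have "cis (cZ d) * complex_of_real (inner ?Q (spinor_base d)) = cis (cZ c) * complex_of_real (inner ?Q (spinor_base c))"
    unfolding spinor_def herm_csmul using herm_torus_section_spinor_base[of c] herm_torus_section_spinor_base[of d] Qd by simp
  then have hz: "inner ?Q (spinor_base d) *\<^sub>R cis (cZ d) = inner ?Q (spinor_base c) *\<^sub>R cis (cZ c)"
    by (simp add: scaleR_conv_of_real mult.commute)
  have pos: "inner ?Q (spinor_base d) > 0" "inner ?Q (spinor_base c) > 0"
    using inner_torus_section_spinor_base_pos[OF dt] inner_torus_section_spinor_base_pos[OF assms(1)] Qd by auto
  from hz have "norm (inner ?Q (spinor_base d) *\<^sub>R cis (cZ d)) = norm (inner ?Q (spinor_base c) *\<^sub>R cis (cZ c))" by simp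
  with pos have "inner ?Q (spinor_base d) = inner ?Q (spinor_base c)" by simp
  with hz pos have z: "cis (cZ d) = cis (cZ c)" by simp
  have "csmul (cis (- cZ c)) (spinor d) = csmul (cis (- cZ c)) (spinor c)" using spd by simp
  then have "spinor_base d = spinor_base c" unfolding spinor_def z csmul_csmul by (simp add: cis_mult)
  then have "tube_coord d = tube_coord c" unfolding spinor_base_def Qd using tube_coord_inj torus_section_nonzero by metis
  then have q: "cP d = cP c" "cW d = cW c" by (auto simp: tube_coord_def)
  obtain j where j: "cZ d = cZ c + 2 * pi * of_int j" using z by (auto simp: cis_eq_cis_iff)
  have "c' = deck l m n j c"
    unfolding cd using j q by (simp add: deck_def d_def)
  then show ?thesis by (rule that)
qed

subsection \<open>Local smooth inverses\<close>

text \<open>The branch of the argument that is cut opposite to the angle \<open>t\<close>.\<close>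

definition angle_near :: "real \<Rightarrow> complex \<Rightarrow> real" where
  "angle_near t w = t + Im (Ln (cis (- t) * w))"

lemma cis_angle_near: "w \<noteq> 0 \<Longrightarrow> norm w *\<^sub>R cis (angle_near t w) = w"
proof -
  assume w: "w \<noteq> 0"
  then have nz: "cis (- t) * w \<noteq> 0" by simp
  have "cis (- t) * w = exp (Ln (cis (- t) * w))" using nz by simp
  also have "\<dots> = exp (Re (Ln (cis (- t) * w))) *\<^sub>R cis (Im (Ln (cis (- t) * w)))"
    by (simp add: exp_eq_polar scaleR_conv_of_real)
  also have "Re (Ln (cis (- t) * w)) = ln (norm w)" using nz by (simp add: norm_mult)
  finally have *: "cis (- t) * w = norm w *\<^sub>R cis (Im (Ln (cis (- t) * w)))" using w by simp
  have "norm w *\<^sub>R cis (angle_near t w) = cis t * (norm w *\<^sub>R cis (Im (Ln (cis (- t) * w))))"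
    by (simp add: angle_near_def cis_mult[symmetric] scaleR_conv_of_real mult_ac)
  also have "\<dots> = cis t * (cis (- t) * w)" using * by simp
  also have "\<dots> = w" by (simp add: mult.assoc[symmetric] cis_mult)
  finally show ?thesis .
qed

lemma angle_near_center: "r > 0 \<Longrightarrow> angle_near t (r *\<^sub>R cis t) = t"
proof -
  assume r: "r > 0"
  have "cis (- t) * (r *\<^sub>R cis t) = complex_of_real r" by (simp add: cis_mult scaleR_conv_of_real mult.left_commute)
  then show ?thesis using r by (simp add: angle_near_def Ln_of_real)
qed

lemma smooth_at_angle_near:
  assumes "smooth_at p f" "f p = r *\<^sub>R cis t" "r > 0"
  shows "smooth_at p (\<lambda>x. angle_near t (f x))"
proof -
  have "cis (- t) * (r *\<^sub>R cis t) = complex_of_real r" by (simp add: cis_mult scaleR_conv_of_real mult.left_commute)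
  then have "cis (- t) * f p \<notin> \<real>\<^sub>\<le>\<^sub>0" using assms by simp
  then show ?thesis unfolding angle_near_def by (intro smooth_intros assms(1))
qed

text \<open>This definition and those up to \<open>chart\<close> undo the steps in the definition of \<^const>\<open>tube_map\<close> in
  reverse order; the coordinates \<open>c\<close> only select the branches of the angles.\<close>

definition angle_quat_of :: "real ^ 8 \<Rightarrow> quat" where
  "angle_quat_of p = (1 / (norm (fst (prj p)))\<^sup>2) *\<^sub>R qmul (qconj (fst (prj p))) (snd (prj p))"

definition polar_of :: "real ^ 8 \<Rightarrow> complex" where
  "polar_of p = Complex (ln (cmod (fst (angle_quat_of p)))) (ln (cmod (snd (angle_quat_of p))))"

definition spinor_of :: "real ^ 8 \<Rightarrow> quat" where
  "spinor_of p = (cmod (polar_of p) / norm (fst (prj p))) *\<^sub>R fst (prj p)"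

definition torus_section_of :: "coord \<Rightarrow> real ^ 8 \<Rightarrow> quat" where
  "torus_section_of c p = torus_section (angle_near (cX c) (fst (angle_quat_of p))) (angle_near (cY c) (polar_of p))"

definition z_of :: "coord \<Rightarrow> real ^ 8 \<Rightarrow> real" where
  "z_of c p = angle_near (cZ c) (herm (torus_section_of c p) (spinor_of p))"

definition q_of :: "coord \<Rightarrow> real ^ 8 \<Rightarrow> quat" where
  "q_of c p = (1 / (norm (torus_section_of c p))\<^sup>2) *\<^sub>R
     qmul (qconj (torus_section_of c p)) (csmul \<i> (csmul (cis (- z_of c p)) (spinor_of p) - torus_section_of c p))"

definition chart :: "coord \<Rightarrow> real ^ 8 \<Rightarrow> coord" where
  "chart c p = (angle_near (cX c) (fst (angle_quat_of p)), angle_near (cY c) (polar_of p),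
     angle_near (cU c) (snd (angle_quat_of p)), z_of c p, Im (fst (q_of c p)), snd (q_of c p))"

definition regular :: "coord \<Rightarrow> real ^ 8 \<Rightarrow> bool" where
  "regular c p \<longleftrightarrow> fst (prj p) \<noteq> 0 \<and> fst (angle_quat_of p) \<noteq> 0 \<and> snd (angle_quat_of p) \<noteq> 0 \<and> polar_of p \<noteq> 0 \<and>
     herm (torus_section_of c p) (spinor_of p) \<noteq> 0"

text \<open>The point of the computation is that the quaternion \<open>q_of c p\<close> is imaginary, so that it is a
  possible value of \<^const>\<open>tube_coord\<close>: the phase \<open>z\<close> is chosen such that its real part vanishes.\<close>

lemma tube_map_chart:
  assumes "regular c p"
  shows "tube_map (chart c p) = (1 / norm p) *\<^sub>R p"
proof -
  let ?d = "chart c p" and ?Q = "torus_section_of c p" and ?g = "fst (prj p)" and ?h = "snd (prj p)" and ?z = "z_of c p"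
  from assms have nz: "?g \<noteq> 0" "fst (angle_quat_of p) \<noteq> 0" "snd (angle_quat_of p) \<noteq> 0" "polar_of p \<noteq> 0" "herm ?Q (spinor_of p) \<noteq> 0"
    by (auto simp: regular_def)
  let ?T = "herm ?Q (spinor_of p)"
  have Q: "torus_section (cX ?d) (cY ?d) = ?Q" by (simp add: chart_def torus_section_of_def)
  have Q0: "?Q \<noteq> 0" unfolding torus_section_of_def by (rule torus_section_nonzero)
  have T: "cis (- ?z) * ?T = complex_of_real (norm ?T)"
  proof -
    have "norm ?T *\<^sub>R cis ?z = ?T"
      unfolding z_of_def by (rule cis_angle_near[OF nz(5)])
    from arg_cong[OF this[symmetric], of "(*) (cis (- ?z))"]
    have "cis (- ?z) * ?T = cis (- ?z) * (norm ?T *\<^sub>R cis ?z)" .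
    also have "cis (- ?z) * (t *\<^sub>R cis ?z) = complex_of_real t" for t
      by (simp add: cis_mult scaleR_conv_of_real mult.left_commute)
    finally show ?thesis .
  qed
  let ?H = "csmul \<i> (csmul (cis (- ?z)) (spinor_of p) - ?Q)"
  have reH: "Re (fst (qmul (qconj ?Q) ?H)) = 0"
  proof -
    have "herm ?Q ?H = \<i> * (cis (- ?z) * ?T - complex_of_real ((norm ?Q)\<^sup>2))"
      unfolding norm_quat_sq_complex by (simp add: herm_def csmul_def algebra_simps)
    then have "herm ?Q ?H = \<i> * complex_of_real (norm ?T - (norm ?Q)\<^sup>2)" unfolding T by simp
    then have "Re (herm ?Q ?H) = 0" by simp
    moreover have "Re (fst (qmul (qconj g) h)) = Re (herm g h)" for g h
      by (simp add: qmul_def qconj_def herm_def)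
    ultimately show ?thesis by simp
  qed
  have qt: "tube_coord ?d = q_of c p"
  proof -
    have "Re (fst (q_of c p)) = 0" using reH by (simp add: q_of_def)
    then show ?thesis by (simp add: tube_coord_def chart_def prod_eq_iff complex_eq_iff)
  qed
  have "qmul ?Q (q_of c p) = ?H"
    unfolding q_of_def qmul_scaleR_right qmul_qconj_cancel using Q0 by simp
  then have "spinor_base ?d = ?Q - csmul \<i> ?H" unfolding spinor_base_def Q qt by simp
  also have "csmul \<i> ?H = ?Q - csmul (cis (- ?z)) (spinor_of p)"
    unfolding csmul_csmul by (simp add: csmul_def algebra_simps)
  finally have "spinor_base ?d = csmul (cis (- ?z)) (spinor_of p)" by simp
  then have sp: "spinor ?d = spinor_of p"
    unfolding spinor_def by (simp add: chart_def csmul_csmul cis_mult)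
  have ns: "norm (spinor_of p) = cmod (polar_of p)" using nz by (simp add: spinor_of_def)
  have pol: "polar_of p = cmod (polar_of p) *\<^sub>R cis (cY ?d)"
    using cis_angle_near[OF nz(4), of "cY c"] by (simp add: chart_def)
  have "cmod (polar_of p) * cos (cY ?d) = ln (cmod (fst (angle_quat_of p)))" "cmod (polar_of p) * sin (cY ?d) = ln (cmod (snd (angle_quat_of p)))"
    using arg_cong[OF pol, of Re] arg_cong[OF pol, of Im] by (simp_all add: polar_of_def)
  then have "angle_quat ?d = (cmod (fst (angle_quat_of p)) *\<^sub>R cis (cX ?d), cmod (snd (angle_quat_of p)) *\<^sub>R cis (cU ?d))"
    unfolding angle_quat_def sp ns using nz by simp
  also have "\<dots> = angle_quat_of p"
    using cis_angle_near[OF nz(2), of "cX c"] cis_angle_near[OF nz(3), of "cU c"] by (simp add: chart_def)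
  finally have k: "angle_quat ?d = angle_quat_of p" .
  let ?a = "cmod (polar_of p) / norm ?g"
  have a: "?a > 0" using nz by simp
  have "qmul (spinor_of p) (angle_quat_of p) = ?a *\<^sub>R ?h"
    unfolding spinor_of_def angle_quat_of_def qmul_scaleR_left qmul_scaleR_right qmul_qconj_cancel using nz by simp
  then have "unscaled_map ?d = ?a *\<^sub>R prj p"
    unfolding unscaled_map_def sp k by (simp add: spinor_of_def prod_eq_iff)
  then have "tube_map ?d = emb ((1 / (?a * norm (prj p))) *\<^sub>R ?a *\<^sub>R prj p)"
    unfolding tube_map_def using a by simp
  also have "\<dots> = (1 / norm p) *\<^sub>R p"
    using nz by (simp add: emb_scaleR emb_prj norm_prj)
  finally show ?thesis .
qed

text \<open>At the point with coordinates \<open>c\<close> the chart centred at \<open>c\<close> takes the value \<open>c\<close>, and no branch cut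
  is met there; this gives a smooth local inverse.\<close>

context
  fixes c :: coord and r :: real
  assumes c: "c \<in> tube" and r: "r > 0"
begin

lemma angle_quat_of_center: "angle_quat_of (r *\<^sub>R tube_map c) = angle_quat c"
proof -
  obtain \<mu> where m: "\<mu> > 0" "prj (r *\<^sub>R tube_map c) = (\<mu> *\<^sub>R spinor c, \<mu> *\<^sub>R qmul (spinor c) (angle_quat c))"
    using tube_map_components[OF c r] .
  have "angle_quat_of (r *\<^sub>R tube_map c) = (1 / (\<mu> * norm (spinor c))\<^sup>2) *\<^sub>R (\<mu>\<^sup>2 * (norm (spinor c))\<^sup>2) *\<^sub>R angle_quat c"
    unfolding angle_quat_of_def m(2) using m(1)
    by (simp add: qconj_scaleR qmul_scaleR_left qmul_scaleR_right qconj_qmul_cancel power2_eq_square)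
  then show ?thesis using m(1) spinor_nonzero[OF c] by (simp add: power_mult_distrib)
qed

lemma polar_of_center: "polar_of (r *\<^sub>R tube_map c) = norm (spinor c) *\<^sub>R cis (cY c)"
  unfolding polar_of_def angle_quat_of_center by (simp add: angle_quat_def complex_eq_iff)

lemma spinor_of_center: "spinor_of (r *\<^sub>R tube_map c) = spinor c"
proof -
  obtain \<mu> where m: "\<mu> > 0" "prj (r *\<^sub>R tube_map c) = (\<mu> *\<^sub>R spinor c, \<mu> *\<^sub>R qmul (spinor c) (angle_quat c))"
    using tube_map_components[OF c r] .
  then show ?thesis using spinor_nonzero[OF c] by (simp add: spinor_of_def polar_of_center)
qed

lemma fst_prj_center: "fst (prj (r *\<^sub>R tube_map c)) \<noteq> 0"
proof -
  obtain \<mu> where m: "\<mu> > 0" "prj (r *\<^sub>R tube_map c) = (\<mu> *\<^sub>R spinor c, \<mu> *\<^sub>R qmul (spinor c) (angle_quat c))"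
    using tube_map_components[OF c r] .
  then show ?thesis using spinor_nonzero[OF c] by simp
qed

lemma angles_center:
  "angle_near (cX c) (fst (angle_quat_of (r *\<^sub>R tube_map c))) = cX c"
  "angle_near (cU c) (snd (angle_quat_of (r *\<^sub>R tube_map c))) = cU c"
  "angle_near (cY c) (polar_of (r *\<^sub>R tube_map c)) = cY c"
  using spinor_nonzero[OF c]
  by (simp_all add: polar_of_center angle_quat_of_center angle_quat_def angle_near_center)

lemma torus_section_of_center: "torus_section_of c (r *\<^sub>R tube_map c) = torus_section (cX c) (cY c)"
  unfolding torus_section_of_def angles_center ..

lemma herm_center:
  "herm (torus_section_of c (r *\<^sub>R tube_map c)) (spinor_of (r *\<^sub>R tube_map c)) = inner (torus_section (cX c) (cY c)) (spinor_base c) *\<^sub>R cis (cZ c)"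
  unfolding spinor_of_center torus_section_of_center spinor_def herm_csmul
  by (simp add: herm_torus_section_spinor_base scaleR_conv_of_real mult.commute)

lemma z_of_center: "z_of c (r *\<^sub>R tube_map c) = cZ c"
  unfolding z_of_def herm_center by (rule angle_near_center[OF inner_torus_section_spinor_base_pos[OF c]])

lemma regular_center: "regular c (r *\<^sub>R tube_map c)"
  unfolding regular_def herm_center angle_quat_of_center polar_of_center
  using spinor_nonzero[OF c] inner_torus_section_spinor_base_pos[OF c] fst_prj_center by (simp add: angle_quat_def)

lemma q_of_center: "q_of c (r *\<^sub>R tube_map c) = tube_coord c"
proof -
  let ?Q = "torus_section (cX c) (cY c)"
  have "csmul \<i> (csmul (cis (- cZ c)) (spinor c) - ?Q) = qmul ?Q (tube_coord c)"
    unfolding spinor_def csmul_csmul spinor_base_def by (simp add: cis_mult csmul_diff csmul_csmul) (simp add: csmul_def)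
  then show ?thesis unfolding q_of_def torus_section_of_center z_of_center spinor_of_center
    using torus_section_nonzero by (simp add: qconj_qmul_cancel)
qed

lemma smooth_at_angle_quat_of: "smooth_at (r *\<^sub>R tube_map c) angle_quat_of"
  unfolding angle_quat_of_def using fst_prj_center by (intro smooth_intros) auto

lemma smooth_at_polar_of: "smooth_at (r *\<^sub>R tube_map c) polar_of"
proof -
  have "fst (angle_quat_of (r *\<^sub>R tube_map c)) \<noteq> 0" "snd (angle_quat_of (r *\<^sub>R tube_map c)) \<noteq> 0"
    using regular_center by (auto simp: regular_def)
  then show ?thesis unfolding polar_of_def by (intro smooth_intros smooth_at_angle_quat_of) auto
qed

lemma smooth_at_spinor_of: "smooth_at (r *\<^sub>R tube_map c) spinor_of"
proof -
  have "polar_of (r *\<^sub>R tube_map c) \<noteq> 0" using regular_center by (auto simp: regular_def)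
  then show ?thesis unfolding spinor_of_def using fst_prj_center
    by (intro smooth_intros smooth_at_polar_of) auto
qed

lemma smooth_at_angles:
  "smooth_at (r *\<^sub>R tube_map c) (\<lambda>p. angle_near (cX c) (fst (angle_quat_of p)))"
  "smooth_at (r *\<^sub>R tube_map c) (\<lambda>p. angle_near (cU c) (snd (angle_quat_of p)))"
  "smooth_at (r *\<^sub>R tube_map c) (\<lambda>p. angle_near (cY c) (polar_of p))"
proof -
  show "smooth_at (r *\<^sub>R tube_map c) (\<lambda>p. angle_near (cX c) (fst (angle_quat_of p)))"
    by (rule smooth_at_angle_near[OF smooth_at_fst[OF smooth_at_angle_quat_of], of "exp (norm (spinor c) * cos (cY c))"])
      (simp_all add: angle_quat_of_center angle_quat_def)
  show "smooth_at (r *\<^sub>R tube_map c) (\<lambda>p. angle_near (cU c) (snd (angle_quat_of p)))"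
    by (rule smooth_at_angle_near[OF smooth_at_snd[OF smooth_at_angle_quat_of], of "exp (norm (spinor c) * sin (cY c))"])
      (simp_all add: angle_quat_of_center angle_quat_def)
  show "smooth_at (r *\<^sub>R tube_map c) (\<lambda>p. angle_near (cY c) (polar_of p))"
    by (rule smooth_at_angle_near[OF smooth_at_polar_of polar_of_center]) (simp add: spinor_nonzero[OF c])
qed

lemma smooth_at_torus_section_of: "smooth_at (r *\<^sub>R tube_map c) (torus_section_of c)"
  unfolding torus_section_of_def by (intro smooth_at_torus_section smooth_at_angles)

lemma smooth_at_z_of: "smooth_at (r *\<^sub>R tube_map c) (z_of c)"
  unfolding z_of_def
  by (rule smooth_at_angle_near[OF smooth_at_herm[OF smooth_at_torus_section_of smooth_at_spinor_of] herm_center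
      inner_torus_section_spinor_base_pos[OF c]])

lemma smooth_at_q_of: "smooth_at (r *\<^sub>R tube_map c) (q_of c)"
proof -
  have "torus_section_of c (r *\<^sub>R tube_map c) \<noteq> 0" unfolding torus_section_of_center by (rule torus_section_nonzero)
  then show ?thesis unfolding q_of_def
    by (intro smooth_intros smooth_at_torus_section_of smooth_at_z_of smooth_at_spinor_of) auto
qed

lemma smooth_at_chart: "smooth_at (r *\<^sub>R tube_map c) (chart c)"
  unfolding chart_def
  by (intro smooth_at_Pair smooth_at_angles smooth_at_z_of smooth_at_Im smooth_at_fst smooth_at_snd smooth_at_q_of)

lemma chart_center: "chart c (r *\<^sub>R tube_map c) = c"
  unfolding chart_def q_of_center z_of_center angles_center by (simp add: tube_coord_def)

lemma eventually_regular: "\<forall>\<^sub>F p in nhds (r *\<^sub>R tube_map c). regular c p"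
proof -
  have ne: "\<forall>\<^sub>F p in nhds (r *\<^sub>R tube_map c). f p \<noteq> 0"
    if "smooth_at (r *\<^sub>R tube_map c) f" "f (r *\<^sub>R tube_map c) \<noteq> 0" for f :: "real ^ 8 \<Rightarrow> 'b::euclidean_space"
    using smooth_at_isCont[OF that(1)] that(2) tendsto_imp_eventually_ne
    by (force simp: isCont_def tendsto_at_iff_tendsto_nhds)
  note * = regular_center[unfolded regular_def]
  have "\<forall>\<^sub>F p in nhds (r *\<^sub>R tube_map c). fst (prj p) \<noteq> 0"
    using * by (intro ne smooth_intros) auto
  moreover have "\<forall>\<^sub>F p in nhds (r *\<^sub>R tube_map c). fst (angle_quat_of p) \<noteq> 0"
    using * by (intro ne smooth_at_fst smooth_at_angle_quat_of) auto
  moreover have "\<forall>\<^sub>F p in nhds (r *\<^sub>R tube_map c). snd (angle_quat_of p) \<noteq> 0"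
    using * by (intro ne smooth_at_snd smooth_at_angle_quat_of) auto
  moreover have "\<forall>\<^sub>F p in nhds (r *\<^sub>R tube_map c). polar_of p \<noteq> 0"
    using * by (intro ne smooth_at_polar_of) auto
  moreover have "\<forall>\<^sub>F p in nhds (r *\<^sub>R tube_map c). herm (torus_section_of c p) (spinor_of p) \<noteq> 0"
    using * by (intro ne smooth_at_herm smooth_at_torus_section_of smooth_at_spinor_of) auto
  ultimately show ?thesis by eventually_elim (simp add: regular_def)
qed

lemma eventually_chart: "\<forall>\<^sub>F p in nhds (r *\<^sub>R tube_map c). chart c p \<in> tube \<and> tube_map (chart c p) = (1 / norm p) *\<^sub>R p"
proof -
  have "(chart c \<longlongrightarrow> chart c (r *\<^sub>R tube_map c)) (nhds (r *\<^sub>R tube_map c))"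
    using smooth_at_isCont[OF smooth_at_chart]
    unfolding isCont_def tendsto_at_iff_tendsto_nhds .
  then have "(chart c \<longlongrightarrow> c) (nhds (r *\<^sub>R tube_map c))" unfolding chart_center .
  then have "\<forall>\<^sub>F p in nhds (r *\<^sub>R tube_map c). chart c p \<in> tube"
    using open_tube c topological_tendstoD by blast
  with eventually_regular show ?thesis by eventually_elim (simp add: tube_map_chart)
qed

end

section \<open>The vector field\<close>

text \<open>The term along the fibre makes the field invariant under the deck transformations
  (\<open>deck_invariant_drift\<close>).\<close>

definition drift_dir :: "coord \<Rightarrow> coord" where
  "drift_dir c = (cos (cU c), sin (cU c), 0, - (cY c / (2 * pi)) * cos (cU c), 0, 0)"

definition turn_dir :: coord where "turn_dir = (0, 0, 1, 0, 0, 0)"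

definition fibre_dir :: coord where "fibre_dir = (0, 0, 0, 1, 0, 0)"

definition cutoff :: "coord \<Rightarrow> real" where
  "cutoff c = flat 0 (1/2 - (norm (tube_coord c))\<^sup>2)"

definition drift :: "coord \<Rightarrow> real ^ 8" where
  "drift c = cutoff c *\<^sub>R frechet_derivative tube_map (at c) (drift_dir c)"

definition turn :: "coord \<Rightarrow> real ^ 8" where
  "turn c = (cutoff c)\<^sup>2 *\<^sub>R frechet_derivative tube_map (at c) turn_dir"

text \<open>The extension of \<open>w\<close>, given along the unit sphere in terms of the coordinates, to a homogeneous
  field of degree one that vanishes outside the cone over the tube.\<close>

definition cone_field :: "(coord \<Rightarrow> real ^ 8) \<Rightarrow> real ^ 8 \<Rightarrow> real ^ 8" where
  "cone_field w p = (if p \<noteq> 0 \<and> (\<exists>c\<in>tube. tube_map c = (1 / norm p) *\<^sub>R p)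
     then norm p *\<^sub>R w (SOME c. c \<in> tube \<and> tube_map c = (1 / norm p) *\<^sub>R p) else 0)"

definition deck_invariant :: "(coord \<Rightarrow> real ^ 8) \<Rightarrow> bool" where
  "deck_invariant w \<longleftrightarrow> (\<forall>c\<in>tube. \<forall>l m n j. w (deck l m n j c) = w c)"

lemma cutoff_deck: "cutoff (deck l m n j c) = cutoff c"
  by (simp add: cutoff_def tube_coord_deck)

lemma deck_invariant_drift: "deck_invariant drift"
  unfolding deck_invariant_def
proof (intro ballI allI)
  fix c l m n j assume "c \<in> tube"
  have "(cY c + 2 * pi * of_int m) / (2 * pi) = cY c / (2 * pi) + of_int m" by (simp add: field_simps)
  then have "drift_dir (deck l m n j c) = deck_lin m (drift_dir c)"
    unfolding drift_dir_def deck_def deck_lin_def fst_conv snd_conv cos_sin_add_int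
    by (simp add: algebra_simps)
  then show "drift (deck l m n j c) = drift c"
    by (simp add: drift_def cutoff_deck frechet_tube_map_deck[OF \<open>c \<in> tube\<close>])
qed

lemma deck_invariant_turn: "deck_invariant turn"
  unfolding deck_invariant_def
proof (intro ballI allI)
  fix c l m n j assume "c \<in> tube"
  have "turn_dir = deck_lin m turn_dir" by (simp add: turn_dir_def deck_lin_def)
  then have "frechet_derivative tube_map (at (deck l m n j c)) turn_dir = frechet_derivative tube_map (at c) turn_dir"
    using frechet_tube_map_deck[OF \<open>c \<in> tube\<close>, of l m n j turn_dir] by simp
  then show "turn (deck l m n j c) = turn c"
    by (simp add: turn_def cutoff_deck)
qed

lemma cone_field_eq_norm:
  assumes "deck_invariant w" "c \<in> tube" "p \<noteq> 0" "tube_map c = (1 / norm p) *\<^sub>R p"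
  shows "cone_field w p = norm p *\<^sub>R w c"
proof -
  let ?d = "SOME c. c \<in> tube \<and> tube_map c = (1 / norm p) *\<^sub>R p"
  have d: "?d \<in> tube \<and> tube_map ?d = (1 / norm p) *\<^sub>R p"
    by (rule someI[of "\<lambda>c. c \<in> tube \<and> tube_map c = (1 / norm p) *\<^sub>R p" c]) (use assms in simp)
  then obtain l m n j where "?d = deck l m n j c"
    using tube_map_eqD[OF assms(2), of ?d] assms(4) by metis
  then have "w ?d = w c" using assms by (auto simp: deck_invariant_def)
  then show ?thesis using assms by (auto simp: cone_field_def)
qed

lemma cone_field_scaled_tube_map:
  assumes "deck_invariant w" "c \<in> tube" "r > 0"
  shows "cone_field w (r *\<^sub>R tube_map c) = r *\<^sub>R w c"
proof -
  have n: "norm (r *\<^sub>R tube_map c) = r" using norm_tube_map[OF assms(2)] assms(3) by simp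
  then have "r *\<^sub>R tube_map c \<noteq> 0" using assms(3) by auto
  moreover have "tube_map c = (1 / norm (r *\<^sub>R tube_map c)) *\<^sub>R r *\<^sub>R tube_map c" unfolding n using assms(3) by simp
  ultimately show ?thesis using cone_field_eq_norm[OF assms(1,2)] n by metis
qed

lemma homogeneous_cone_field: "homogeneous 1 (cone_field w)"
  unfolding homogeneous_def
proof (intro allI impI, elim conjE)
  fix l :: real and p :: "real ^ 8" assume "l > 0" "p \<noteq> 0"
  then have "(1 / norm (l *\<^sub>R p)) *\<^sub>R (l *\<^sub>R p) = (1 / norm p) *\<^sub>R p" by simp
  then show "cone_field w (l *\<^sub>R p) = (l powr 1) *\<^sub>R cone_field w p"
    using \<open>l > 0\<close> by (simp add: cone_field_def)
qed

text \<open>Modulo the deck group the parameters of the core are bounded. The core is therefore closed in the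
  sphere, and fields supported in it extend smoothly by zero.\<close>

lemma compact_core: "compact (tube_map ` {c. (norm (tube_coord c))\<^sup>2 \<le> 1/2})"
proof -
  let ?I = "{0 .. 2 * pi}"
  define B :: "coord set" where "B = (?I \<times> ?I \<times> ?I \<times> ?I \<times> {-1..1} \<times> cball 0 1) \<inter> {c. (norm (tube_coord c))\<^sup>2 \<le> 1/2}"
  have "closed {c. (norm (tube_coord c))\<^sup>2 \<le> 1/2}"
    unfolding tube_coord_def by (intro closed_Collect_le continuous_intros)
  then have cB: "compact B" unfolding B_def by (intro compact_Int_closed compact_Times) auto
  have t: "c \<in> tube" if "(norm (tube_coord c))\<^sup>2 \<le> 1/2" for c
  proof -
    from that have "(norm (tube_coord c))\<^sup>2 < 1\<^sup>2" by simp
    then show ?thesis unfolding tube_def by (simp add: power2_less_imp_less)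
  qed
  have "continuous_on B tube_map"
    using t by (intro continuous_at_imp_continuous_on ballI smooth_at_isCont smooth_at_tube_map) (auto simp: B_def)
  then have "compact (tube_map ` B)" using cB by (rule compact_continuous_image)
  moreover have "tube_map ` {c. (norm (tube_coord c))\<^sup>2 \<le> 1/2} = tube_map ` B"
  proof (intro subset_antisym image_subsetI)
    fix c assume "c \<in> {c. (norm (tube_coord c))\<^sup>2 \<le> 1/2}"
    then have q: "(norm (tube_coord c))\<^sup>2 \<le> 1/2" by simp
    have n: "(norm (tube_coord c))\<^sup>2 = (cP c)\<^sup>2 + (cmod (cW c))\<^sup>2"
      by (simp add: tube_coord_def norm_quat_sq norm_mult)
    have "(cP c)\<^sup>2 \<le> 1\<^sup>2" "(cmod (cW c))\<^sup>2 \<le> 1\<^sup>2"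
      using q n zero_le_power2[of "cP c"] zero_le_power2[of "cmod (cW c)"] by (simp_all only: one_power2)
    then have PW: "\<bar>cP c\<bar> \<le> 1" "cmod (cW c) \<le> 1"
      using abs_le_square_iff[of "cP c" 1] power2_le_imp_le[of "cmod (cW c)" 1] by simp_all
    have red: "\<exists>n::int. a + 2 * pi * of_int n \<in> ?I" for a
    proof
      define k where "k = real_of_int \<lfloor>a / (2 * pi)\<rfloor>"
      have "k \<le> a / (2 * pi)" "a / (2 * pi) \<le> k + 1" unfolding k_def by linarith+
      then show "a + 2 * pi * of_int (- \<lfloor>a / (2 * pi)\<rfloor>) \<in> ?I"
        unfolding of_int_minus k_def[symmetric] by (simp add: field_simps)
    qed
    obtain l m n where lmn: "cX c + 2 * pi * of_int l \<in> ?I" "cY c + 2 * pi * of_int m \<in> ?I" "cU c + 2 * pi * of_int n \<in> ?I"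
      using red by metis
    obtain j where j: "(cZ c - of_int m * cX c) + 2 * pi * of_int j \<in> ?I" using red by metis
    have "deck l m n j c \<in> B"
      unfolding B_def using lmn j PW q by (simp add: tube_coord_deck) (simp add: deck_def mem_Times_iff abs_le_iff)
    then show "tube_map c \<in> tube_map ` B" using tube_map_deck by (metis imageI)
  qed (auto simp: B_def)
  ultimately show ?thesis by simp
qed

lemma smooth_at_cone_field:
  assumes inv: "deck_invariant w" and smooth: "\<And>c. c \<in> tube \<Longrightarrow> smooth_at c w"
    and supp: "\<And>c. (norm (tube_coord c))\<^sup>2 > 1/2 \<Longrightarrow> w c = 0" and "p \<noteq> 0"
  shows "smooth_at p (cone_field w)"
proof (cases "\<exists>c\<in>tube. tube_map c = (1 / norm p) *\<^sub>R p")
  case True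
  then obtain c where c: "c \<in> tube" "tube_map c = (1 / norm p) *\<^sub>R p" by blast
  let ?r = "norm p"
  have r: "?r > 0" using assms by simp
  have p: "?r *\<^sub>R tube_map c = p" unfolding c(2) using r by simp
  have "smooth_at (?r *\<^sub>R tube_map c) (\<lambda>p. norm p *\<^sub>R w (chart c p))"
  proof (rule smooth_at_scaleR[OF smooth_at_norm[OF smooth_at_id]])
    have "smooth_at (chart c (?r *\<^sub>R tube_map c)) w" unfolding chart_center[OF c(1) r] by (rule smooth[OF c(1)])
    then show "smooth_at (?r *\<^sub>R tube_map c) (\<lambda>p. w (chart c p))"
      by (rule smooth_at_compose[OF _ smooth_at_chart[OF c(1) r]])
    show "?r *\<^sub>R tube_map c \<noteq> 0" unfolding p by (rule assms(4))
  qed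
  moreover have "\<forall>\<^sub>F q in nhds p. q \<noteq> 0"
    using assms(4) t1_space_nhds[of p 0] by simp
  with eventually_chart[OF c(1) r] have "\<forall>\<^sub>F q in nhds (?r *\<^sub>R tube_map c). norm q *\<^sub>R w (chart c q) = cone_field w q"
    unfolding p
  proof eventually_elim
    case (elim q)
    then show ?case using cone_field_eq_norm[OF inv, of "chart c q" q] by simp
  qed
  ultimately have "smooth_at (?r *\<^sub>R tube_map c) (cone_field w)" by (rule smooth_at_cong)
  then show ?thesis unfolding p .
next
  case False
  let ?K = "tube_map ` {c. (norm (tube_coord c))\<^sup>2 \<le> 1/2}"
  have t: "c \<in> tube" if "(norm (tube_coord c))\<^sup>2 \<le> 1/2" for c
  proof -
    from that have "(norm (tube_coord c))\<^sup>2 < 1\<^sup>2" by simp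
    then show ?thesis unfolding tube_def by (simp add: power2_less_imp_less)
  qed
  have cl: "closed ?K" using compact_core by (rule compact_imp_closed)
  have ni: "(1 / norm p) *\<^sub>R p \<in> - ?K"
  proof
    assume "(1 / norm p) *\<^sub>R p \<in> ?K"
    then obtain c where "(norm (tube_coord c))\<^sup>2 \<le> 1/2" "(1 / norm p) *\<^sub>R p = tube_map c" by blast
    then show False using False t by metis
  qed
  have lim: "((\<lambda>q. (1 / norm q) *\<^sub>R q) \<longlongrightarrow> (1 / norm p) *\<^sub>R p) (nhds p)"
  proof -
    have "isCont (\<lambda>q. (1 / norm q) *\<^sub>R q) p" using assms(4) by (intro continuous_intros) auto
    then show ?thesis unfolding isCont_def
      using tendsto_at_iff_tendsto_nhds[of "\<lambda>q. (1 / norm q) *\<^sub>R q" p] by blast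
  qed
  have "\<forall>\<^sub>F q in nhds p. (1 / norm q) *\<^sub>R q \<in> - ?K"
    by (rule topological_tendstoD[OF lim open_Compl[OF cl] ni])
  then have "\<forall>\<^sub>F q in nhds p. 0 = cone_field w q"
  proof eventually_elim
    case (elim q)
    show ?case
    proof (cases "q \<noteq> 0 \<and> (\<exists>c\<in>tube. tube_map c = (1 / norm q) *\<^sub>R q)")
      case True
      then obtain c where c: "c \<in> tube" "tube_map c = (1 / norm q) *\<^sub>R q" by blast
      have "\<not> (norm (tube_coord c))\<^sup>2 \<le> 1/2"
      proof
        assume "(norm (tube_coord c))\<^sup>2 \<le> 1/2"
        then have "tube_map c \<in> ?K" by blast
        then show False using elim unfolding c(2) by blast
      qed
      then have "w c = 0" using supp by auto
      then show ?thesis using cone_field_eq_norm[OF inv c(1) _ c(2)] True by simp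
    qed (auto simp: cone_field_def)
  qed
  then show ?thesis by (rule smooth_at_cong[OF smooth_at_const])
qed

lemma smooth_at_cutoff: "smooth_at c cutoff"
proof -
  have "smooth_at c (\<lambda>c. flat 0 (1/2 - inner (tube_coord c) (tube_coord c)))"
    unfolding tube_coord_def by (intro smooth_intros)
  moreover have "cutoff = (\<lambda>c. flat 0 (1/2 - inner (tube_coord c) (tube_coord c)))"
    by (rule ext) (simp only: cutoff_def power2_norm_eq_inner)
  ultimately show ?thesis by simp
qed

lemma smooth_at_drift: "c \<in> tube \<Longrightarrow> smooth_at c drift"
  unfolding drift_def drift_dir_def
  by (intro smooth_at_scaleR smooth_at_cutoff smooth_at_directional_derivative smooth_at_tube_map smooth_at_Pair
      smooth_at_mult smooth_at_minus smooth_at_divide smooth_intros) auto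

lemma smooth_at_turn: "c \<in> tube \<Longrightarrow> smooth_at c turn"
  unfolding turn_def
  by (intro smooth_at_scaleR smooth_at_power smooth_at_cutoff smooth_at_directional_derivative smooth_at_tube_map smooth_at_const)

lemma cutoff_zero: "(norm (tube_coord c))\<^sup>2 > 1/2 \<Longrightarrow> cutoff c = 0"
  by (simp add: cutoff_def flat_nonpos)

lemma smooth_at_cone_field_drift: "p \<noteq> 0 \<Longrightarrow> smooth_at p (cone_field drift)"
  by (rule smooth_at_cone_field[OF deck_invariant_drift smooth_at_drift]) (auto simp: drift_def cutoff_zero)

lemma smooth_at_cone_field_turn: "p \<noteq> 0 \<Longrightarrow> smooth_at p (cone_field turn)"
  by (rule smooth_at_cone_field[OF deck_invariant_turn smooth_at_turn]) (auto simp: turn_def cutoff_zero)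

text \<open>The unperturbed flow, in which all orbits except the origin have period \<open>2\<pi>\<close>.\<close>

definition phase_rot :: "real \<Rightarrow> real ^ 8 \<Rightarrow> real ^ 8" where
  "phase_rot t p = emb (csmul (cis t) (fst (prj p)), csmul (cis t) (snd (prj p)))"

definition times_i :: "real ^ 8 \<Rightarrow> real ^ 8" where
  "times_i p = emb (csmul \<i> (fst (prj p)), csmul \<i> (snd (prj p)))"

definition amplitude :: "real ^ 8 \<Rightarrow> real" where "amplitude p = flat 0 (p \<bullet> p)"

text \<open>The factor \<open>- 1 / (4 \<pi>)\<close> is the turning rate for which the area enclosed by the drifting orbit
  cancels the motion along the fibre.\<close>

definition multicentre_field :: "real ^ 8 \<Rightarrow> real ^ 8" where
  "multicentre_field p = times_i p + amplitude p *\<^sub>R cone_field drift p + (- 1 / (4 * pi)) *\<^sub>R (amplitude p *\<^sub>R (amplitude p *\<^sub>R cone_field turn p))"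

lemma linear_times_i: "linear times_i"
proof -
  have "linear (\<lambda>v::quat \<times> quat. (csmul \<i> (fst v), csmul \<i> (snd v)))"
    by (rule linearI) (auto simp: csmul_def algebra_simps)
  then have "linear (emb \<circ> (\<lambda>v. (csmul \<i> (fst v), csmul \<i> (snd v))) \<circ> prj)"
    by (intro linear_compose emb_prj)
  then show ?thesis by (simp add: times_i_def[abs_def] o_def)
qed

lemma bounded_linear_times_i: "bounded_linear times_i"
  using linear_times_i linear_conv_bounded_linear by blast

lemma smooth_at_times_i: "smooth_at p times_i"
  using smooth_at_linear_of[OF bounded_linear_times_i smooth_at_id] .

lemma smooth_at_amplitude_cone_field:
  assumes "\<And>p. p \<noteq> 0 \<Longrightarrow> smooth_at p (cone_field w)"
  shows "smooth_at p (\<lambda>p. amplitude p *\<^sub>R cone_field w p)"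
  using smooth_flat_homogeneous[OF homogeneous_cone_field assms, of 0]
  unfolding smooth_on_iff_smooth_at[OF open_UNIV] amplitude_def by blast

lemma smooth_at_amplitude: "smooth_at p amplitude"
  unfolding amplitude_def by (intro smooth_intros)

lemma smooth_at_multicentre_field: "smooth_at p multicentre_field"
  unfolding multicentre_field_def
  by (intro smooth_at_add smooth_at_times_i smooth_at_scaleR[OF smooth_at_const] smooth_at_scaleR[OF smooth_at_amplitude]
      smooth_at_amplitude_cone_field smooth_at_cone_field_drift smooth_at_cone_field_turn)

lemma smooth_on_multicentre_field: "smooth_on UNIV multicentre_field"
  using smooth_at_multicentre_field by (simp add: smooth_on_iff_smooth_at)

lemma norm_csmul_pair:
  assumes "cmod c = 1" shows "norm (csmul c (fst v), csmul c (snd v)) = norm v"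
  using assms by (cases v) (simp only: norm_Pair norm_csmul fst_conv snd_conv mult_1)

lemma norm_times_i: "norm (times_i p) = norm p"
  unfolding times_i_def emb_prj by (simp only: norm_csmul_pair norm_ii norm_prj)

lemma norm_phase_rot: "norm (phase_rot t p) = norm p"
  unfolding phase_rot_def emb_prj by (simp only: norm_csmul_pair norm_cis norm_prj)

lemma times_i_times_i: "times_i (times_i p) = - p"
proof -
  have "csmul (- 1) v = - v" for v by (simp add: csmul_def prod_eq_iff)
  then have "times_i (times_i p) = emb (- prj p)"
    by (simp add: times_i_def emb_prj csmul_csmul uminus_prod_def)
  then show ?thesis by (simp add: linear_neg[OF emb_prj(1)] emb_prj)
qed

lemma phase_rot_eq: "phase_rot t p = cos t *\<^sub>R p + sin t *\<^sub>R times_i p"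
proof -
  have c: "csmul (cis t) v = cos t *\<^sub>R v + sin t *\<^sub>R csmul \<i> v" for v
    by (simp add: csmul_def prod_eq_iff complex_eq_iff)
  have "phase_rot t p = emb (cos t *\<^sub>R prj p + sin t *\<^sub>R (csmul \<i> (fst (prj p)), csmul \<i> (snd (prj p))))"
    by (cases "prj p") (simp add: phase_rot_def c)
  then show ?thesis
    by (simp only: linear_add[OF emb_prj(1)] emb_scaleR emb_prj(5) times_i_def)
qed

text \<open>Rotation by a quarter of \<open>\<pi>\<close> preserves the norm, and the cross term in the norm of
  \<open>cos t p + sin t (i p)\<close> is this inner product.\<close>

lemma times_i_inner: "times_i p \<bullet> p = 0"
proof -
  have "(norm (phase_rot (pi/4) p))\<^sup>2 = (norm p)\<^sup>2 + times_i p \<bullet> p"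
  proof -
    have "(norm (phase_rot (pi/4) p))\<^sup>2 = (cos (pi/4))\<^sup>2 * (p \<bullet> p) + 2 * cos (pi/4) * sin (pi/4) * (times_i p \<bullet> p)
        + (sin (pi/4))\<^sup>2 * (times_i p \<bullet> times_i p)"
      unfolding phase_rot_eq power2_norm_eq_inner
      by (simp add: inner_add_left inner_add_right inner_commute power2_eq_square algebra_simps)
    moreover have "times_i p \<bullet> times_i p = p \<bullet> p" using norm_times_i by (simp add: norm_eq_sqrt_inner)
    moreover have "(cos (pi/4))\<^sup>2 = 1/2" "(sin (pi/4))\<^sup>2 = 1/2" "2 * cos (pi/4) * sin (pi/4) = 1"
      by (simp_all add: cos_45 sin_45 power2_eq_square)
    ultimately show ?thesis by (simp add: power2_norm_eq_inner)
  qed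
  then show ?thesis by (simp add: norm_phase_rot)
qed

lemma phase_rot_phase_rot: "phase_rot s (phase_rot t p) = phase_rot (s + t) p"
  by (simp add: phase_rot_def emb_prj csmul_csmul cis_mult)

lemma phase_rot_scaleR: "phase_rot t (a *\<^sub>R p) = a *\<^sub>R phase_rot t p"
  by (simp add: phase_rot_eq linear_cmul[OF linear_times_i] scaleR_add_right mult.commute)

lemma phase_rot_0: "phase_rot 0 p = p"
  by (simp add: phase_rot_eq)

lemma times_i_phase_rot: "times_i (phase_rot t p) = - sin t *\<^sub>R p + cos t *\<^sub>R times_i p"
  unfolding phase_rot_eq linear_add[OF linear_times_i] linear_cmul[OF linear_times_i] times_i_times_i by simp

lemma phase_rot_has_vector_derivative: "((\<lambda>t. phase_rot t p) has_vector_derivative times_i (phase_rot t p)) (at t)"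
  unfolding times_i_phase_rot unfolding phase_rot_eq
  by (auto intro!: derivative_eq_intros simp: has_real_derivative_iff_has_vector_derivative[symmetric])

definition shift_z :: "real \<Rightarrow> coord \<Rightarrow> coord" where
  "shift_z t c = (cX c, cY c, cU c, cZ c + t, cP c, cW c)"

lemma tube_coord_shift_z: "tube_coord (shift_z t c) = tube_coord c"
  by (simp add: tube_coord_def shift_z_def)

lemma tube_map_shift_z: "tube_map (shift_z t c) = phase_rot t (tube_map c)"
proof -
  have sp: "spinor (shift_z t c) = csmul (cis t) (spinor c)"
    by (simp add: spinor_def spinor_base_def shift_z_def tube_coord_def csmul_csmul cis_mult add.commute)
  have "angle_quat (shift_z t c) = angle_quat c"
    unfolding angle_quat_def sp by (simp add: norm_csmul shift_z_def)
  then have r: "unscaled_map (shift_z t c) = (csmul (cis t) (fst (unscaled_map c)), csmul (cis t) (snd (unscaled_map c)))"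
    by (simp add: unscaled_map_def sp qmul_csmul)
  have n: "norm (unscaled_map (shift_z t c)) = norm (unscaled_map c)"
    unfolding r by (rule norm_csmul_pair) simp
  show ?thesis
    unfolding tube_map_def phase_rot_def emb_prj n unfolding r
    by (simp only: scaleR_Pair fst_scaleR snd_scaleR csmul_scaleR)
qed

lemma frechet_tube_map_fibre_dir: "c \<in> tube \<Longrightarrow> frechet_derivative tube_map (at c) fibre_dir = times_i (tube_map c)"
proof -
  assume c: "c \<in> tube"
  have s0: "shift_z 0 c = c" by (simp add: shift_z_def)
  have "((\<lambda>t. shift_z t c) has_derivative (\<lambda>h. h *\<^sub>R fibre_dir)) (at 0)"
    unfolding shift_z_def fibre_dir_def by (auto intro!: derivative_eq_intros simp: zero_prod_def)
  from diff_chain_at[OF this, unfolded s0, OF smooth_at_has_derivative[OF smooth_at_tube_map[OF c]]]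
  have "((\<lambda>t. phase_rot t (tube_map c)) has_derivative (\<lambda>h. frechet_derivative tube_map (at c) (h *\<^sub>R fibre_dir))) (at 0)"
    by (simp add: o_def tube_map_shift_z)
  moreover have "((\<lambda>t. phase_rot t (tube_map c)) has_derivative (\<lambda>h. h *\<^sub>R times_i (tube_map c))) (at 0)"
    using phase_rot_has_vector_derivative[of "tube_map c" 0] by (simp add: has_vector_derivative_def phase_rot_0)
  ultimately have "(\<lambda>h. frechet_derivative tube_map (at c) (h *\<^sub>R fibre_dir)) = (\<lambda>h. h *\<^sub>R times_i (tube_map c))"
    by (rule has_derivative_unique)
  then have "frechet_derivative tube_map (at c) (1 *\<^sub>R fibre_dir) = 1 *\<^sub>R times_i (tube_map c)" by meson
  then show ?thesis by simp
qed

lemma frechet_tube_map_inner: "c \<in> tube \<Longrightarrow> frechet_derivative tube_map (at c) v \<bullet> tube_map c = 0"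
proof -
  assume c: "c \<in> tube"
  note d = smooth_at_has_derivative[OF smooth_at_tube_map[OF c]]
  have "((\<lambda>c. tube_map c \<bullet> tube_map c) has_derivative
      (\<lambda>v. tube_map c \<bullet> frechet_derivative tube_map (at c) v + frechet_derivative tube_map (at c) v \<bullet> tube_map c)) (at c)"
    by (rule has_derivative_inner[OF d d])
  moreover have "((\<lambda>c. tube_map c \<bullet> tube_map c) has_derivative (\<lambda>v. 0)) (at c)"
    by (rule has_derivative_transform_within_open[OF has_derivative_const open_tube c])
       (simp add: norm_tube_map power2_norm_eq_inner[symmetric])
  ultimately have "(\<lambda>v. tube_map c \<bullet> frechet_derivative tube_map (at c) v + frechet_derivative tube_map (at c) v \<bullet> tube_map c) = (\<lambda>v. 0)"
    by (rule has_derivative_unique)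
  then have "tube_map c \<bullet> frechet_derivative tube_map (at c) v + frechet_derivative tube_map (at c) v \<bullet> tube_map c = 0" by meson
  then show ?thesis by (simp add: inner_commute)
qed

lemma cone_field_inner:
  assumes "deck_invariant w" "\<And>c. c \<in> tube \<Longrightarrow> w c \<bullet> tube_map c = 0"
  shows "cone_field w p \<bullet> p = 0"
proof (cases "p \<noteq> 0 \<and> (\<exists>c\<in>tube. tube_map c = (1 / norm p) *\<^sub>R p)")
  case True
  then obtain c where c: "c \<in> tube" "tube_map c = (1 / norm p) *\<^sub>R p" by blast
  have "norm p *\<^sub>R tube_map c = p" unfolding c(2) using True by simp
  then have "w c \<bullet> p = norm p * (w c \<bullet> tube_map c)" by (metis inner_scaleR_right)
  then show ?thesis using cone_field_eq_norm[OF assms(1) c(1) _ c(2)] True assms(2)[OF c(1)] by simp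
qed (auto simp: cone_field_def)

lemma multicentre_field_inner: "multicentre_field p \<bullet> p = 0"
proof -
  have "cone_field drift p \<bullet> p = 0"
    by (rule cone_field_inner[OF deck_invariant_drift]) (simp add: drift_def frechet_tube_map_inner)
  moreover have "cone_field turn p \<bullet> p = 0"
    by (rule cone_field_inner[OF deck_invariant_turn]) (simp add: turn_def frechet_tube_map_inner)
  ultimately show ?thesis by (simp add: multicentre_field_def inner_add_left inner_diff_left times_i_inner)
qed

text \<open>In the coordinates of the tube, on the sphere of radius \<open>r\<close>, the field is the model field with
  drift velocity \<open>\<eta>\<close>.\<close>

lemma multicentre_field_scaled_tube_map:
  assumes "c \<in> tube" "r > 0" "\<eta> = flat 0 (r\<^sup>2) * cutoff c"
  shows "multicentre_field (r *\<^sub>R tube_map c) = r *\<^sub>R frechet_derivative tube_map (at c) (fibre_dir + \<eta> *\<^sub>R drift_dir c + (- \<eta>\<^sup>2 / (4 * pi)) *\<^sub>R turn_dir)"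
proof -
  let ?D = "frechet_derivative tube_map (at c)"
  have lin: "linear ?D" by (rule smooth_at_linear_derivative[OF smooth_at_tube_map[OF assms(1)]])
  have a: "amplitude (r *\<^sub>R tube_map c) = flat 0 (r\<^sup>2)"
    using norm_tube_map[OF assms(1)] by (simp add: amplitude_def power2_eq_square norm_eq_sqrt_inner)
  have "multicentre_field (r *\<^sub>R tube_map c) = r *\<^sub>R ?D fibre_dir + flat 0 (r\<^sup>2) *\<^sub>R r *\<^sub>R drift c + (- 1 / (4 * pi)) *\<^sub>R (flat 0 (r\<^sup>2) *\<^sub>R (flat 0 (r\<^sup>2) *\<^sub>R r *\<^sub>R turn c))"
    unfolding multicentre_field_def a cone_field_scaled_tube_map[OF deck_invariant_drift assms(1,2)] cone_field_scaled_tube_map[OF deck_invariant_turn assms(1,2)]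
    by (simp add: linear_cmul[OF linear_times_i] frechet_tube_map_fibre_dir[OF assms(1)])
  also have "\<dots> = r *\<^sub>R (?D fibre_dir + \<eta> *\<^sub>R ?D (drift_dir c) + (- \<eta>\<^sup>2 / (4 * pi)) *\<^sub>R ?D turn_dir)"
    by (simp add: drift_def turn_def assms(3) scaleR_add_right scaleR_diff_right power2_eq_square mult_ac)
  also have "\<dots> = r *\<^sub>R ?D (fibre_dir + \<eta> *\<^sub>R drift_dir c + (- \<eta>\<^sup>2 / (4 * pi)) *\<^sub>R turn_dir)"
    by (simp only: linear_add[OF lin] linear_cmul[OF lin])
  finally show ?thesis .
qed

section \<open>Closed orbits\<close>

text \<open>Periodicity is part of the definition, so that a witness also provides the periodic
  trajectory.\<close>

definition first_return :: "(real \<Rightarrow> real ^ 8) \<Rightarrow> real ^ 8 \<Rightarrow> real \<Rightarrow> bool" where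
  "first_return \<gamma> p T \<longleftrightarrow> integral_curve UNIV multicentre_field UNIV \<gamma> \<and> \<gamma> 0 = p \<and> T > 0 \<and> (\<forall>t. \<gamma> (t + T) = \<gamma> t) \<and>
     (\<forall>s. 0 < s \<and> s < T \<longrightarrow> \<gamma> s \<noteq> p)"

text \<open>The integrated model field. The motion in \<open>x\<close> and \<open>y\<close> is along a circle of radius \<open>R\<close>; integrating
  \<open>1 - (y / 2 \<pi>) \<eta> cos u\<close> gives a term proportional to \<open>t\<close> with coefficient zero, so that \<open>z\<close> is a
  function of \<open>u\<close> alone.\<close>

definition orbit_coord :: "real \<Rightarrow> coord \<Rightarrow> real \<Rightarrow> coord" where
  "orbit_coord \<eta> c t = (let u = cU c - \<eta>\<^sup>2 / (4 * pi) * t; R = 4 * pi / \<eta>; A = cY c - R * cos (cU c) in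
     (cX c - R * (sin u - sin (cU c)), A + R * cos u, u,
      cZ c + 2 * (A / \<eta> * (sin u - sin (cU c)) + pi / \<eta>\<^sup>2 * (sin (2 * u) - sin (2 * cU c))), cP c, cW c))"

lemma orbit_coord_0: "\<eta> \<noteq> 0 \<Longrightarrow> orbit_coord \<eta> c 0 = c"
  by (simp add: orbit_coord_def Let_def)

lemma tube_coord_orbit_coord: "tube_coord (orbit_coord \<eta> c t) = tube_coord c"
  by (simp add: orbit_coord_def Let_def tube_coord_def)

lemma orbit_coord_has_vector_derivative:
  assumes "\<eta> \<noteq> 0"
  shows "(orbit_coord \<eta> c has_vector_derivative (fibre_dir + \<eta> *\<^sub>R drift_dir (orbit_coord \<eta> c t) + (- \<eta>\<^sup>2 / (4 * pi)) *\<^sub>R turn_dir)) (at t)"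
proof -
  define u where "u s = cU c - \<eta>\<^sup>2 / (4 * pi) * s" for s
  define R where "R = 4 * pi / \<eta>"
  define A where "A = cY c - R * cos (cU c)"
  have du: "(u has_real_derivative - \<eta>\<^sup>2 / (4 * pi)) (at t)"
    unfolding u_def by (auto intro!: derivative_eq_intros)
  have p: "orbit_coord \<eta> c = (\<lambda>s. (cX c - R * (sin (u s) - sin (cU c)), A + R * cos (u s), u s,
      cZ c + 2 * (A / \<eta> * (sin (u s) - sin (cU c)) + pi / \<eta>\<^sup>2 * (sin (2 * u s) - sin (2 * cU c))), cP c, cW c))"
    by (auto simp: orbit_coord_def Let_def u_def R_def A_def)
  have x: "((\<lambda>s. cX c - R * (sin (u s) - sin (cU c))) has_real_derivative \<eta> * cos (u t)) (at t)"
    using assms by (auto intro!: derivative_eq_intros du simp: R_def field_simps power2_eq_square)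
  have y: "((\<lambda>s. A + R * cos (u s)) has_real_derivative \<eta> * sin (u t)) (at t)"
    using assms by (auto intro!: derivative_eq_intros du simp: R_def field_simps power2_eq_square)
  have z: "((\<lambda>s. cZ c + 2 * (A / \<eta> * (sin (u s) - sin (cU c)) + pi / \<eta>\<^sup>2 * (sin (2 * u s) - sin (2 * cU c)))) has_real_derivative
      1 - \<eta> * ((A + R * cos (u t)) / (2 * pi) * cos (u t))) (at t)"
  proof (rule DERIV_cong)
    show "((\<lambda>s. cZ c + 2 * (A / \<eta> * (sin (u s) - sin (cU c)) + pi / \<eta>\<^sup>2 * (sin (2 * u s) - sin (2 * cU c)))) has_real_derivative
      2 * (A / \<eta> * (cos (u t) * (- \<eta>\<^sup>2 / (4 * pi))) + pi / \<eta>\<^sup>2 * (cos (2 * u t) * (2 * (- \<eta>\<^sup>2 / (4 * pi)))))) (at t)"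
      using assms by (auto intro!: derivative_eq_intros du simp: power2_eq_square power4_eq_xxxx)
    show "2 * (A / \<eta> * (cos (u t) * (- \<eta>\<^sup>2 / (4 * pi))) + pi / \<eta>\<^sup>2 * (cos (2 * u t) * (2 * (- \<eta>\<^sup>2 / (4 * pi))))) =
        1 - \<eta> * ((A + R * cos (u t)) / (2 * pi) * cos (u t))"
      unfolding cos_double_cos using assms by (simp add: R_def field_simps power2_eq_square)
  qed
  have pt: "cU (orbit_coord \<eta> c t) = u t" "cY (orbit_coord \<eta> c t) = A + R * cos (u t)" by (simp_all add: p)
  have "(orbit_coord \<eta> c has_vector_derivative (\<eta> * cos (u t), \<eta> * sin (u t), - \<eta>\<^sup>2 / (4 * pi),
      1 - \<eta> * ((A + R * cos (u t)) / (2 * pi) * cos (u t)), 0, 0)) (at t)"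
    unfolding p
    by (intro has_vector_derivative_Pair has_vector_derivative_const x[unfolded has_real_derivative_iff_has_vector_derivative]
        y[unfolded has_real_derivative_iff_has_vector_derivative] z[unfolded has_real_derivative_iff_has_vector_derivative]
        du[unfolded has_real_derivative_iff_has_vector_derivative])
  moreover have "(\<eta> * cos (u t), \<eta> * sin (u t), - \<eta>\<^sup>2 / (4 * pi),
      1 - \<eta> * ((A + R * cos (u t)) / (2 * pi) * cos (u t)), 0, 0) = fibre_dir + \<eta> *\<^sub>R drift_dir (orbit_coord \<eta> c t) + (- \<eta>\<^sup>2 / (4 * pi)) *\<^sub>R turn_dir"
    by (simp add: fibre_dir_def drift_dir_def turn_dir_def pt)
  ultimately show ?thesis by simp
qed

lemma orbit_coord_periodic:
  assumes "\<eta> \<noteq> 0"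
  shows "orbit_coord \<eta> c (t + 8 * pi\<^sup>2 / \<eta>\<^sup>2) = deck 0 0 (- 1) 0 (orbit_coord \<eta> c t)"
proof -
  define u where "u s = cU c - \<eta>\<^sup>2 / (4 * pi) * s" for s
  have u: "u (t + 8 * pi\<^sup>2 / \<eta>\<^sup>2) = u t - 2 * pi"
    using assms by (simp add: u_def field_simps power2_eq_square)
  have "2 * (u t - 2 * pi) = 2 * u t + 2 * pi * of_int (- 2)" by simp
  then have "sin (2 * (u t - 2 * pi)) = sin (2 * u t)" using cos_sin_add_int by metis
  moreover have "u t - 2 * pi = u t + 2 * pi * of_int (- 1)" by simp
  then have "sin (u t - 2 * pi) = sin (u t)" "cos (u t - 2 * pi) = cos (u t)" using cos_sin_add_int by metis+
  ultimately show ?thesis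
    unfolding orbit_coord_def Let_def u_def[symmetric] u by (simp add: deck_def)
qed

text \<open>The angle \<open>u\<close> moves monotonically and is determined by the point modulo \<open>2\<pi>\<close>; hence the orbit
  cannot return before \<open>u\<close> has turned once.\<close>

lemma long_orbit:
  assumes "c \<in> tube" "r > 0" "cutoff c > 0"
  shows "\<exists>\<gamma>. first_return \<gamma> (r *\<^sub>R tube_map c) (8 * pi\<^sup>2 / (flat 0 (r\<^sup>2) * cutoff c)\<^sup>2)"
proof -
  define \<eta> where "\<eta> = flat 0 (r\<^sup>2) * cutoff c"
  have e: "\<eta> > 0" using assms flat_pos[of "r\<^sup>2" 0] by (simp add: \<eta>_def)
  let ?g = "\<lambda>t. r *\<^sub>R tube_map (orbit_coord \<eta> c t)" and ?T = "8 * pi\<^sup>2 / \<eta>\<^sup>2"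
  have t: "orbit_coord \<eta> c t \<in> tube" for t using assms(1) by (simp add: tube_def tube_coord_orbit_coord)
  have b: "\<eta> = flat 0 (r\<^sup>2) * cutoff (orbit_coord \<eta> c t)" for t by (simp add: \<eta>_def cutoff_def tube_coord_orbit_coord)
  have "(?g has_vector_derivative multicentre_field (?g t)) (at t)" for t
  proof -
    have "((\<lambda>t. tube_map (orbit_coord \<eta> c t)) has_derivative
        (\<lambda>h. frechet_derivative tube_map (at (orbit_coord \<eta> c t)) (h *\<^sub>R (fibre_dir + \<eta> *\<^sub>R drift_dir (orbit_coord \<eta> c t) + (- \<eta>\<^sup>2 / (4 * pi)) *\<^sub>R turn_dir)))) (at t)"
      using diff_chain_at[OF orbit_coord_has_vector_derivative[of \<eta> c t, unfolded has_vector_derivative_def]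
          smooth_at_has_derivative[OF smooth_at_tube_map[OF t[of t]]]] e by (simp add: o_def)
    from has_derivative_scaleR_right[OF this, of r]
    show ?thesis
      unfolding has_vector_derivative_def multicentre_field_scaled_tube_map[OF t[of t] assms(2) b[of t]]
      by (simp add: linear_cmul[OF smooth_at_linear_derivative[OF smooth_at_tube_map[OF t]]] mult.commute)
  qed
  then have "integral_curve UNIV multicentre_field UNIV ?g" by (simp add: integral_curve_def)
  moreover have "?g 0 = r *\<^sub>R tube_map c" using e by (simp add: orbit_coord_0)
  moreover have "?T > 0" using e by simp
  moreover have "?g (t + ?T) = ?g t" for t using e by (simp add: orbit_coord_periodic tube_map_deck)
  moreover have "?g s \<noteq> r *\<^sub>R tube_map c" if s: "0 < s" "s < ?T" for s
  proof
    assume "?g s = r *\<^sub>R tube_map c"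
    then have eq: "tube_map (orbit_coord \<eta> c s) = tube_map c" using assms(2) by simp
    obtain l m n j where d: "c = deck l m n j (orbit_coord \<eta> c s)" by (rule tube_map_eqD[OF t assms(1) eq])
    have "cU c = cU (orbit_coord \<eta> c s) + 2 * pi * of_int n" by (subst d) (simp add: deck_def)
    then have n: "\<eta>\<^sup>2 / (4 * pi) * s = 2 * pi * of_int n" by (simp add: orbit_coord_def Let_def)
    have "0 < \<eta>\<^sup>2 / (4 * pi) * s" "\<eta>\<^sup>2 / (4 * pi) * s < \<eta>\<^sup>2 / (4 * pi) * ?T"
      using s e by (auto intro!: mult_strict_left_mono simp del: times_divide_eq_left times_divide_eq_right)
    moreover have "\<eta>\<^sup>2 / (4 * pi) * ?T = 2 * pi" using e by (simp add: field_simps power2_eq_square)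
    ultimately have "0 < 2 * pi * of_int n" "2 * pi * of_int n < 2 * pi * 1" using n by auto
    then have "0 < real_of_int n" "real_of_int n < 1" by (simp_all add: zero_less_mult_iff)
    then show False by simp
  qed
  ultimately show ?thesis unfolding first_return_def \<eta>_def[symmetric] by (intro exI[of _ ?g]) auto
qed

text \<open>The set where the perturbation vanishes is invariant under the unperturbed flow, because the flow
  only shifts the coordinate \<open>z\<close>.\<close>

lemma short_orbit:
  assumes "p \<noteq> 0" "\<And>c. c \<in> tube \<Longrightarrow> tube_map c = (1 / norm p) *\<^sub>R p \<Longrightarrow> cutoff c = 0"
  shows "first_return (\<lambda>t. phase_rot t p) p (2 * pi)"
proof -
  have f: "multicentre_field (phase_rot t p) = times_i (phase_rot t p)" for t
  proof -
    have "cone_field w (phase_rot t p) = 0" if w: "deck_invariant w" "\<And>c. cutoff c = 0 \<Longrightarrow> w c = 0" for w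
    proof (cases "\<exists>c\<in>tube. tube_map c = (1 / norm (phase_rot t p)) *\<^sub>R phase_rot t p")
      case True
      then obtain c where c: "c \<in> tube" "tube_map c = (1 / norm (phase_rot t p)) *\<^sub>R phase_rot t p" by blast
      have "tube_map (shift_z (- t) c) = (1 / norm p) *\<^sub>R phase_rot (- t) (phase_rot t p)"
        unfolding tube_map_shift_z c(2) norm_phase_rot by (rule phase_rot_scaleR)
      then have "tube_map (shift_z (- t) c) = (1 / norm p) *\<^sub>R p" by (simp add: phase_rot_phase_rot phase_rot_0)
      then have "cutoff (shift_z (- t) c) = 0" using assms(2) c(1) by (simp add: tube_def tube_coord_shift_z)
      then have "cutoff c = 0" by (simp add: cutoff_def tube_coord_shift_z)
      moreover have "phase_rot t p \<noteq> 0" using assms(1) norm_phase_rot[of t p] by auto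
      ultimately show ?thesis using cone_field_eq_norm[OF w(1) c(1) _ c(2)] w(2) by simp
    qed (auto simp: cone_field_def)
    then show ?thesis
      using deck_invariant_drift deck_invariant_turn by (simp add: multicentre_field_def drift_def turn_def)
  qed
  have "phase_rot t p = p \<Longrightarrow> cos t = 1" for t
  proof -
    assume "phase_rot t p = p"
    then have "phase_rot t p \<bullet> p = p \<bullet> p" by simp
    then have "cos t * (p \<bullet> p) = p \<bullet> p" by (simp add: phase_rot_eq inner_add_left times_i_inner)
    then show "cos t = 1" using assms(1) by simp
  qed
  moreover have "cos s \<noteq> 1" if "0 < s" "s < 2 * pi" for s
  proof
    assume "cos s = 1"
    then obtain n :: int where n: "s = of_int n * 2 * pi" using cos_one_2pi_int[of s] by blast
    have "0 < real_of_int n" "real_of_int n < 1" using that unfolding n by (simp_all add: zero_less_mult_iff)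
    then show False by simp
  qed
  ultimately have "phase_rot s p \<noteq> p" if "0 < s \<and> s < 2 * pi" for s using that by metis
  moreover have "phase_rot (t + 2 * pi) p = phase_rot t p" for t by (simp add: phase_rot_eq)
  ultimately show ?thesis
    unfolding first_return_def integral_curve_def using phase_rot_has_vector_derivative[of p] f
    by (simp add: phase_rot_0)
qed

section \<open>Uniqueness of trajectories and the period function\<close>

lemma smooth_imp_lipschitz_on_cball:
  fixes X :: "'a::euclidean_space \<Rightarrow> 'b::euclidean_space"
  assumes "smooth_on UNIV X"
  obtains L where "L \<ge> 0" "\<And>x y. x \<in> cball 0 R \<Longrightarrow> y \<in> cball 0 R \<Longrightarrow> norm (X x - X y) \<le> L * norm (x - y)"
proof -
  let ?D = "\<lambda>x b. frechet_derivative X (at x) b"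
  have C1: "Ck_on 1 UNIV X" using assms by (simp add: smooth_on_def)
  have d: "(X has_derivative frechet_derivative X (at x)) (at x)" for x
    using C1 Ck_on_has_derivative[of 0 UNIV X x] by simp
  have "\<exists>M. \<forall>x\<in>cball 0 R. norm (?D x b) \<le> M" for b
  proof -
    have "continuous_on UNIV (\<lambda>x. ?D x b)" using C1 by simp
    then have "continuous_on (cball 0 R) (\<lambda>x. ?D x b)" by (rule continuous_on_subset) simp
    then have "bounded ((\<lambda>x. ?D x b) ` cball 0 R)"
      by (intro compact_imp_bounded compact_continuous_image) auto
    then show ?thesis by (auto simp: bounded_iff)
  qed
  then obtain M where M: "\<And>b x. x \<in> cball 0 R \<Longrightarrow> norm (?D x b) \<le> M b" by metis
  define L where "L = (\<Sum>b\<in>(Basis::'a set). max 0 (M b))"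
  have on: "onorm (frechet_derivative X (at x)) \<le> L" if x: "x \<in> cball 0 R" for x
  proof (rule onorm_le)
    fix v
    have "norm (?D x v) = norm (\<Sum>b\<in>Basis. (v \<bullet> b) *\<^sub>R ?D x b)"
      using linear_eq_sum_Basis[OF has_derivative_linear[OF d]] by metis
    also have "\<dots> \<le> (\<Sum>b\<in>Basis. norm ((v \<bullet> b) *\<^sub>R ?D x b))" by (rule norm_sum)
    also have "\<dots> \<le> (\<Sum>b\<in>(Basis::'a set). max 0 (M b) * norm v)"
    proof (rule sum_mono)
      fix b :: 'a assume b: "b \<in> Basis"
      have "\<bar>v \<bullet> b\<bar> * norm (?D x b) \<le> norm v * max 0 (M b)"
        using M[OF x, of b] Basis_le_norm[OF b, of v] by (intro mult_mono) auto
      then show "norm ((v \<bullet> b) *\<^sub>R ?D x b) \<le> max 0 (M b) * norm v" by (simp add: mult.commute)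
    qed
    finally show "norm (?D x v) \<le> L * norm v" by (simp add: L_def sum_distrib_right)
  qed
  show ?thesis
  proof
    show "L \<ge> 0" by (auto simp: L_def intro: sum_nonneg)
    show "norm (X x - X y) \<le> L * norm (x - y)" if "x \<in> cball 0 R" "y \<in> cball 0 R" for x y
      using that on by (intro differentiable_bound[of "cball 0 R" X "\<lambda>x. frechet_derivative X (at x)"])
        (auto intro: has_derivative_at_withinI d)
  qed
qed

lemma inner_self_has_derivative:
  assumes "(d has_vector_derivative e) (at t)"
  shows "((\<lambda>t. d t \<bullet> d t) has_real_derivative 2 * (d t \<bullet> e)) (at t)"
proof -
  have "(d has_derivative (\<lambda>h. h *\<^sub>R e)) (at t)" using assms by (simp add: has_vector_derivative_def)
  from has_derivative_inner[OF this this] show ?thesis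
    unfolding has_field_derivative_def
    by (rule has_derivative_eq_rhs) (simp add: fun_eq_iff inner_commute algebra_simps)
qed

text \<open>Gronwall's inequality for the squared distance of the two solutions, which stay in a ball on
  which \<open>X\<close> is Lipschitz. The time-dependent factor \<open>a\<close> covers reparametrised trajectories.\<close>

lemma ode_unique:
  fixes X :: "'a::euclidean_space \<Rightarrow> 'a"
  assumes X: "smooth_on UNIV X" and T: "T \<ge> 0"
    and v: "\<And>t. t \<in> {0..T} \<Longrightarrow> (v has_vector_derivative a t *\<^sub>R X (v t)) (at t within {0..T})"
    and w: "\<And>t. t \<in> {0..T} \<Longrightarrow> (w has_vector_derivative a t *\<^sub>R X (w t)) (at t within {0..T})"
    and a: "\<And>t. t \<in> {0..T} \<Longrightarrow> \<bar>a t\<bar> \<le> M" and eq: "v 0 = w 0"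
  shows "v T = w T"
proof -
  have cv: "continuous_on {0..T} v" and cw: "continuous_on {0..T} w"
    by (rule continuous_on_vector_derivative[OF v], assumption)
       (rule continuous_on_vector_derivative[OF w], assumption)
  have "bounded (v ` {0..T} \<union> w ` {0..T})"
    by (simp add: compact_imp_bounded compact_continuous_image cv cw)
  then obtain R where "\<And>x. x \<in> v ` {0..T} \<union> w ` {0..T} \<Longrightarrow> norm x \<le> R"
    unfolding bounded_iff by blast
  then have R: "v t \<in> cball 0 R \<and> w t \<in> cball 0 R" if "t \<in> {0..T}" for t
    using that by simp
  obtain L where L: "L \<ge> 0" "\<And>x y. x \<in> cball 0 R \<Longrightarrow> y \<in> cball 0 R \<Longrightarrow> norm (X x - X y) \<le> L * norm (x - y)"
    using smooth_imp_lipschitz_on_cball[OF X, of R] by metis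
  let ?d = "\<lambda>t. v t - w t" and ?K = "2 * M * L"
  let ?g = "\<lambda>t. (?d t \<bullet> ?d t) * exp (- ?K * t)"
  have "?g T \<le> ?g 0"
  proof (rule DERIV_nonpos_imp_decreasing_open[OF T])
    show "continuous_on {0..T} ?g" by (intro continuous_intros cv cw)
    fix t assume t: "0 < t" "t < T"
    then have at: "at t within {0..T} = at t" by (simp add: at_within_Icc_at)
    have t': "t \<in> {0..T}" using t by simp
    let ?e = "a t *\<^sub>R (X (v t) - X (w t))"
    have "(?d has_vector_derivative ?e) (at t)"
      using has_vector_derivative_diff[OF v[OF t'] w[OF t']] unfolding at by (simp add: scaleR_diff_right)
    then have sq: "((\<lambda>t. ?d t \<bullet> ?d t) has_real_derivative 2 * (?d t \<bullet> ?e)) (at t)"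
      by (rule inner_self_has_derivative)
    have "((\<lambda>t. exp (- ?K * t)) has_real_derivative - ?K * exp (- ?K * t)) (at t)"
      by (auto intro!: derivative_eq_intros)
    moreover have distr: "y * e + - k * e * q = (y - k * q) * e" for y e k q :: real
      by (simp add: algebra_simps)
    ultimately have D: "(?g has_real_derivative (2 * (?d t \<bullet> ?e) - ?K * (?d t \<bullet> ?d t)) * exp (- ?K * t)) (at t)"
      by (intro DERIV_cong[OF DERIV_mult[OF sq] distr])
    have "?d t \<bullet> ?e \<le> norm (?d t) * norm ?e" by (rule norm_cauchy_schwarz)
    also have "\<dots> \<le> norm (?d t) * (M * (L * norm (?d t)))"
      using a[OF t'] L R[OF t'] by (auto intro!: mult_left_mono mult_mono)
    also have "\<dots> = M * L * (?d t \<bullet> ?d t)"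
      by (simp add: power2_norm_eq_inner[symmetric] power2_eq_square)
    finally have "2 * (?d t \<bullet> ?e) - ?K * (?d t \<bullet> ?d t) \<le> 0" by simp
    then show "\<exists>y. (?g has_real_derivative y) (at t) \<and> y \<le> 0"
      using D by (intro exI conjI) (auto intro: mult_nonpos_nonneg)
  qed
  then have "?d T \<bullet> ?d T \<le> 0" using eq by (simp add: mult_le_0_iff)
  then have "?d T \<bullet> ?d T = 0" by (rule antisym) (rule inner_ge_zero)
  then show ?thesis using inner_eq_zero_iff[of "?d T"] by (simp only: right_minus_eq)
qed

lemma integral_curve_unique:
  fixes X :: "'a::euclidean_space \<Rightarrow> 'a"
  assumes "smooth_on UNIV X" "integral_curve UNIV X UNIV v" "integral_curve UNIV X UNIV w" "v 0 = w 0" "t \<ge> 0"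
  shows "v t = w t"
proof (rule ode_unique[OF assms(1,5), of v "\<lambda>_. 1" w 1])
  show "(v has_vector_derivative 1 *\<^sub>R X (v t)) (at t within {0..t'})"
    "(w has_vector_derivative 1 *\<^sub>R X (w t)) (at t within {0..t'})" for t t'
    using assms(2,3) by (auto simp: integral_curve_def intro: has_vector_derivative_at_within)
qed (use assms in auto)

lemma first_returnD:
  assumes "first_return \<gamma> p T"
  shows "integral_curve UNIV multicentre_field UNIV \<gamma>" "\<gamma> 0 = p" "T > 0" "\<gamma> (t + T) = \<gamma> t"
    "0 < s \<Longrightarrow> s < T \<Longrightarrow> \<gamma> s \<noteq> p"
  using assms unfolding first_return_def by blast+

lemma period_function_multicentre_field:
  assumes "first_return \<gamma> p T"
  shows "period_function UNIV multicentre_field p = T"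
  unfolding period_function_def
proof (rule the_equality)
  show "0 < T \<and> (\<exists>\<gamma>. integral_curve UNIV multicentre_field UNIV \<gamma> \<and> \<gamma> 0 = p \<and> \<gamma> T = p \<and> (\<forall>s. 0 < s \<and> s < T \<longrightarrow> \<gamma> s \<noteq> p))"
  proof (intro conjI exI[of _ \<gamma>] allI impI)
    show "\<gamma> T = p" using first_returnD(2)[OF assms] first_returnD(4)[OF assms, of 0] by simp
  qed (use first_returnD[OF assms] in blast)+
next
  fix S
  assume S: "0 < S \<and> (\<exists>\<gamma>. integral_curve UNIV multicentre_field UNIV \<gamma> \<and> \<gamma> 0 = p \<and> \<gamma> S = p \<and> (\<forall>s. 0 < s \<and> s < S \<longrightarrow> \<gamma> s \<noteq> p))"
  then obtain \<delta> where d: "integral_curve UNIV multicentre_field UNIV \<delta>" "\<delta> 0 = p" "\<delta> S = p" "\<And>s. 0 < s \<Longrightarrow> s < S \<Longrightarrow> \<delta> s \<noteq> p"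
    by blast
  have g: "integral_curve UNIV multicentre_field UNIV \<gamma>" "\<gamma> 0 = p" "0 < T" "\<And>s. 0 < s \<Longrightarrow> s < T \<Longrightarrow> \<gamma> s \<noteq> p"
    using first_returnD[OF assms] by blast+
  have gT: "\<gamma> T = p" using first_returnD(2)[OF assms] first_returnD(4)[OF assms, of 0] by simp
  have eq: "\<gamma> t = \<delta> t" if "t \<ge> 0" for t
    using integral_curve_unique[OF smooth_on_multicentre_field g(1) d(1)] g(2) d(2) that by simp
  show "S = T"
    using S d(3,4) g(3,4) gT eq by (metis less_eq_real_def linorder_neqE_linordered_idom)
qed

lemma ex_first_return:
  assumes "p \<noteq> 0" shows "\<exists>\<gamma> T. first_return \<gamma> p T"
proof (cases "\<exists>c\<in>tube. tube_map c = (1 / norm p) *\<^sub>R p \<and> cutoff c > 0")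
  case True
  then obtain c where c: "c \<in> tube" "tube_map c = (1 / norm p) *\<^sub>R p" "cutoff c > 0" by blast
  have "norm p *\<^sub>R tube_map c = p" unfolding c(2) using assms by simp
  then show ?thesis using long_orbit[OF c(1) _ c(3), of "norm p"] assms by fastforce
next
  case False
  have "cutoff c = 0" if "c \<in> tube" "tube_map c = (1 / norm p) *\<^sub>R p" for c
    using False that flat_nonneg[of 0] by (metis cutoff_def less_eq_real_def)
  then show ?thesis using short_orbit[OF assms] by blast
qed

lemma period_function_multicentre_field_le:
  assumes "p \<noteq> 0" "integral_curve UNIV multicentre_field UNIV \<delta>" "\<delta> 0 = p" "\<delta> t = p" "t > 0"
  shows "period_function UNIV multicentre_field p \<le> t"
proof -
  obtain \<gamma> T where g: "first_return \<gamma> p T" using ex_first_return[OF assms(1)] by blast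
  note g' = first_returnD[OF g]
  have "\<gamma> t = \<delta> t"
    using integral_curve_unique[OF smooth_on_multicentre_field g'(1) assms(2)] g'(2) assms(3,5) by simp
  then have "\<not> t < T" using g'(5) assms(4,5) by blast
  then show ?thesis using period_function_multicentre_field[OF g] by simp
qed

text \<open>Let \<open>q\<close> approach the boundary of the support of the cutoff from inside: the drift velocity tends
  to zero through positive values, and the period is inversely proportional to its square.\<close>

lemma period_function_unbounded:
  assumes "r > 0" shows "\<not> bdd_above (period_function UNIV multicentre_field ` sphere 0 r)"
proof
  assume "bdd_above (period_function UNIV multicentre_field ` sphere 0 r)"
  then obtain B where B: "\<And>p. p \<in> sphere 0 r \<Longrightarrow> period_function UNIV multicentre_field p \<le> B"
    unfolding bdd_above_def by blast
  define C :: "real \<Rightarrow> coord" where "C s = (0, 0, 0, 0, 0, complex_of_real s)" for s :: real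
  have q: "(norm (tube_coord (C s)))\<^sup>2 = s\<^sup>2" for s by (simp add: C_def tube_coord_def norm_quat_sq)
  let ?e = "\<lambda>s. flat 0 (r\<^sup>2) * flat 0 (1/2 - s\<^sup>2)"
  have per: "8 * pi\<^sup>2 / (?e s)\<^sup>2 \<le> B" if "s\<^sup>2 < 1/2" for s
  proof -
    have "(norm (tube_coord (C s)))\<^sup>2 < 1\<^sup>2" using that q by simp
    then have t: "C s \<in> tube" unfolding tube_def using power2_less_imp_less by fastforce
    have b: "cutoff (C s) = flat 0 (1/2 - s\<^sup>2)" by (simp add: cutoff_def q)
    moreover have "cutoff (C s) > 0" unfolding b using that by (intro flat_pos) simp
    ultimately obtain \<gamma> where "first_return \<gamma> (r *\<^sub>R tube_map (C s)) (8 * pi\<^sup>2 / (?e s)\<^sup>2)"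
      using long_orbit[OF t assms] by metis
    from period_function_multicentre_field[OF this] show ?thesis
      using B[of "r *\<^sub>R tube_map (C s)"] norm_tube_map[OF t] assms by simp
  qed
  have z: "?e (sqrt (1/2)) = 0" by (simp add: flat_nonpos)
  have "isCont ?e (sqrt (1/2))"
    by (intro smooth_at_isCont smooth_intros)
  then have "(?e \<longlongrightarrow> 0) (at_left (sqrt (1/2)))"
    unfolding isCont_def z using filterlim_at_split by blast
  then have lim: "((\<lambda>s. (?e s)\<^sup>2 * B) \<longlongrightarrow> 0\<^sup>2 * B) (at_left (sqrt (1/2)))"
    by (intro tendsto_intros)
  have "\<forall>\<^sub>F s in at_left (sqrt (1/2)). (?e s)\<^sup>2 * B < 8 * pi\<^sup>2"
    using order_tendstoD(2)[OF lim, of "8 * pi\<^sup>2"] by simp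
  moreover have "\<forall>\<^sub>F s in at_left (sqrt (1/2)). s \<in> {0<..<sqrt (1/2)}"
    by (rule eventually_at_left_real) simp
  ultimately have "\<forall>\<^sub>F s in at_left (sqrt (1/2)). False"
  proof eventually_elim
    case (elim s)
    have s: "s\<^sup>2 < 1/2"
    proof -
      have "0 \<le> s" "s < sqrt (1/2)" using elim(2) by auto
      then have "s\<^sup>2 < (sqrt (1/2))\<^sup>2" by (intro power_strict_mono) auto
      then show ?thesis by simp
    qed
    have "(?e s)\<^sup>2 > 0" using s assms flat_pos[of "r\<^sup>2" 0] flat_pos[of "1/2 - s\<^sup>2" 0] by simp
    then have "8 * pi\<^sup>2 \<le> (?e s)\<^sup>2 * B" using per[OF s] by (simp add: pos_divide_le_eq mult.commute)
    then show False using elim(1) by simp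
  qed
  then show False by simp
qed

section \<open>The linear part\<close>

lemma amplitude_cone_field_has_derivative:
  assumes "\<And>p. p \<noteq> 0 \<Longrightarrow> smooth_at p (cone_field w)"
  shows "((\<lambda>p. amplitude p *\<^sub>R cone_field w p) has_derivative (\<lambda>v. 0)) (at 0)"
  using flat_homogeneous_has_derivative[OF homogeneous_cone_field assms, of 0 0]
  by (simp add: amplitude_def flat_nonpos)

lemma multicentre_field_has_derivative_0: "(multicentre_field has_derivative times_i) (at 0)"
proof -
  have d2: "((\<lambda>p. amplitude p *\<^sub>R cone_field turn p) has_derivative (\<lambda>v. 0)) (at 0)"
    by (rule amplitude_cone_field_has_derivative[OF smooth_at_cone_field_turn])
  have "amplitude 0 = 0" by (simp add: amplitude_def flat_nonpos)
  then have "((\<lambda>p. amplitude p *\<^sub>R (amplitude p *\<^sub>R cone_field turn p)) has_derivative (\<lambda>v. 0)) (at 0)"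
    using has_derivative_scaleR[OF smooth_at_has_derivative[OF smooth_at_amplitude] d2] by simp
  then have "((\<lambda>p. times_i p + amplitude p *\<^sub>R cone_field drift p + (- 1 / (4 * pi)) *\<^sub>R (amplitude p *\<^sub>R (amplitude p *\<^sub>R cone_field turn p))) has_derivative
      (\<lambda>v. times_i v + 0 + (- 1 / (4 * pi)) *\<^sub>R 0)) (at 0)"
    by (intro has_derivative_add has_derivative_scaleR_right amplitude_cone_field_has_derivative smooth_at_cone_field_drift
        bounded_linear_imp_has_derivative bounded_linear_times_i)
  then show ?thesis by (simp add: multicentre_field_def[abs_def])
qed

lemma frechet_multicentre_field_0: "frechet_derivative multicentre_field (at 0) = times_i"
  using multicentre_field_has_derivative_0 frechet_derivative_at by metis

lemma multicentre_field_0: "multicentre_field 0 = 0"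
  using linear_0[OF linear_times_i] by (simp add: multicentre_field_def amplitude_def flat_nonpos)

context
  fixes A :: "real ^ 'n ^ 'n"
  assumes square: "A ** A = - mat 1"
begin

lemma matrix_exp_term:
  "(1 / fact k) *\<^sub>R (((**) (t *\<^sub>R A) ^^ k) (mat 1)) = (cos_coeff k * t ^ k) *\<^sub>R mat 1 + (sin_coeff k * t ^ k) *\<^sub>R A"
proof (induction k)
  case 0
  then show ?case by simp
next
  case (Suc k)
  let ?P = "((**) (t *\<^sub>R A) ^^ k) (mat 1)"
  have "(1 / fact (Suc k)) *\<^sub>R ((t *\<^sub>R A) ** ?P) = (1 / real (Suc k)) *\<^sub>R ((t *\<^sub>R A) ** ((1 / fact k) *\<^sub>R ?P))"
    by (simp add: matrix_scalar_ac scalar_matrix_assoc[symmetric] mult.commute)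
  also have "\<dots> = (1 / real (Suc k)) *\<^sub>R ((cos_coeff k * t ^ Suc k) *\<^sub>R A - (sin_coeff k * t ^ Suc k) *\<^sub>R mat 1)"
    unfolding Suc
    by (simp add: matrix_add_ldistrib matrix_scalar_ac scalar_matrix_assoc[symmetric] square algebra_simps)
  also have "\<dots> = (cos_coeff (Suc k) * t ^ Suc k) *\<^sub>R mat 1 + (sin_coeff (Suc k) * t ^ Suc k) *\<^sub>R A"
    unfolding cos_coeff_Suc sin_coeff_Suc by (simp add: scaleR_diff_right del: power_Suc of_nat_Suc)
  finally show ?case by simp
qed

lemma matrix_exp_square_minus_one: "matrix_exp (t *\<^sub>R A) = cos t *\<^sub>R mat 1 + sin t *\<^sub>R A"
proof -
  have "(\<lambda>k. cos_coeff k * t ^ k) sums cos t" "(\<lambda>k. sin_coeff k * t ^ k) sums sin t"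
    using cos_converges[of t] sin_converges[of t] by simp_all
  then have "(\<lambda>k. (cos_coeff k * t ^ k) *\<^sub>R mat 1 + (sin_coeff k * t ^ k) *\<^sub>R A) sums (cos t *\<^sub>R mat 1 + sin t *\<^sub>R A)"
    by (intro sums_add bounded_linear.sums[OF bounded_linear_scaleR_left])
  then show ?thesis unfolding matrix_exp_def matrix_exp_term by (rule sums_unique[symmetric])
qed

end

text \<open>The exponential is the unperturbed flow. Its determinant is positive because every element is the
  square of another one.\<close>

lemma generates_nondegenerate_rotations_times_i: "generates_nondegenerate_rotations (matrix times_i)"
proof -
  let ?A = "matrix times_i"
  have lin: "linear (phase_rot t)" for t unfolding phase_rot_eq[abs_def]
    by (intro linear_compose_add linear_compose_scale_right linear_ident linear_times_i)
  have A: "?A *v x = times_i x" for x by (rule fun_cong[OF matrix_vector_mul(2)[OF linear_times_i]])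
  have R: "matrix (phase_rot t) *v x = phase_rot t x" for t x by (rule fun_cong[OF matrix_vector_mul(2)[OF lin]])
  have neg: "(- mat 1) *v x = - x" for x :: "real ^ 8"
    using scaleR_matrix_vector_assoc[of "-1" "mat 1" x] by simp
  have sq: "?A ** ?A = - mat 1"
    unfolding matrix_eq matrix_vector_mul_assoc[symmetric] A times_i_times_i neg by simp
  have E: "matrix_exp (t *\<^sub>R ?A) = matrix (phase_rot t)" for t
    unfolding matrix_exp_square_minus_one[OF sq] matrix_eq R
    by (simp add: matrix_vector_mult_add_rdistrib scaleR_matrix_vector_assoc[symmetric] A phase_rot_eq)
  have orth: "orthogonal_matrix (matrix (phase_rot t))" for t
    using orthogonal_transformation_matrix[of "phase_rot t"] orthogonal_transformation[of "phase_rot t"] lin norm_phase_rot by blast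
  have "det (matrix (phase_rot t)) = 1" for t
  proof -
    have "phase_rot t = phase_rot (t/2) \<circ> phase_rot (t/2)" by (simp add: fun_eq_iff phase_rot_phase_rot)
    then have "matrix (phase_rot t) = matrix (phase_rot (t/2)) ** matrix (phase_rot (t/2))" using matrix_compose[OF lin lin] by metis
    then have "det (matrix (phase_rot t)) = (det (matrix (phase_rot (t/2))))\<^sup>2" by (simp add: det_mul power2_eq_square)
    then show ?thesis using det_orthogonal_matrix[OF orth[of "t/2"]] by auto
  qed
  then have "rotation_matrix (matrix_exp (t *\<^sub>R ?A))" for t using orth E by (simp add: rotation_matrix_def)
  moreover have "invertible ?A"
    unfolding invertible_def
  proof (intro exI conjI)
    have "?A ** (- ?A) = - (?A ** ?A)" "(- ?A) ** ?A = - (?A ** ?A)"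
      using matrix_scalar_ac[of ?A "-1" ?A] scalar_matrix_assoc[of "-1" ?A ?A] by simp_all
    then show "?A ** (- ?A) = mat 1" "(- ?A) ** ?A = mat 1" by (simp_all add: sq)
  qed
  ultimately show ?thesis by (simp add: generates_nondegenerate_rotations_def)
qed

section \<open>The first integral\<close>

lemma has_sum_sum:
  fixes f :: "'i \<Rightarrow> 'a \<Rightarrow> real"
  assumes "finite I" "\<And>i. i \<in> I \<Longrightarrow> (f i has_sum s i) A"
  shows "((\<lambda>x. \<Sum>i\<in>I. f i x) has_sum (\<Sum>i\<in>I. s i)) A"
  using assms by (induction I rule: finite_induct) (auto intro: has_sum_add)

text \<open>The Taylor polynomial at \<open>p\<close> is \<open>\<Sum>\<^sub>i (p\<^sub>i\<^sup>2 + 2 p\<^sub>i (x\<^sub>i - p\<^sub>i) + (x\<^sub>i - p\<^sub>i)\<^sup>2)\<close>.\<close>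

lemma real_analytic_norm_sq: "real_analytic_on S (\<lambda>x :: real ^ 'n. (norm x)\<^sup>2)"
  unfolding real_analytic_on_def
proof (intro ballI)
  fix p :: "real ^ 'n"
  \<comment> \<open>The multi-index with \<open>k\<close> at position \<open>i\<close> and zero elsewhere.\<close>
  define e :: "nat \<Rightarrow> 'n \<Rightarrow> 'n \<Rightarrow> nat" where "e k i = (\<lambda>j. if j = i then k else 0)" for k i
  define c :: "'n \<Rightarrow> ('n \<Rightarrow> nat) \<Rightarrow> real" where
    "c i \<alpha> = (if \<alpha> = e 0 i then (p $ i)\<^sup>2 else if \<alpha> = e 1 i then 2 * p $ i else if \<alpha> = e 2 i then 1 else 0)" for i \<alpha>
  have ne: "e 0 i \<noteq> e 1 i" "e 0 i \<noteq> e 2 i" "e 1 i \<noteq> e 2 i" for i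
    by (auto simp: e_def fun_eq_iff)
  have pr: "(\<Prod>j\<in>UNIV. (x $ j - p $ j) ^ e k i j) = (x $ i - p $ i) ^ k" for x k i
  proof -
    have "(\<Prod>j\<in>UNIV. (x $ j - p $ j) ^ e k i j) = (\<Prod>j\<in>UNIV. if j = i then (x $ j - p $ j) ^ k else 1)"
      by (intro prod.cong) (auto simp: e_def)
    then show ?thesis by simp
  qed
  have "((\<lambda>\<alpha>. (\<Sum>i\<in>UNIV. c i \<alpha>) * (\<Prod>i\<in>UNIV. (x $ i - p $ i) ^ \<alpha> i)) has_sum (norm x)\<^sup>2) UNIV" for x
  proof -
    have "((\<lambda>\<alpha>. c i \<alpha> * (\<Prod>i\<in>UNIV. (x $ i - p $ i) ^ \<alpha> i)) has_sum (x $ i)\<^sup>2) UNIV" for i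
    proof (rule has_sum_finite_neutralI[of "{e 0 i, e 1 i, e 2 i}"])
      show "c i \<alpha> * (\<Prod>i\<in>UNIV. (x $ i - p $ i) ^ \<alpha> i) = 0" if "\<alpha> \<in> UNIV - {e 0 i, e 1 i, e 2 i}" for \<alpha>
        using that by (auto simp: c_def)
      have "c i (e 0 i) = (p $ i)\<^sup>2" "c i (e 1 i) = 2 * p $ i" "c i (e 2 i) = 1"
        using ne[of i] by (auto simp: c_def)
      then show "(x $ i)\<^sup>2 = (\<Sum>\<alpha>\<in>{e 0 i, e 1 i, e 2 i}. c i \<alpha> * (\<Prod>i\<in>UNIV. (x $ i - p $ i) ^ \<alpha> i))"
        using ne[of i] by (simp add: pr) (simp add: power2_eq_square algebra_simps)
    qed auto
    from has_sum_sum[OF finite this]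
    show ?thesis by (simp add: sum_distrib_right norm_vec_def L2_set_def sum_nonneg)
  qed
  then show "\<exists>r>0. \<exists>c. \<forall>x\<in>ball p r. ((\<lambda>\<alpha>. c \<alpha> * (\<Prod>i\<in>UNIV. (x $ i - p $ i) ^ \<alpha> i)) has_sum (norm x)\<^sup>2) UNIV"
    by (intro exI[of _ 1] conjI zero_less_one) (rule exI, rule ballI)
qed

lemma first_integral_norm_sq: "first_integral UNIV multicentre_field (\<lambda>x. (norm x)\<^sup>2)"
  unfolding first_integral_def
proof (intro conjI allI impI)
  show "\<not> (\<lambda>x::real ^ 8. (norm x)\<^sup>2) constant_on UNIV"
  proof
    assume "(\<lambda>x::real ^ 8. (norm x)\<^sup>2) constant_on UNIV"
    then obtain k where "\<And>x::real ^ 8. (norm x)\<^sup>2 = k" by (auto simp: constant_on_def)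
    from this[of 0] this[of "axis 1 1"] show False by simp
  qed
  fix I \<gamma> assume "open I \<and> is_interval I \<and> integral_curve UNIV multicentre_field I \<gamma>"
  then have I: "open I" "is_interval I" "integral_curve UNIV multicentre_field I \<gamma>" by auto
  have "((\<lambda>t. (norm (\<gamma> t))\<^sup>2) has_derivative (\<lambda>h. 0)) (at t within I)" if "t \<in> I" for t
  proof -
    have "(\<gamma> has_derivative (\<lambda>h. h *\<^sub>R multicentre_field (\<gamma> t))) (at t)"
      using I that by (auto simp: integral_curve_def has_vector_derivative_def)
    from has_derivative_inner[OF this this]
    have "((\<lambda>t. \<gamma> t \<bullet> \<gamma> t) has_derivative (\<lambda>h. 0)) (at t)"
      using multicentre_field_inner[of "\<gamma> t"] by (simp add: inner_commute)
    then show ?thesis by (simp add: power2_norm_eq_inner has_derivative_at_withinI)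
  qed
  then show "(\<lambda>t. (norm (\<gamma> t))\<^sup>2) constant_on I"
    using has_derivative_zero_constant[of I "\<lambda>t. (norm (\<gamma> t))\<^sup>2"] I by (simp add: is_interval_convex_1 constant_on_def)
qed

section \<open>Non-linearizability\<close>

text \<open>An orbital equivalence would map linear orbits, which have period \<open>2\<pi>\<close>, to trajectories of \<open>f X\<close>
  with the same period. In the time of \<open>X\<close> this period is the integral of \<open>f\<close> over a full turn, at
  most \<open>2\<pi>\<close> times the maximum of \<open>f\<close> on a compact neighbourhood of the origin. So the periods of \<open>X\<close>
  on small spheres would be bounded.\<close>

lemma not_linearizable_multicentre_field: "\<not> linearizable_at_0 UNIV multicentre_field"
proof
  assume "linearizable_at_0 UNIV multicentre_field"
  then obtain U W \<phi> and f :: "real ^ 8 \<Rightarrow> real" where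
    U: "open U" "0 \<in> U" and W: "open W" "0 \<in> W"
    and bij: "bij_betw \<phi> U W" and sU: "smooth_on U \<phi>" and sW: "smooth_on W (inv_into U \<phi>)"
    and f0: "\<phi> 0 = 0" and sf: "smooth_on U f" and fpos: "\<And>x. x \<in> U \<Longrightarrow> f x > 0"
    and push: "\<And>y. y \<in> W \<Longrightarrow> pushforward U \<phi> (\<lambda>x. f x *\<^sub>R multicentre_field x) y = times_i y"
    unfolding linearizable_at_0_def orbitally_equivalent_def diffeomorphism_def frechet_multicentre_field_0 by blast
  let ?i = "inv_into U \<phi>"
  have i1: "?i (\<phi> x) = x" if "x \<in> U" for x using bij that by (simp add: bij_betw_inv_into_left)
  have i2: "\<phi> (?i y) = y" "?i y \<in> U" if "y \<in> W" for y
    using bij that by (auto simp: bij_betw_inv_into_right bij_betw_def inv_into_into)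
  have fU: "\<phi> x \<in> W" if "x \<in> U" for x using bij that by (auto simp: bij_betw_def)
  have saU: "smooth_at x \<phi>" "smooth_at x f" if "x \<in> U" for x
    using that sU sf U(1) by (auto simp: smooth_on_iff_smooth_at)
  have saW: "smooth_at y ?i" if "y \<in> W" for y
    using that sW W(1) by (auto simp: smooth_on_iff_smooth_at)
  \<comment> \<open>In the old coordinates the linear orbits are trajectories of \<open>f X\<close>.\<close>
  have di: "frechet_derivative ?i (at y) (times_i y) = f (?i y) *\<^sub>R multicentre_field (?i y)" if y: "y \<in> W" for y
  proof -
    let ?x = "?i y"
    have x: "?x \<in> U" "\<phi> ?x = y" using i2[OF y] by auto
    have "((?i \<circ> \<phi>) has_derivative (frechet_derivative ?i (at y) \<circ> frechet_derivative \<phi> (at ?x))) (at ?x)"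
      using diff_chain_at[OF smooth_at_has_derivative[OF saU(1)[OF x(1)]]] smooth_at_has_derivative[OF saW[OF y]] x(2)
      by simp
    moreover have "((?i \<circ> \<phi>) has_derivative (\<lambda>v. v)) (at ?x)"
      by (rule has_derivative_transform_within_open[OF has_derivative_ident U(1) x(1)]) (simp add: i1)
    ultimately have "frechet_derivative ?i (at y) \<circ> frechet_derivative \<phi> (at ?x) = (\<lambda>v. v)"
      by (rule has_derivative_unique)
    moreover have "frechet_derivative \<phi> (at ?x) (f ?x *\<^sub>R multicentre_field ?x) = times_i y"
      using push[OF y] by (simp add: pushforward_def Let_def)
    ultimately show ?thesis by (metis comp_apply)
  qed
  obtain \<rho> where \<rho>: "\<rho> > 0" "cball 0 \<rho> \<subseteq> W" using W open_contains_cball by blast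
  have cont_i: "continuous_on (cball 0 \<rho>) ?i"
    using \<rho>(2) by (intro continuous_at_imp_continuous_on ballI smooth_at_isCont saW) auto
  have "compact (?i ` cball 0 \<rho>)" by (rule compact_continuous_image[OF cont_i]) simp
  moreover have "continuous_on (?i ` cball 0 \<rho>) f"
    using \<rho>(2) i2 by (intro continuous_at_imp_continuous_on ballI smooth_at_isCont saU(2)) auto
  ultimately have "bounded (f ` ?i ` cball 0 \<rho>)" using compact_continuous_image compact_imp_bounded by blast
  then obtain M where "\<And>z. z \<in> f ` ?i ` cball 0 \<rho> \<Longrightarrow> norm z \<le> M" unfolding bounded_iff by blast
  then have M: "\<bar>f (?i y)\<bar> \<le> M" if "y \<in> cball 0 \<rho>" for y using that by (metis imageI real_norm_def)
  have "isCont \<phi> 0" using saU(1)[OF U(2)] by (rule smooth_at_isCont)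
  then obtain d where d: "d > 0" "\<And>x. dist x 0 < d \<Longrightarrow> dist (\<phi> x) (\<phi> 0) < \<rho>"
    using \<rho>(1) unfolding continuous_at_eps_delta by blast
  obtain d' where d': "d' > 0" "cball 0 d' \<subseteq> U" using U open_contains_cball by blast
  define r where "r = min d d' / 2"
  have r: "r > 0" "r < d" "r < d'" using d(1) d'(1) by (auto simp: r_def min_def)
  have bound: "period_function UNIV multicentre_field p \<le> M * (2 * pi)" if p: "p \<in> sphere 0 r" for p
  proof -
    have np: "norm p = r" using p by simp
    have pU: "p \<in> U" using np r d'(2) by (auto simp: subset_iff)
    have p0: "p \<noteq> 0" using np r by auto
    let ?y0 = "\<phi> p" and ?T = "2 * pi"
    have y0: "norm ?y0 < \<rho>" using d(2)[of p] np r f0 by simp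
    have yb: "phase_rot t ?y0 \<in> cball 0 \<rho>" for t using y0 by (simp add: norm_phase_rot)
    then have yW: "phase_rot t ?y0 \<in> W" for t using \<rho>(2) by blast
    define x where "x t = ?i (phase_rot t ?y0)" for t
    have dx: "(x has_vector_derivative f (x t) *\<^sub>R multicentre_field (x t)) (at t)" for t
    proof -
      have "((\<lambda>t. phase_rot t ?y0) has_derivative (\<lambda>h. h *\<^sub>R times_i (phase_rot t ?y0))) (at t)"
        using phase_rot_has_vector_derivative by (simp add: has_vector_derivative_def)
      from diff_chain_at[OF this smooth_at_has_derivative[OF saW[OF yW[of t]]]]
      show ?thesis
        unfolding has_vector_derivative_def x_def
        by (simp add: o_def di[OF yW] linear_cmul[OF smooth_at_linear_derivative[OF saW[OF yW]]])
    qed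
    have x0: "x 0 = p" "x ?T = p" by (simp_all add: x_def phase_rot_eq i1[OF pU])
    obtain \<gamma> S where g: "first_return \<gamma> p S" using ex_first_return[OF p0] by blast
    have dg: "(\<gamma> has_vector_derivative multicentre_field (\<gamma> t)) (at t)" and g0: "\<gamma> 0 = p" for t
      using first_returnD(1,2)[OF g] by (auto simp: integral_curve_def)
    have cf: "continuous_on {0..?T} (\<lambda>t. f (x t))"
    proof (intro continuous_at_imp_continuous_on ballI)
      fix t
      have "isCont x t" using dx has_vector_derivative_continuous by blast
      moreover have "isCont f (x t)" using i2(2)[OF yW[of t]] by (intro smooth_at_isCont saU(2)) (simp add: x_def)
      ultimately show "isCont (\<lambda>t. f (x t)) t" by (rule isCont_o2)
    qed
    \<comment> \<open>The time of the original field, as a function of the time of the linear one.\<close>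
    define \<tau> where "\<tau> u = integral {0..u} (\<lambda>t. f (x t))" for u
    have d\<tau>: "(\<tau> has_vector_derivative f (x t)) (at t within {0..?T})" if "t \<in> {0..?T}" for t
      unfolding \<tau>_def by (rule integral_has_vector_derivative[OF cf that])
    have "x ?T = \<gamma> (\<tau> ?T)"
    proof (rule ode_unique[OF smooth_on_multicentre_field, of ?T x "\<lambda>t. f (x t)" "\<lambda>t. \<gamma> (\<tau> t)" M])
      show "(x has_vector_derivative f (x t) *\<^sub>R multicentre_field (x t)) (at t within {0..?T})" for t
        using dx by (rule has_vector_derivative_at_within)
      show "((\<lambda>t. \<gamma> (\<tau> t)) has_vector_derivative f (x t) *\<^sub>R multicentre_field (\<gamma> (\<tau> t))) (at t within {0..?T})"
        if "t \<in> {0..?T}" for t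
        using vector_diff_chain_within[OF d\<tau>[OF that], of \<gamma> "multicentre_field (\<gamma> (\<tau> t))"] dg
        by (auto simp: o_def intro: has_vector_derivative_at_within)
      show "\<bar>f (x t)\<bar> \<le> M" for t using M[OF yb] by (simp add: x_def)
      show "x 0 = \<gamma> (\<tau> 0)" by (simp add: x0 \<tau>_def g0)
    qed simp
    then have ret: "\<gamma> (\<tau> ?T) = p" using x0 by simp
    have int: "((\<lambda>t. f (x t)) has_integral \<tau> ?T) {0..?T}"
      unfolding \<tau>_def using integrable_continuous_real[OF cf] by (rule integrable_integral)
    have "\<tau> ?T \<le> M * ?T"
    proof -
      have "((\<lambda>t. M) has_integral M * ?T) {0..?T}" using has_integral_const_real[of M 0 ?T] by (simp add: mult.commute)
      from has_integral_le[OF int this] show ?thesis using M[OF yb] by (auto simp: x_def abs_le_iff)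
    qed
    moreover have "\<tau> ?T > 0"
    proof -
      have "\<exists>t\<in>{0..?T}. \<forall>s\<in>{0..?T}. f (x t) \<le> f (x s)"
        by (rule continuous_attains_inf[OF _ _ cf]) auto
      then obtain t where t: "\<And>s. s \<in> {0..?T} \<Longrightarrow> f (x t) \<le> f (x s)" by blast
      have "((\<lambda>s. f (x t)) has_integral f (x t) * ?T) {0..?T}"
        using has_integral_const_real[of "f (x t)" 0 ?T] by (simp add: mult.commute)
      from has_integral_le[OF this int] t have "f (x t) * ?T \<le> \<tau> ?T" by auto
      moreover have "f (x t) > 0" using i2(2)[OF yW[of t]] by (intro fpos) (simp add: x_def)
      ultimately show ?thesis by (smt (verit) mult_pos_pos pi_gt_zero)
    qed
    ultimately show ?thesis
      using period_function_multicentre_field_le[OF p0 _ g0 ret] first_returnD(1)[OF g] by linarith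
  qed
  then have "bdd_above (period_function UNIV multicentre_field ` sphere 0 r)" by (rule bdd_aboveI2)
  then show False using period_function_unbounded[OF r(1)] by blast
qed

lemma nondegenerate_multicentre_field: "nondegenerate_multicentre UNIV multicentre_field"
  unfolding nondegenerate_multicentre_def
proof (intro conjI)
  show "\<exists>n>1. CARD(8) = 2 * n" by (intro exI[of _ 4]) simp
  show "Ck_on 1 UNIV multicentre_field" using smooth_on_multicentre_field by (simp add: smooth_on_def)
  show "generates_nondegenerate_rotations (matrix (frechet_derivative multicentre_field (at 0)))"
    unfolding frechet_multicentre_field_0 by (rule generates_nondegenerate_rotations_times_i)
  have "\<exists>\<gamma>. periodic_trajectory (UNIV - {0}) multicentre_field \<gamma> \<and> \<gamma> 0 = p" if p: "p \<in> UNIV - {0}" for p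
  proof -
    obtain \<gamma> T where g: "first_return \<gamma> p T" using ex_first_return[of p] p by blast
    note c = first_returnD(1)[OF g] and g0 = first_returnD(2)[OF g] and T = first_returnD(3,4)[OF g]
      and ne = first_returnD(5)[OF g]
    have "(\<lambda>t. (norm (\<gamma> t))\<^sup>2) constant_on UNIV"
      using first_integral_norm_sq c by (auto simp: first_integral_def)
    then have "norm (\<gamma> t) = norm p" for t
      using g0 by (auto simp: constant_on_def) (metis norm_ge_zero power2_eq_iff_nonneg)
    then have nz: "\<gamma> t \<noteq> 0" for t using p by (metis DiffD2 insertI1 norm_eq_zero)
    have "integral_curve (UNIV - {0}) multicentre_field UNIV \<gamma>" using c nz by (simp add: integral_curve_def)
    moreover have "\<not> \<gamma> constant_on UNIV"
    proof
      assume "\<gamma> constant_on UNIV"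
      then have "\<gamma> (T/2) = \<gamma> 0" by (auto simp: constant_on_def)
      then show False using ne[of "T/2"] T(1) g0 by simp
    qed
    ultimately show ?thesis using T g0 unfolding periodic_trajectory_def by blast
  qed
  then show "\<exists>U. open U \<and> 0 \<in> U \<and> U \<subseteq> UNIV \<and> (\<forall>p\<in>U - {0}. \<exists>\<gamma>. periodic_trajectory (U - {0}) multicentre_field \<gamma> \<and> \<gamma> 0 = p)"
    by (intro exI[of _ UNIV]) auto
qed (auto simp: multicentre_field_0)

theorem theorem1p3:
  shows "\<exists>(V :: (real ^ 8) set) (X :: real ^ 8 \<Rightarrow> real ^ 8).
           open V \<and> 0 \<in> V \<and> smooth_on V X \<and>
           nondegenerate_multicentre V X \<and>
           \<not> linearizable_at_0 V X \<and>
           (\<exists>H :: real ^ 8 \<Rightarrow> real.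
              real_analytic_on V H \<and> first_integral V X H \<and>
              {x \<in> V. H x = H 0} = {0} \<and>
              (\<forall>p\<in>V - {0}. \<exists>r>0. {x \<in> V. H x = H p} = sphere 0 r)) \<and>
           (\<exists>\<epsilon>>0. \<forall>r. 0 < r \<and> r < \<epsilon> \<longrightarrow>
              \<not> bdd_above (period_function V X ` sphere 0 r))"
proof (intro exI[of _ UNIV] exI[of _ multicentre_field] conjI)
  show "\<exists>H :: real ^ 8 \<Rightarrow> real.
      real_analytic_on UNIV H \<and> first_integral UNIV multicentre_field H \<and>
      {x \<in> UNIV. H x = H 0} = {0} \<and>
      (\<forall>p\<in>UNIV - {0}. \<exists>r>0. {x \<in> UNIV. H x = H p} = sphere 0 r)"
  proof (intro exI[of _ "\<lambda>x. (norm x)\<^sup>2"] conjI ballI)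
    show "real_analytic_on UNIV (\<lambda>x :: real ^ 8. (norm x)\<^sup>2)" by (rule real_analytic_norm_sq)
    show "first_integral UNIV multicentre_field (\<lambda>x. (norm x)\<^sup>2)" by (rule first_integral_norm_sq)
    fix p :: "real ^ 8" assume "p \<in> UNIV - {0}"
    then show "\<exists>r>0. {x \<in> UNIV. (norm x)\<^sup>2 = (norm p)\<^sup>2} = sphere 0 r"
      by (intro exI[of _ "norm p"]) auto
  qed auto
  show "\<exists>\<epsilon>>0. \<forall>r. 0 < r \<and> r < \<epsilon> \<longrightarrow> \<not> bdd_above (period_function UNIV multicentre_field ` sphere 0 r)"
    using period_function_unbounded by (intro exI[of _ 1]) auto
qed (use smooth_on_multicentre_field nondegenerate_multicentre_field not_linearizable_multicentre_field in auto)

end
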